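(* Assume that the block Jacobi operator $J$ is self-adjoint, let $G\subset\mathbb{R}$ be a non-empty Borel set, and let $\mathfrak{b}$ be a barrier for $J$ on $G$. If $J$ is $\mathfrak{b}$-nonsubordinate on $G$, then: (a) the spectral matrix measure $M$ of $J$ is absolutely continuous on $G$; (b) there exists a density $D$ of $M$ on $G$ such that $D(\lambda)$ is an invertible matrix for a.e. $\lambda\in G$; (c) $J$ is absolutely continuous in $G$, and the essential closure of $G$ is contained in $\sigma_{\mathrm{ac}}(J)$. If, moreover, $J$ is uniformly $\mathfrak{b}$-nonsubordinate on $G$, then there exist $c_1,c_2>0$ such that the density $D$ of $M$ on $G$ satisfies $c_1\operatorname{I}\le D(\lambda)\le c_2\operatorname{I}$ for a.e. $\lambda\in G$.
   Context: Setting. Fix $d\in\mathbb{N}$, $d\ge 1$, and sequences $(A_n)_{n\ge 0}$, $(B_n)_{n\ge 0}$ of complex $d\times d$ matrices with $\det A_n\neq 0$ and $B_n=B_n^*$ for all $n\ge 0$. Put $A_{-1}:=-\operatorname{I}$. For a sequence $u=(u_n)_{n\ge0}$ in $\mathbb{C}^d$ set $(\mathcal{J}u)_0=B_0u_0+A_0u_1$ and $(\mathcal{J}u)_n=A_{n-1}^*u_{n-1}+B_nu_n+A_nu_{n+1}$ for $n\ge1$. The (maximal) block Jacobi operator $J$ in the Hilbert space $\ell^2(\mathbb{N}_0,\mathbb{C}^d)$ is the restriction of $\mathcal{J}$ to $\operatorname{Dom}(J)=\{u\in\ell^2(\mathbb{N}_0,\mathbb{C}^d):\mathcal{J}u\in\ell^2(\mathbb{N}_0,\mathbb{C}^d)\}$.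 Spectral matrix measure. For $v\in\mathbb{C}^d$, $\delta_0(v)$ is the sequence with value $v$ at position $0$ and $0$ elsewhere; $e_1,\dots,e_d$ is the standard basis of $\mathbb{C}^d$. For self-adjoint $J$ with projection-valued spectral measure $E_J$, set $M(\omega)=\big(\langle E_J(\omega)\delta_0(e_j),\delta_0(e_i)\rangle\big)_{i,j=1,\dots,d}$ for Borel $\omega\subset\mathbb{R}$. Absolute continuity and "a.e." are with respect to Lebesgue measure $|\cdot|$ on $\mathbb{R}$. A density of $M$ on $G$ is a measurable matrix function $D$ on $G$ (defined a.e.) with $M(\omega)=\int_\omega D\,d\lambda$ for all Borel $\omega\subset G$. "$J$ is absolutely continuous in $G$" means $\operatorname{Ran}E_J(G)\subset\mathcal{H}_{\mathrm{ac}}(J):=\{x:\ \omega\mapsto\langle E_J(\omega)x,x\rangle\text{ is absolutely continuous}\}$. The essential closure of $G$ is $\{t\in\mathbb{R}:\forall\varepsilon>0\ |G\cap(t-\varepsilon,t+\varepsilon)|>0\}$. Inequalities between Hermitian matrices are in the sense of quadratic forms. Extended matrix generalized eigenvectors (emgev). For $\lambda\in\mathbb{C}$, an emgev for $J$ and $\lambda$ is a sequence $U=(U_n)_{n\ge-1}$ of complex $d\times d$ matrices with $A_{n-1}^*U_{n-1}+B_nU_n+A_nU_{n+1}=\lambda U_n$ for all $n\ge0$. For a sequence $X$ of matrices and real $t\ge0$, with the operator norm $\|\cdot\|$ (Euclidean norm on $\mathbb{C}^d$), $\|X\|_{[0,t]}=\Big(\sum_{k=0}^{\lfloor t\rfloor}\|X_k\|^2+\{t\}\,\|X_{\lfloor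 t\rfloor+1}\|^2\Big)^{1/2}$, where $\{t\}=t-\lfloor t\rfloor$. Barriers. For non-empty $G\subset\mathbb{R}$, a function $\mathfrak{b}:G\times[1,+\infty)\to\mathbb{R}$ is a barrier (for $J$ on $G$) if for any $\lambda\in G$ and any two emgevs $U,V$ for $J$ and $\lambda$ with $\|U_{-1}\|^2+\|U_0\|^2=\|V_{-1}\|^2+\|V_0\|^2=1$ one has $\big(\|U\|_{[0,t]}/\|V\|_{[0,t]}\big)^2\le\mathfrak{b}(\lambda,t)$ for all $t\ge1$. $J$ is $\mathfrak{b}$-nonsubordinate on $G$ if $\liminf_{t\to\infty}\mathfrak{b}(\lambda,t)<+\infty$ for every $\lambda\in G$, and uniformly $\mathfrak{b}$-nonsubordinate on $G$ if $\sup_{\lambda\in G}\liminf_{t\to+\infty}\mathfrak{b}(\lambda,t)<+\infty$. *)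

theory Defs
  imports "HOL-Analysis.Analysis"
begin

section \<open>Complex vectors and matrices\<close>

text \<open>Inner products are linear in the first argument.\<close>

definition cinner :: "complex^'d \<Rightarrow> complex^'d \<Rightarrow> complex" where
  "cinner v w = (\<Sum>i\<in>UNIV. v $ i * cnj (w $ i))"

definition adj :: "complex^'d^'d \<Rightarrow> complex^'d^'d" where
  "adj X = (\<chi> i j. cnj (X $ j $ i))"

definition hermitian :: "complex^'d^'d \<Rightarrow> bool" where
  "hermitian X \<longleftrightarrow> adj X = X"

definition herm_le :: "complex^'d^'d \<Rightarrow> complex^'d^'d \<Rightarrow> bool" where
  "herm_le X Y \<longleftrightarrow> hermitian X \<and> hermitian Y \<and>
     (\<forall>v. Re (cinner (X *v v) v) \<le> Re (cinner (Y *v v) v))"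

text \<open>The library norm on the type of matrices is the Frobenius norm; here the operator
  norm induced by the Euclidean norm is needed.\<close>

definition mat_opnorm :: "complex^'d^'d \<Rightarrow> real" where
  "mat_opnorm X = onorm (\<lambda>v. X *v v)"


section \<open>Square-summable sequences and unbounded operators\<close>

type_synonym 'd vseq = "nat \<Rightarrow> complex^'d"

definition ell2 :: "('d::finite) vseq set" where
  "ell2 = {u. summable (\<lambda>n. (norm (u n))\<^sup>2)}"

definition ell2_inner :: "('d::finite) vseq \<Rightarrow> 'd vseq \<Rightarrow> complex" where
  "ell2_inner u v = (\<Sum>n. cinner (u n) (v n))"

definition ell2_norm :: "('d::finite) vseq \<Rightarrow> real" where
  "ell2_norm u = sqrt (\<Sum>n. (norm (u n))\<^sup>2)"

definition delta0 :: "complex^'d \<Rightarrow> 'd vseq" where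
  "delta0 v = (\<lambda>n. if n = 0 then v else 0)"

text \<open>An operator is a pair of its domain and a map that matters only on the domain.\<close>

type_synonym 'd vop = "'d vseq set \<times> ('d vseq \<Rightarrow> 'd vseq)"

definition op_graph :: "('d::finite) vop \<Rightarrow> ('d vseq \<times> 'd vseq) set" where
  "op_graph T = {(u, snd T u) | u. u \<in> fst T}"

definition adjoint_graph :: "('d::finite) vop \<Rightarrow> ('d vseq \<times> 'd vseq) set" where
  "adjoint_graph T = {(v, w). v \<in> ell2 \<and> w \<in> ell2 \<and>
     (\<forall>u\<in>fst T. ell2_inner (snd T u) v = ell2_inner u w)}"

definition densely_defined :: "('d::finite) vop \<Rightarrow> bool" where
  "densely_defined T \<longleftrightarrow> fst T \<subseteq> ell2 \<and>
     (\<forall>u\<in>ell2. \<forall>\<epsilon>>0. \<exists>v\<in>fst T. ell2_norm (\<lambda>n. u n - v n) < \<epsilon>)"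

definition selfadjoint :: "('d::finite) vop \<Rightarrow> bool" where
  "selfadjoint T \<longleftrightarrow> densely_defined T \<and> op_graph T = adjoint_graph T"

text \<open>Spectrum of an operator acting in the Hilbert space \<open>K\<close>, a closed subspace of
  \<^const>\<open>ell2\<close>.\<close>

definition spectrum_in :: "('d::finite) vseq set \<Rightarrow> 'd vop \<Rightarrow> complex set" where
  "spectrum_in K T = - {z.
     bij_betw (\<lambda>u n. snd T u n - z *s u n) (fst T) K \<and>
     (\<exists>C. \<forall>u\<in>fst T. ell2_norm u \<le> C * ell2_norm (\<lambda>n. snd T u n - z *s u n))}"


section \<open>Projection-valued measures\<close>

definition ortho_projection :: "(('d::finite) vseq \<Rightarrow> 'd vseq) \<Rightarrow> bool" where
  "ortho_projection P \<longleftrightarrow>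
     (\<forall>x\<in>ell2. P x \<in> ell2 \<and> P (P x) = P x) \<and>
     (\<forall>x\<in>ell2. \<forall>y\<in>ell2. \<forall>a. P (\<lambda>n. a *s x n + y n) = (\<lambda>n. a *s P x n + P y n)) \<and>
     (\<forall>x\<in>ell2. \<forall>y\<in>ell2. ell2_inner (P x) y = ell2_inner x (P y))"

text \<open>Countable additivity is in the strong operator topology.\<close>

definition proj_valued_measure ::
    "(real set \<Rightarrow> ('d::finite) vseq \<Rightarrow> 'd vseq) \<Rightarrow> bool" where
  "proj_valued_measure E \<longleftrightarrow>
     (\<forall>\<omega>\<in>sets borel. ortho_projection (E \<omega>)) \<and>
     (\<forall>x\<in>ell2. E UNIV x = x) \<and>
     (\<forall>\<omega>\<in>sets borel. \<forall>\<omega>'\<in>sets borel. \<forall>x\<in>ell2. E (\<omega> \<inter> \<omega>') x = E \<omega> (E \<omega>' x)) \<and>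
     (\<forall>W :: nat \<Rightarrow> real set. range W \<subseteq> sets borel \<longrightarrow> disjoint_family W \<longrightarrow>
        (\<forall>x\<in>ell2. (\<lambda>N. ell2_norm (\<lambda>n. E (\<Union>k. W k) x n - (\<Sum>k<N. E (W k) x n)))
           \<longlonglongrightarrow> 0))"

definition scalar_measure ::
    "(real set \<Rightarrow> ('d::finite) vseq \<Rightarrow> 'd vseq) \<Rightarrow> 'd vseq \<Rightarrow> real measure" where
  "scalar_measure E x =
     measure_of UNIV (sets borel) (\<lambda>\<omega>. ennreal (Re (ell2_inner (E \<omega> x) x)))"

text \<open>\<open>E\<close> is the projection-valued measure with \<open>T = \<integral> t dE(t)\<close>: the domain of \<open>T\<close> consists
  of the \<open>x\<close> for which the second moment of \<open>\<langle>E(\<cdot>)x, x\<rangle>\<close> is finite, and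
  \<open>\<langle>Tx, x\<rangle> = \<integral> t d\<langle>E(t)x, x\<rangle>\<close> there (which, by polarization, determines \<open>T\<close>).\<close>

definition spectral_measure_of ::
    "('d::finite) vop \<Rightarrow> (real set \<Rightarrow> 'd vseq \<Rightarrow> 'd vseq) \<Rightarrow> bool" where
  "spectral_measure_of T E \<longleftrightarrow> proj_valued_measure E \<and>
     fst T = {x \<in> ell2. integrable (scalar_measure E x) (\<lambda>t. t\<^sup>2)} \<and>
     (\<forall>x\<in>fst T. ell2_inner (snd T x) x = complex_of_real (\<integral>t. t \<partial>scalar_measure E x))"

definition H_ac :: "(real set \<Rightarrow> ('d::finite) vseq \<Rightarrow> 'd vseq) \<Rightarrow> 'd vseq set" where
  "H_ac E = {x \<in> ell2. absolutely_continuous lborel (scalar_measure E x)}"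

definition abs_cont_in :: "(real set \<Rightarrow> ('d::finite) vseq \<Rightarrow> 'd vseq) \<Rightarrow> real set \<Rightarrow> bool" where
  "abs_cont_in E G \<longleftrightarrow> E G ` ell2 \<subseteq> H_ac E"

text \<open>The absolutely continuous spectrum is the spectrum of the part of \<open>T\<close> in \<^term>\<open>H_ac E\<close>.\<close>

definition ac_spectrum ::
    "('d::finite) vop \<Rightarrow> (real set \<Rightarrow> 'd vseq \<Rightarrow> 'd vseq) \<Rightarrow> complex set" where
  "ac_spectrum T E = spectrum_in (H_ac E) (fst T \<inter> H_ac E, snd T)"

definition ess_closure :: "real set \<Rightarrow> real set" where
  "ess_closure G = {t. \<forall>\<epsilon>>0. emeasure lborel (G \<inter> {t - \<epsilon><..<t + \<epsilon>}) > 0}"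


section \<open>The spectral matrix measure\<close>

definition matrix_measure ::
    "(real set \<Rightarrow> ('d::finite) vseq \<Rightarrow> 'd vseq) \<Rightarrow> real set \<Rightarrow> complex^'d^'d" where
  "matrix_measure E \<omega> =
     (\<chi> i j. ell2_inner (E \<omega> (delta0 (axis j 1))) (delta0 (axis i 1)))"

definition matrix_abs_cont_on :: "(real set \<Rightarrow> complex^('d::finite)^'d) \<Rightarrow> real set \<Rightarrow> bool" where
  "matrix_abs_cont_on M G \<longleftrightarrow> (\<forall>\<omega>\<in>null_sets lborel. \<omega> \<subseteq> G \<longrightarrow> M \<omega> = 0)"

definition matrix_density_on ::
    "(real set \<Rightarrow> complex^('d::finite)^'d) \<Rightarrow> real set \<Rightarrow> (real \<Rightarrow> complex^'d^'d) \<Rightarrow> bool" where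
  "matrix_density_on M G D \<longleftrightarrow> set_borel_measurable lborel G D \<and>
     (\<forall>\<omega>\<in>sets borel. \<omega> \<subseteq> G \<longrightarrow>
        set_integrable lborel \<omega> D \<and> M \<omega> = set_lebesgue_integral lborel \<omega> D)"


section \<open>Block Jacobi operators\<close>

definition jacobi_expr ::
    "(nat \<Rightarrow> complex^'d^'d) \<Rightarrow> (nat \<Rightarrow> complex^'d^'d) \<Rightarrow> 'd vseq \<Rightarrow> ('d::finite) vseq" where
  "jacobi_expr A B u n = (case n of
       0 \<Rightarrow> B 0 *v u 0 + A 0 *v u 1
     | Suc m \<Rightarrow> adj (A m) *v u m + B n *v u n + A n *v u (n + 1))"

definition jacobi_op ::
    "(nat \<Rightarrow> complex^'d^'d) \<Rightarrow> (nat \<Rightarrow> complex^'d^'d) \<Rightarrow> ('d::finite) vop" where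
  "jacobi_op A B = ({u \<in> ell2. jacobi_expr A B u \<in> ell2}, jacobi_expr A B)"


section \<open>Extended matrix generalized eigenvectors and barriers\<close>

text \<open>\<open>prev_coeff A n\<close> is $A_{n-1}$, with the convention $A_{-1} = -I$.\<close>

definition prev_coeff :: "(nat \<Rightarrow> complex^'d^'d) \<Rightarrow> nat \<Rightarrow> complex^('d::finite)^'d" where
  "prev_coeff A n = (case n of 0 \<Rightarrow> - mat 1 | Suc m \<Rightarrow> A m)"

text \<open>Sequences indexed by \<open>{-1, 0, 1, \<dots>}\<close> are functions on the integers whose values below \<open>-1\<close>
  are irrelevant.\<close>

definition emgev ::
    "(nat \<Rightarrow> complex^'d^'d) \<Rightarrow> (nat \<Rightarrow> complex^'d^'d) \<Rightarrow> complex \<Rightarrow>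
     (int \<Rightarrow> complex^('d::finite)^'d) \<Rightarrow> bool" where
  "emgev A B z U \<longleftrightarrow> (\<forall>n::nat.
     adj (prev_coeff A n) ** U (int n - 1) + B n ** U (int n) + A n ** U (int n + 1)
       = mat z ** U (int n))"

definition trunc_norm :: "(int \<Rightarrow> complex^('d::finite)^'d) \<Rightarrow> real \<Rightarrow> real" where
  "trunc_norm X t = sqrt ((\<Sum>k\<in>{0..\<lfloor>t\<rfloor>}. (mat_opnorm (X k))\<^sup>2)
     + frac t * (mat_opnorm (X (\<lfloor>t\<rfloor> + 1)))\<^sup>2)"

definition normalized_start :: "(int \<Rightarrow> complex^('d::finite)^'d) \<Rightarrow> bool" where
  "normalized_start U \<longleftrightarrow> (mat_opnorm (U (-1)))\<^sup>2 + (mat_opnorm (U 0))\<^sup>2 = 1"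

text \<open>Only the values of \<open>b\<close> on \<open>G \<times> [1, \<infinity>)\<close> matter.\<close>

definition barrier ::
    "(nat \<Rightarrow> complex^('d::finite)^'d) \<Rightarrow> (nat \<Rightarrow> complex^'d^'d) \<Rightarrow> real set \<Rightarrow>
     (real \<Rightarrow> real \<Rightarrow> real) \<Rightarrow> bool" where
  "barrier A B G b \<longleftrightarrow> (\<forall>l\<in>G. \<forall>U V.
     emgev A B (complex_of_real l) U \<longrightarrow> emgev A B (complex_of_real l) V \<longrightarrow>
     normalized_start U \<longrightarrow> normalized_start V \<longrightarrow>
     (\<forall>t\<ge>1. (trunc_norm U t / trunc_norm V t)\<^sup>2 \<le> b l t))"

definition nonsubordinate :: "(real \<Rightarrow> real \<Rightarrow> real) \<Rightarrow> real set \<Rightarrow> bool" where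
  "nonsubordinate b G \<longleftrightarrow> (\<forall>l\<in>G. Liminf at_top (\<lambda>t. ereal (b l t)) < \<infinity>)"

definition uniformly_nonsubordinate :: "(real \<Rightarrow> real \<Rightarrow> real) \<Rightarrow> real set \<Rightarrow> bool" where
  "uniformly_nonsubordinate b G \<longleftrightarrow> (SUP l\<in>G. Liminf at_top (\<lambda>t. ereal (b l t))) < \<infinity>"

end

theory Submission
  imports Defs
begin

text \<open>For \<open>l \<in> G\<close> and \<open>t\<close> with \<open>b l t\<close> bounded, all normalised solutions of
  \<open>\<J>u = lu\<close> have truncated norms comparable to \<open>T\<^sup>1\<^sup>/\<^sup>2\<close>, where \<open>T \<rightarrow> \<infinity>\<close> since \<open>J\<close> is
  self-adjoint. Put \<open>e = 1 / T\<close>.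

  Upper bound: a vector \<open>x\<close> in the range of \<open>E [l - e, l + e]\<close> satisfies \<open>\<parallel>(J - l) x\<parallel> \<le> e \<parallel>x\<parallel>\<close>,
  so up to index \<open>t\<close> it is a small perturbation of a solution; hence \<open>\<bar>x\<^sub>0\<bar>\<^sup>2 \<le> K e \<parallel>x\<parallel>\<^sup>2\<close>, which says
  that \<open>\<langle>M [l - e, l + e] v, v\<rangle> \<le> K e \<bar>v\<bar>\<^sup>2\<close>.

  Lower bound: there is a finitely supported \<open>y\<close> with \<open>y\<^sub>0 = v\<close>, \<open>\<parallel>y\<parallel>\<^sup>2 \<le> K \<bar>v\<bar>\<^sup>2 / e\<close> and
  \<open>\<parallel>(J - l) y\<parallel>\<^sup>2 \<le> K e \<bar>v\<bar>\<^sup>2\<close>; expanding \<open>\<langle>\<delta>\<^sub>0 v, y\<rangle> = \<bar>v\<bar>\<^sup>2\<close> over geometric annuli around \<open>l\<close> bounds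
  from below a Poisson-type average of \<open>\<langle>M(\<cdot>) v, v\<rangle>\<close> at scale \<open>e\<close>.

  Both bounds hold along a sequence \<open>e \<rightarrow> 0\<close>. By Vitali's covering lemma the first one gives
  absolute continuity and an upper bound of the density, the second one a positive lower bound
  almost everywhere.\<close>

section \<open>Differentiation of measures on the line\<close>

text \<open>The scales at which the two bounds hold depend on the point and may be arbitrarily
  sparse, and nothing says that the spectral measure is doubling. For the upper bound this is
  harmless: the doubling is put on the Lebesgue side. The lower bound is used by contradiction: at
  almost every point where the density is below \<open>c\<close>, the measure is small on all small
  balls, so the average is too small at every small scale. An average instead of the mass of one
  ball is forced because \<open>y\<close> lies in no spectral subspace; its far components are
  damped since \<open>J - l\<close> is large there. The quality of both bounds is the ratio
  \<open>T / m\<close> between an upper and a lower bound for the growth of solutions, which the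
  barrier bounds independently of \<open>t\<close>. Hence the final constants depend only on the
  dimension and on the bound for the barrier. The analysis takes place in real inner product spaces,
  since real parts of inner products and quadratic forms suffice; complex scalars return with the
  entries of \<open>M\<close>. Passing from \<open>M\<close> to the whole spectral measure rests on
  the vectors \<open>\<delta> 0 v\<close> being cyclic.\<close>

text \<open>Disjoint balls inside \<open>U\<close> are selected whose fivefold enlargements cover
  \<open>S\<close>; the hypothesis pays for each enlargement with the \<open>M\<close>-mass of its
  ball, and these masses add up inside \<open>U\<close>. A Borel superset \<open>T\<close> appears
  because \<open>S\<close> may be non-measurable. The two measures are kept apart since the Lebesgue
  measure will be used in either role.\<close>

lemma vitali_emeasure_bound:
  fixes M N :: "'b::euclidean_space measure"
  assumes [measurable_cong]: "sets M = sets borel" "sets N = sets borel"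
    and "open U" "S \<subseteq> U"
    and bound: "\<And>x d. x \<in> S \<Longrightarrow> d > 0 \<Longrightarrow>
      \<exists>r>0. r < d \<and> emeasure N (ball x (5 * r)) \<le> c * emeasure M (ball x r)"
  shows "\<exists>T\<in>sets borel. S \<subseteq> T \<and> emeasure N T \<le> c * emeasure M U"
proof -
  define K where "K = {(x, r). x \<in> S \<and> 0 < r \<and> r \<le> 1 \<and> ball x r \<subseteq> U \<and>
    emeasure N (ball x (5 * r)) \<le> c * emeasure M (ball x r)}"
  have "S \<subseteq> (\<Union>i\<in>K. ball (fst i) (snd i))"
  proof
    fix x assume x: "x \<in> S"
    then obtain d where d: "d > 0" "ball x d \<subseteq> U"
      using \<open>open U\<close> \<open>S \<subseteq> U\<close> open_contains_ball by blast
    obtain r where r: "r > 0" "r < min d 1"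
      "emeasure N (ball x (5 * r)) \<le> c * emeasure M (ball x r)"
      using bound[OF x, of "min d 1"] d by auto
    have "(x, r) \<in> K"
      using x r d by (auto simp: K_def)
    then show "x \<in> (\<Union>i\<in>K. ball (fst i) (snd i))"
      using r by force
  qed
  moreover have "0 < snd i \<and> snd i \<le> 1" if "i \<in> K" for i
    using that by (auto simp: K_def)
  ultimately obtain C where C: "countable C" "C \<subseteq> K"
    and disj: "pairwise (\<lambda>i j. disjnt (ball (fst i) (snd i)) (ball (fst j) (snd j))) C"
    and cov: "S \<subseteq> (\<Union>i\<in>C. ball (fst i) (5 * snd i))"
    by (rule Vitali_covering_lemma_balls) (blast intro: that)+
  define A where "A s n = (\<Union>i\<in>{i\<in>C. to_nat_on C i = n}. ball (fst i) (s * snd i))" for s :: real and n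
  have A_cases: "(\<exists>i\<in>C. to_nat_on C i = n \<and> (\<forall>s. A s n = ball (fst i) (s * snd i))) \<or> (\<forall>s. A s n = {})" for n
  proof (cases "\<exists>i\<in>C. to_nat_on C i = n")
    case True
    then obtain i where i: "i \<in> C" "to_nat_on C i = n" by blast
    have "{i\<in>C. to_nat_on C i = n} = {i}"
      using i C(1) by (auto simp: to_nat_on_inj)
    then show ?thesis using i by (auto simp: A_def)
  qed (auto simp: A_def)
  have meas: "A s n \<in> sets borel" for s n
    using A_cases[of n] by (metis borel_open open_ball sets.empty_sets)
  have le: "emeasure N (A 5 n) \<le> c * emeasure M (A 1 n)" for n
    using A_cases[of n]
  proof
    assume "\<exists>i\<in>C. to_nat_on C i = n \<and> (\<forall>s. A s n = ball (fst i) (s * snd i))"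
    then obtain i where "i \<in> C" "\<And>s. A s n = ball (fst i) (s * snd i)" by blast
    then show ?thesis using C(2) by (auto simp: K_def)
  qed auto
  have dis: "disjoint_family (A 1)"
    unfolding disjoint_family_on_def
  proof (intro ballI impI)
    fix m n :: nat assume "m \<noteq> n"
    have False if x: "x \<in> A 1 m" "x \<in> A 1 n" for x
    proof -
      obtain i j where "i \<in> C" "j \<in> C" "to_nat_on C i = m" "to_nat_on C j = n"
        and x: "x \<in> ball (fst i) (snd i)" "x \<in> ball (fst j) (snd j)"
        using x by (auto simp: A_def)
      then have "disjnt (ball (fst i) (snd i)) (ball (fst j) (snd j))"
        using disj \<open>m \<noteq> n\<close> by (auto simp: pairwise_def)
      then show False using x unfolding disjnt_def by blast
    qed
    then show "A 1 m \<inter> A 1 n = {}" by blast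
  qed
  have sub: "(\<Union>n. A 1 n) \<subseteq> U"
  proof -
    have "\<forall>i\<in>K. ball (fst i) (snd i) \<subseteq> U"
      unfolding K_def by auto
    then have "ball (fst i) (snd i) \<subseteq> U" if "i \<in> C" for i
      using C(2) that by blast
    then show ?thesis by (auto simp: A_def)
  qed
  show ?thesis
  proof (intro bexI conjI)
    show "S \<subseteq> (\<Union>n. A 5 n)"
      unfolding A_def using cov by blast
    have "emeasure N (\<Union>n. A 5 n) \<le> (\<Sum>n. emeasure N (A 5 n))"
      using meas by (intro emeasure_subadditive_countably) (auto simp: assms)
    also have "\<dots> \<le> (\<Sum>n. c * emeasure M (A 1 n))"
      by (intro suminf_le le) auto
    also have "\<dots> = c * emeasure M (\<Union>n. A 1 n)"
      using meas dis by (subst suminf_emeasure[symmetric]) (auto simp: assms)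
    also have "\<dots> \<le> c * emeasure M U"
      using sub \<open>open U\<close> by (intro mult_left_mono emeasure_mono) (auto simp: assms)
    finally show "emeasure N (\<Union>n. A 5 n) \<le> c * emeasure M U" .
  qed (use meas in auto)
qed

lemma lborel_ball_real: "r \<ge> 0 \<Longrightarrow> emeasure lborel (ball x r) = ennreal (2 * r)" for x r :: real
  by (simp add: ball_eq_greaterThanLessThan)

text \<open>The ball of radius \<open>r\<close> is the fivefold enlargement of one of radius
  \<open>r / 5\<close>, whose length is \<open>2 * r / 5\<close>; this is the origin of
  \<open>5 / 2\<close>. Outer regularity of the Lebesgue measure then shrinks the open set to
  \<open>S\<close>.\<close>

lemma measure_le_of_frequently_ball_le:
  fixes \<mu> :: "real measure"
  assumes [measurable_cong]: "sets \<mu> = sets borel" and "S \<in> sets borel" "c \<ge> 0"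
    and bound: "\<And>x d. x \<in> S \<Longrightarrow> d > 0 \<Longrightarrow> \<exists>r>0. r < d \<and> emeasure \<mu> (ball x r) \<le> ennreal (c * r)"
  shows "emeasure \<mu> S \<le> ennreal (5 / 2 * c) * emeasure lborel S"
proof -
  have *: "\<exists>r>0. r < d \<and> emeasure \<mu> (ball x (5 * r)) \<le> ennreal (5 / 2 * c) * emeasure lborel (ball x r)"
    if x: "x \<in> S" and d: "d > 0" for x d
  proof -
    obtain r where r: "r > 0" "r < 5 * d" "emeasure \<mu> (ball x r) \<le> ennreal (c * r)"
      using bound[OF x, of "5 * d"] d by auto
    have "ennreal (c * r) = ennreal (5 / 2 * c) * emeasure lborel (ball x (r / 5))"
      using r \<open>c \<ge> 0\<close> by (simp add: lborel_ball_real ennreal_mult[symmetric])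
    then show ?thesis
      using r by (intro exI[of _ "r / 5"]) auto
  qed
  have "emeasure \<mu> S \<le> ennreal (5 / 2 * c) * emeasure lborel S + ennreal (5 / 2 * c * e)" if "e > 0" for e
  proof -
    obtain U where U: "open U" "S \<subseteq> U" "emeasure lborel (U - S) < e"
      using outer_regular_lborel[OF \<open>S \<in> sets borel\<close> \<open>e > 0\<close>] by blast
    obtain T where T: "T \<in> sets borel" "S \<subseteq> T" "emeasure \<mu> T \<le> ennreal (5 / 2 * c) * emeasure lborel U"
      using vitali_emeasure_bound[OF sets_lborel assms(1) U(1,2) *] by auto
    have "emeasure \<mu> S \<le> emeasure \<mu> T"
      using T by (intro emeasure_mono) (auto simp: assms)
    also note T(3)
    also have "emeasure lborel U = emeasure lborel S + emeasure lborel (U - S)"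
      using U \<open>S \<in> sets borel\<close> by (subst plus_emeasure) (auto intro!: arg_cong[where f = "emeasure lborel"])
    also have "ennreal (5 / 2 * c) * \<dots> \<le> ennreal (5 / 2 * c) * (emeasure lborel S + ennreal e)"
      using U by (intro mult_left_mono add_left_mono) auto
    also have "\<dots> = ennreal (5 / 2 * c) * emeasure lborel S + ennreal (5 / 2 * c * e)"
      using \<open>c \<ge> 0\<close> that by (simp add: distrib_left ennreal_mult[symmetric])
    finally show ?thesis .
  qed
  note approx = this
  show ?thesis
  proof (rule ennreal_le_epsilon)
    fix e :: real assume "e > 0"
    have "5 / 2 * c * (e / (5 / 2 * c + 1)) \<le> e"
      using \<open>c \<ge> 0\<close> \<open>e > 0\<close> by (simp add: field_simps)
    then show "emeasure \<mu> S \<le> ennreal (5 / 2 * c) * emeasure lborel S + ennreal e"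
      using approx[of "e / (5 / 2 * c + 1)"] \<open>e > 0\<close> \<open>c \<ge> 0\<close>
      by (meson add_left_mono add_nonneg_pos divide_pos_pos ennreal_leI order_trans
          mult_nonneg_nonneg zero_less_one zero_le_divide_iff zero_le_numeral)
  qed
qed

text \<open>The constant \<open>c\<close> may vary with the point, so \<open>S\<close> is cut into
  countably many pieces with a common integer bound \<open>m\<close>, to each of which
  \<open>measure_le_of_frequently_ball_le\<close> applies. The pieces have to be Borel; this holds
  because the sets \<open>V m k\<close> are open.\<close>

lemma null_of_frequently_ball_le:
  fixes \<mu> :: "real measure"
  assumes [measurable_cong]: "sets \<mu> = sets borel" and "finite_measure \<mu>" and "S \<in> null_sets lborel"
    and bound: "\<And>x. x \<in> S \<Longrightarrow> \<exists>c. \<forall>d>0. \<exists>r>0. r < d \<and> measure \<mu> (cball x r) \<le> c * r"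
  shows "emeasure \<mu> S = 0"
proof -
  interpret finite_measure \<mu> by fact
  define V where "V m k = {x. \<exists>r\<in>{0<..<1 / real (Suc k)}. measure \<mu> (cball x r) < real m * r}" for m k :: nat
  have "open (V m k)" for m k
    unfolding open_dist
  proof
    fix x assume "x \<in> V m k"
    then obtain r where r: "0 < r" "r < 1 / real (Suc k)" "measure \<mu> (cball x r) < real m * r"
      by (auto simp: V_def)
    \<comment> \<open>Continuity from above for closed balls: a strict bound survives a slight
      enlargement of the radius, hence a slight move of the centre.\<close>
    have "(\<lambda>i. measure \<mu> (cball x (r + 1 / Suc i))) \<longlonglongrightarrow> measure \<mu> (\<Inter>i. cball x (r + 1 / real (Suc i)))"
    proof (rule finite_Lim_measure_decseq)
      show "decseq (\<lambda>i. cball x (r + 1 / real (Suc i)))"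
        by (intro decseq_SucI subset_cball) (auto simp: field_simps)
    qed (auto simp: assms)
    also have "(\<Inter>i. cball x (r + 1 / real (Suc i))) = cball x r"
    proof (intro equalityI subsetI)
      fix y assume "y \<in> (\<Inter>i. cball x (r + 1 / real (Suc i)))"
      then have y: "dist x y \<le> r + 1 / real (Suc i)" for i by auto
      have "(\<lambda>i. r + 1 / real (Suc i)) \<longlonglongrightarrow> r + 0"
        by (intro tendsto_intros LIMSEQ_Suc[OF lim_inverse_n'])
      then show "y \<in> cball x r"
        using y by (auto intro: LIMSEQ_le_const)
    qed (auto intro: order_trans)
    finally have "eventually (\<lambda>i. measure \<mu> (cball x (r + 1 / Suc i)) < real m * r) sequentially"
      using r(3) by (rule order_tendstoD)
    then obtain i where i: "measure \<mu> (cball x (r + 1 / Suc i)) < real m * r"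
      by (auto simp: eventually_sequentially)
    show "\<exists>e>0. \<forall>y. dist y x < e \<longrightarrow> y \<in> V m k"
    proof (intro exI[of _ "1 / real (Suc i)"] conjI allI impI)
      fix y assume y: "dist y x < 1 / real (Suc i)"
      have "measure \<mu> (cball y r) \<le> measure \<mu> (cball x (r + 1 / Suc i))"
      proof (rule finite_measure_mono)
        show "cball y r \<subseteq> cball x (r + 1 / Suc i)"
        proof
          fix z assume "z \<in> cball y r"
          then show "z \<in> cball x (r + 1 / Suc i)"
            using y dist_triangle[of x z y] by (auto simp: dist_commute)
        qed
      qed (auto simp: assms)
      then show "y \<in> V m k"
        using i r by (auto simp: V_def intro!: bexI[of _ r])
    qed auto
  qed
  then have meas: "S \<inter> (\<Inter>k. V m k) \<in> sets borel" for m
    using \<open>S \<in> null_sets lborel\<close> by (intro sets.Int sets.countable_INT) auto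
  have "emeasure \<mu> (S \<inter> (\<Inter>k. V m k)) = 0" for m
  proof -
    have "emeasure \<mu> (S \<inter> (\<Inter>k. V m k)) \<le> ennreal (5 / 2 * real m) * emeasure lborel (S \<inter> (\<Inter>k. V m k))"
    proof (rule measure_le_of_frequently_ball_le)
      fix x d :: real assume x: "x \<in> S \<inter> (\<Inter>k. V m k)" and "d > 0"
      obtain k where k: "1 / real (Suc k) < d"
        using \<open>d > 0\<close> nat_approx_posE by blast
      have "x \<in> V m k" using x by auto
      then obtain r where r: "0 < r" "r < 1 / real (Suc k)" "measure \<mu> (cball x r) < real m * r"
        by (auto simp: V_def)
      have "emeasure \<mu> (ball x r) \<le> emeasure \<mu> (cball x r)"
        by (intro emeasure_mono) (auto simp: assms)
      also have "\<dots> \<le> ennreal (real m * r)"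
        using r(3) by (auto simp: emeasure_eq_measure intro!: ennreal_leI)
      finally show "\<exists>r>0. r < d \<and> emeasure \<mu> (ball x r) \<le> ennreal (real m * r)"
        using r k by auto
    qed (use meas assms in auto)
    also have "emeasure lborel (S \<inter> (\<Inter>k. V m k)) = 0"
      using \<open>S \<in> null_sets lborel\<close> meas
      by (metis inf_le1 null_setsD1 null_sets_subset sets_lborel)
    finally show ?thesis by simp
  qed
  then have "emeasure \<mu> (\<Union>m. S \<inter> (\<Inter>k. V m k)) = 0"
    using meas by (intro emeasure_UN_eq_0) (auto simp: assms)
  moreover have "S \<subseteq> (\<Union>m. S \<inter> (\<Inter>k. V m k))"
  proof
    fix x assume x: "x \<in> S"
    then obtain c where c: "\<And>d. d > 0 \<Longrightarrow> \<exists>r>0. r < d \<and> measure \<mu> (cball x r) \<le> c * r"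
      using bound by meson
    obtain m where m: "c < real m" using reals_Archimedean2 by blast
    have "x \<in> V m k" for k
    proof -
      obtain r where r: "r > 0" "r < 1 / real (Suc k)" "measure \<mu> (cball x r) \<le> c * r"
        using c[of "1 / real (Suc k)"] by auto
      moreover have "c * r < real m * r" using m r by simp
      ultimately have "measure \<mu> (cball x r) < real m * r" by linarith
      then show ?thesis
        using r unfolding V_def by (intro CollectI bexI[of _ r]) auto
    qed
    then show "x \<in> (\<Union>m. S \<inter> (\<Inter>k. V m k))" using x by auto
  qed
  moreover have "(\<Union>m. S \<inter> (\<Inter>k. V m k)) \<in> sets \<mu>"
    unfolding assms using meas by (intro sets.countable_UN) auto
  ultimately show ?thesis
    using emeasure_eq_0 by blast
qed

text \<open>A measure has density zero at almost every point of a set that it does not charge. Outer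
  regularity of \<open>\<nu>\<close> gives an open \<open>U\<close> around \<open>F\<close> of small
  \<open>\<nu>\<close>-mass, and the Vitali bound with \<open>N\<close> the Lebesgue measure shows
  that the exceptional sets \<open>A m\<close> have small outer Lebesgue measure.\<close>

lemma AE_ball_le_of_null:
  fixes \<nu> :: "real measure"
  assumes [measurable_cong]: "sets \<nu> = sets borel" and "finite_measure \<nu>"
    and F: "F \<in> sets borel" "emeasure \<nu> F = 0"
  shows "AE x in lborel. x \<in> F \<longrightarrow>
    (\<forall>\<alpha>>0. \<exists>d>0. \<forall>r. 0 < r \<longrightarrow> r < d \<longrightarrow> measure \<nu> (ball x r) \<le> \<alpha> * r)"
proof -
  interpret finite_measure \<nu> by fact
  define A where "A m = {x\<in>F. \<forall>d>0. \<exists>r>0. r < d \<and> measure \<nu> (ball x r) > r / real (Suc m)}" for m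
  have "\<exists>T\<in>sets borel. A m \<subseteq> T \<and> emeasure lborel T = 0" for m
  proof -
    have "\<exists>T\<in>sets borel. A m \<subseteq> T \<and> emeasure lborel T < ennreal e" if "e > 0" for e :: real
    proof -
      \<comment> \<open>A ball of radius \<open>5 * r\<close> has length \<open>10 * r\<close>,
        which is at most \<open>10 * Suc m\<close> times the \<open>\<nu>\<close>-mass of the ball
        of radius \<open>r\<close>.\<close>
      define e' where "e' = e / (10 * real (Suc m))"
      have "e' > 0" using that by (simp add: e'_def)
      have "emeasure \<nu> F = (INF U \<in> {U. F \<subseteq> U \<and> open U}. emeasure \<nu> U)"
        using F by (intro outer_regular) (auto simp: assms emeasure_eq_measure)
      then have "(INF U \<in> {U. F \<subseteq> U \<and> open U}. emeasure \<nu> U) < ennreal e'"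
        using F \<open>e' > 0\<close> by simp
      then obtain U where U: "F \<subseteq> U" "open U" "emeasure \<nu> U < ennreal e'"
        by (auto simp: INF_less_iff)
      have "\<exists>T\<in>sets borel. A m \<subseteq> T \<and> emeasure lborel T \<le> ennreal (10 * real (Suc m)) * emeasure \<nu> U"
      proof (rule vitali_emeasure_bound)
        fix x d :: real assume "x \<in> A m" "d > 0"
        then obtain r where r: "r > 0" "r < d" "measure \<nu> (ball x r) > r / real (Suc m)"
          by (auto simp: A_def)
        have "emeasure lborel (ball x (5 * r)) = ennreal (10 * r)"
          using r by (simp add: lborel_ball_real)
        also have "\<dots> \<le> ennreal (10 * real (Suc m) * measure \<nu> (ball x r))"
          using r by (intro ennreal_leI) (simp add: field_simps)
        finally show "\<exists>r>0. r < d \<and> emeasure lborel (ball x (5 * r)) \<le> ennreal (10 * real (Suc m)) * emeasure \<nu> (ball x r)"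
          using r by (auto simp: emeasure_eq_measure ennreal_mult)
      qed (use U in \<open>auto simp: A_def assms\<close>)
      moreover have "ennreal (10 * real (Suc m)) * emeasure \<nu> U < ennreal e"
      proof -
        have "measure \<nu> U < e'"
          using U(3) \<open>e' > 0\<close> by (simp add: emeasure_eq_measure ennreal_less_iff)
        then have "10 * real (Suc m) * measure \<nu> U < e"
          by (simp add: e'_def field_simps)
        then show ?thesis
          using that by (simp add: emeasure_eq_measure ennreal_mult[symmetric] ennreal_less_iff del: of_nat_Suc)
      qed
      ultimately show ?thesis by (meson le_less_trans)
    qed
    then have "\<forall>k. \<exists>T\<in>sets borel. A m \<subseteq> T \<and> emeasure lborel T < ennreal (1 / real (Suc k))"
      by auto
    then obtain T where T: "\<And>k. T k \<in> sets borel" "\<And>k. A m \<subseteq> T k"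
      "\<And>k. emeasure lborel (T k) < ennreal (1 / real (Suc k))" by metis
    have "emeasure lborel (\<Inter>k. T k) \<le> 0 + ennreal e" if "e > 0" for e
    proof -
      obtain k where k: "1 / real (Suc k) < e"
        using \<open>e > 0\<close> nat_approx_posE by blast
      have "emeasure lborel (\<Inter>k. T k) \<le> emeasure lborel (T k)"
        using T by (intro emeasure_mono) auto
      also have "\<dots> \<le> ennreal e"
        using T(3)[of k] k by (meson ennreal_leI less_imp_le order_trans)
      finally show ?thesis by simp
    qed
    then have "emeasure lborel (\<Inter>k. T k) \<le> 0"
      using ennreal_le_epsilon by blast
    then show ?thesis
      using T by (intro bexI[of _ "\<Inter>k. T k"]) (auto intro: sets.countable_INT)
  qed
  then obtain T where T: "\<And>m. T m \<in> sets borel" "\<And>m. A m \<subseteq> T m" "\<And>m. emeasure lborel (T m) = 0"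
    by metis
  have "AE x in lborel. \<forall>m. x \<notin> T m"
    using T by (subst AE_all_countable) (auto intro!: AE_not_in)
  then show ?thesis
  proof (rule AE_mp, intro AE_I2 impI allI)
    fix x \<alpha> :: real
    assume x: "\<forall>m. x \<notin> T m" "x \<in> F" and "\<alpha> > 0"
    obtain m where m: "1 / real (Suc m) < \<alpha>"
      using \<open>\<alpha> > 0\<close> nat_approx_posE by blast
    have "x \<notin> A m" using x T by auto
    then obtain d where d: "d > 0" "\<And>r. r > 0 \<Longrightarrow> r < d \<Longrightarrow> measure \<nu> (ball x r) \<le> r / real (Suc m)"
      using x(2) by (force simp: A_def not_less)
    have "r / real (Suc m) \<le> \<alpha> * r" if "r > 0" for r
      using mult_right_mono[OF less_imp_le[OF m], of r] that by simp
    then show "\<exists>d>0. \<forall>r. 0 < r \<longrightarrow> r < d \<longrightarrow> measure \<nu> (ball x r) \<le> \<alpha> * r"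
      using d by (meson order_trans)
  qed
qed

text \<open>Near almost every point of \<open>F c\<close> the part of \<open>\<mu>\<close> outside
  \<open>F c\<close> has density zero, and the part inside has mass at most \<open>2 * c * r\<close>
  on a ball of radius \<open>r\<close>. So small balls carry at most \<open>3 * c * r\<close>, and
  the weighted sum is at most about \<open>5 * c * e\<close>, which contradicts \<open>e / C\<close>
  when \<open>c < 1 / (8 * C)\<close>. Only rational \<open>c\<close> are used, so that one null set
  serves for all \<open>C\<close>.\<close>

lemma AE_density_ge:
  fixes \<mu> :: "real measure" and f :: "real \<Rightarrow> real"
  assumes [measurable_cong]: "sets \<mu> = sets borel" and "finite_measure \<mu>"
    and G: "G \<in> sets borel" and f: "set_borel_measurable lborel G f"
    and dens: "\<And>\<omega>. \<omega> \<in> sets borel \<Longrightarrow> \<omega> \<subseteq> G \<Longrightarrow>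
      set_integrable lborel \<omega> f \<and> measure \<mu> \<omega> = (LINT x:\<omega>|lborel. f x)"
  shows "AE x in lborel. x \<in> G \<longrightarrow> (\<forall>C>0.
    (\<forall>d>0. \<exists>e>0. e < d \<and> (\<exists>J. e / C \<le> (\<Sum>j\<le>J. (1 / 16) ^ j * measure \<mu> (ball x (4 ^ j * e)))))
      \<longrightarrow> 1 / (8 * C) \<le> f x)"
proof -
  interpret finite_measure \<mu> by fact
  define F where "F c = {x\<in>G. f x < c}" for c
  have F: "F c \<in> sets borel" for c
  proof -
    have "F c = {x\<in>space borel. indicator G x *\<^sub>R f x < c} \<inter> G"
      by (auto simp: F_def)
    moreover have "(\<lambda>x. indicator G x *\<^sub>R f x) \<in> borel_measurable borel"
      using f by (simp add: set_borel_measurable_def)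
    ultimately show ?thesis using G by auto
  qed
  define \<nu> where "\<nu> c = density \<mu> (indicator (- F c))" for c
  have \<nu>_sets: "sets (\<nu> c) = sets borel" for c
    by (simp add: \<nu>_def assms)
  have \<nu>_eq: "emeasure (\<nu> c) A = emeasure \<mu> (- F c \<inter> A)" if "A \<in> sets borel" for A c
    unfolding \<nu>_def by (rule emeasure_restricted) (use F that in \<open>auto simp: assms\<close>)
  have \<nu>_fin: "finite_measure (\<nu> c)" for c
    using \<nu>_eq[of UNIV c] by (intro finite_measureI) (auto simp: \<nu>_def space_density emeasure_eq_measure sets_eq_imp_space_eq[OF assms(1)])
  have \<nu>_meas: "measure (\<nu> c) A = measure \<mu> (- F c \<inter> A)" if "A \<in> sets borel" for A c
    using \<nu>_eq[OF that] by (simp add: measure_def)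
  have "AE x in lborel. \<forall>c\<in>\<rat>. x \<in> F c \<longrightarrow>
    (\<forall>\<alpha>>0. \<exists>d>0. \<forall>r. 0 < r \<longrightarrow> r < d \<longrightarrow> measure (\<nu> c) (ball x r) \<le> \<alpha> * r)"
    using F \<nu>_sets \<nu>_fin \<nu>_eq[OF F]
    by (subst AE_ball_countable[OF countable_rat]) (auto intro!: AE_ball_le_of_null)
  then show ?thesis
  proof (rule AE_mp, intro AE_I2 impI allI)
    fix x C :: real
    assume x: "\<forall>c\<in>\<rat>. x \<in> F c \<longrightarrow>
        (\<forall>\<alpha>>0. \<exists>d>0. \<forall>r. 0 < r \<longrightarrow> r < d \<longrightarrow> measure (\<nu> c) (ball x r) \<le> \<alpha> * r)"
      and "x \<in> G" "C > 0"
      and freq: "\<forall>d>0. \<exists>e>0. e < d \<and>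
        (\<exists>J. e / C \<le> (\<Sum>j\<le>J. (1 / 16) ^ j * measure \<mu> (ball x (4 ^ j * e))))"
    show "1 / (8 * C) \<le> f x"
    proof (rule ccontr)
      assume "\<not> 1 / (8 * C) \<le> f x"
      \<comment> \<open>The maximum with \<open>0\<close> makes the rational \<open>c\<close>
        positive.\<close>
      then have "max (f x) 0 < 1 / (8 * C)"
        using \<open>C > 0\<close> by simp
      then obtain c where c: "c \<in> \<rat>" "max (f x) 0 < c" "c < 1 / (8 * C)"
        using Rats_dense_in_real by blast
      then have "x \<in> F c" "c > 0"
        using \<open>x \<in> G\<close> by (auto simp: F_def)
      then obtain d where d: "d > 0"
        "\<And>r. 0 < r \<Longrightarrow> r < d \<Longrightarrow> measure (\<nu> c) (ball x r) \<le> c * r"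
        using x c(1) by meson
      define m where "m = measure \<mu> UNIV"
      have "m \<ge> 0" by (simp add: m_def)
      \<comment> \<open>Beyond the radius \<open>d\<close> only the total mass \<open>m\<close> is
        known, and it is dominated by a multiple of \<open>r\<close> to the power 3/2. An exponent
        below 2 makes the sum against \<open>(1 / 16) ^ j\<close> converge on radii
        \<open>4 ^ j * e\<close>; an exponent above 1 makes the result small compared with
        \<open>e\<close>.\<close>
      have \<nu>_ball: "measure (\<nu> c) (ball x r) \<le> c * r + m * (r / d * sqrt (r / d))" if "r > 0" for r
      proof (cases "r < d")
        case True
        then show ?thesis
          using d that \<open>m \<ge> 0\<close> by (intro order_trans[OF d(2)]) auto
      next
        case False
        then have "1 \<le> r / d" using d by simp
        then have "1 * 1 \<le> r / d * sqrt (r / d)"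
          by (intro mult_mono) auto
        then have "m * 1 \<le> m * (r / d * sqrt (r / d))"
          using \<open>m \<ge> 0\<close> by (intro mult_left_mono) auto
        moreover have "measure (\<nu> c) (ball x r) \<le> m"
          unfolding m_def by (subst \<nu>_meas) (auto simp: assms intro!: finite_measure_mono)
        moreover have "c * r \<ge> 0" using \<open>c > 0\<close> that by simp
        ultimately show ?thesis by linarith
      qed
      have \<mu>_ball: "measure \<mu> (ball x r) \<le> 3 * c * r + m * (r / d * sqrt (r / d))" if "r > 0" for r
      proof -
        have B: "ball x r \<inter> F c \<in> sets borel" "ball x r \<inter> F c \<subseteq> G"
          using F by (auto simp: F_def)
        note D = dens[OF B]
        have ball: "set_integrable lborel (ball x r) (\<lambda>x. c)"
          unfolding set_integrable_def using \<open>r > 0\<close> by (simp add: lborel_ball_real)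
        have int: "set_integrable lborel (ball x r \<inter> F c) (\<lambda>x. c)"
          by (rule set_integrable_subset[OF ball]) (use B in auto)
        have "measure \<mu> (ball x r \<inter> F c) = (LINT x:ball x r \<inter> F c|lborel. f x)"
          using D by simp
        also have "\<dots> \<le> (LINT x:ball x r \<inter> F c|lborel. c)"
          by (rule set_integral_mono) (use D int in \<open>auto simp: F_def\<close>)
        also have "\<dots> = measure lborel (ball x r \<inter> F c) * c"
          using B by (simp add: set_lebesgue_integral_def)
        also have "\<dots> \<le> measure lborel (ball x r) * c"
          using B \<open>r > 0\<close> \<open>c > 0\<close>
          by (intro mult_right_mono measure_mono_fmeasurable) (auto simp: fmeasurable_def lborel_ball_real)
        also have "\<dots> = 2 * r * c"
          using \<open>r > 0\<close> by (simp add: measure_def lborel_ball_real)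
        finally have "measure \<mu> (ball x r \<inter> F c) \<le> 2 * r * c" .
        moreover have "measure \<mu> (ball x r) = measure \<mu> (ball x r \<inter> F c) + measure (\<nu> c) (ball x r)"
        proof -
          have "ball x r = (ball x r \<inter> F c) \<union> (- F c \<inter> ball x r)" by blast
          moreover have "measure \<mu> ((ball x r \<inter> F c) \<union> (- F c \<inter> ball x r)) =
              measure \<mu> (ball x r \<inter> F c) + measure \<mu> (- F c \<inter> ball x r)"
            using F by (intro finite_measure_Union) (auto simp: assms)
          ultimately show ?thesis by (simp add: \<nu>_meas)
        qed
        ultimately show ?thesis using \<nu>_ball[OF that] by (simp add: algebra_simps)
      qed
      have geo: "(\<Sum>j\<le>J. (1 / 4) ^ j) \<le> (4 / 3 :: real)" "(\<Sum>j\<le>J. (1 / 2) ^ j) \<le> (2 :: real)" for J :: nat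
        by (simp_all add: sum_gp0)
      \<comment> \<open>Chosen so that \<open>e < \<delta>\<close> implies
        \<open>sqrt (e / d) \<le> c * d / (2 * m + 1)\<close>, which brings the error term
        \<open>2 * m * K\<close> below \<open>c * e\<close>.\<close>
      define \<delta> where "\<delta> = d * (c * d / (2 * m + 1))\<^sup>2"
      have "\<delta> > 0" using d \<open>c > 0\<close> \<open>m \<ge> 0\<close> by (auto simp: \<delta>_def)
      then obtain e J where e: "e > 0" "e < \<delta>"
        "e / C \<le> (\<Sum>j\<le>J. (1 / 16) ^ j * measure \<mu> (ball x (4 ^ j * e)))"
        using freq by meson
      define K where "K = e / d * sqrt (e / d)"
      have "K \<ge> 0" using e d by (simp add: K_def)
      note e(3)
      also have "(\<Sum>j\<le>J. (1 / 16) ^ j * measure \<mu> (ball x (4 ^ j * e)))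
          \<le> (\<Sum>j\<le>J. 3 * c * e * (1 / 4) ^ j + m * K * (1 / 2) ^ j)"
      proof (intro sum_mono)
        fix j
        have "sqrt (4 ^ j) = 2 ^ j"
          by (metis real_sqrt_four real_sqrt_power)
        then have "4 ^ j * e / d * sqrt (4 ^ j * e / d) = 8 ^ j * K"
          using power_mult_distrib[of "4 :: real" 2 j]
          by (simp add: K_def real_sqrt_mult real_sqrt_divide)
        then have "measure \<mu> (ball x (4 ^ j * e)) \<le> 3 * c * (4 ^ j * e) + m * (8 ^ j * K)"
          using \<mu>_ball[of "4 ^ j * e"] e(1) by simp
        then have "(1 / 16) ^ j * measure \<mu> (ball x (4 ^ j * e))
            \<le> (1 / 16) ^ j * (3 * c * (4 ^ j * e) + m * (8 ^ j * K))"
          by (intro mult_left_mono) auto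
        also have "\<dots> = 3 * c * e * ((1 / 16) ^ j * 4 ^ j) + m * K * ((1 / 16) ^ j * 8 ^ j)"
          by (simp add: algebra_simps)
        finally show "(1 / 16) ^ j * measure \<mu> (ball x (4 ^ j * e))
            \<le> 3 * c * e * (1 / 4) ^ j + m * K * (1 / 2) ^ j"
          by (simp add: power_mult_distrib[symmetric])
      qed
      also have "\<dots> = 3 * c * e * (\<Sum>j\<le>J. (1 / 4) ^ j) + m * K * (\<Sum>j\<le>J. (1 / 2) ^ j)"
        by (simp only: sum.distrib sum_distrib_left)
      also have "\<dots> \<le> 3 * c * e * (4 / 3) + m * K * 2"
        using \<open>c > 0\<close> e \<open>m \<ge> 0\<close> \<open>K \<ge> 0\<close> by (intro add_mono mult_left_mono geo) auto
      also have "m * K * 2 \<le> c * e"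
      proof -
        have "e / d < (c * d / (2 * m + 1))\<^sup>2"
          using e d by (simp add: \<delta>_def field_simps)
        then have "sqrt (e / d) \<le> c * d / (2 * m + 1)"
          using \<open>c > 0\<close> d \<open>m \<ge> 0\<close> by (intro real_le_lsqrt) auto
        then have "2 * m * (e / d * sqrt (e / d)) \<le> 2 * m * (e / d * (c * d / (2 * m + 1)))"
          using \<open>m \<ge> 0\<close> e d by (intro mult_left_mono) auto
        also have "\<dots> = c * e * (2 * m / (2 * m + 1))"
          using d by simp
        also have "\<dots> \<le> c * e * 1"
          using \<open>c > 0\<close> e \<open>m \<ge> 0\<close> by (intro mult_left_mono) auto
        finally show ?thesis by (simp add: K_def mult_ac)
      qed
      finally have "e * (1 / C) \<le> e * (5 * c)" by (simp add: mult_ac)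
      then have "1 / C \<le> 5 * c" using e(1) by (simp only: mult_le_cancel_left_pos)
      moreover have "8 * c < 1 / C" using c(3) \<open>C > 0\<close> by (simp add: field_simps)
      ultimately show False using \<open>c > 0\<close> by linarith
    qed
  qed
qed

section \<open>Operators given by a projection-valued measure\<close>

definition spectral_mu :: "(real set \<Rightarrow> 'h \<Rightarrow> 'h) \<Rightarrow> 'h::real_inner \<Rightarrow> real measure" where
  "spectral_mu P x = measure_of UNIV (sets borel) (\<lambda>\<omega>. ennreal (P \<omega> x \<bullet> x))"

text \<open>\<open>Dm_iff\<close> and \<open>T_form\<close> are the two defining conditions of
  \<open>spectral_measure_of\<close>. They speak of diagonal values only, so linearity and symmetry
  of \<open>T\<close> are assumed in addition; they are what permits polarization.\<close>

locale spectral_operator =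
  fixes P :: "real set \<Rightarrow> 'h \<Rightarrow> 'h::real_inner" and Dm :: "'h set" and T :: "'h \<Rightarrow> 'h"
  assumes P_linear: "\<omega> \<in> sets borel \<Longrightarrow> linear (P \<omega>)"
    and P_sym: "\<omega> \<in> sets borel \<Longrightarrow> P \<omega> x \<bullet> y = x \<bullet> P \<omega> y"
    and P_UNIV: "P UNIV x = x"
    and P_Int: "\<omega> \<in> sets borel \<Longrightarrow> \<omega>' \<in> sets borel \<Longrightarrow> P (\<omega> \<inter> \<omega>') x = P \<omega> (P \<omega>' x)"
    and P_sums: "range W \<subseteq> sets borel \<Longrightarrow> disjoint_family W \<Longrightarrow>
      (\<lambda>k::nat. P (W k) x) sums P (\<Union>k. W k) x"
    and Dm_subspace: "subspace Dm"
    and Dm_dense: "closure Dm = UNIV"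
    and T_add: "x \<in> Dm \<Longrightarrow> y \<in> Dm \<Longrightarrow> T (x + y) = T x + T y"
    and T_scale: "x \<in> Dm \<Longrightarrow> T (c *\<^sub>R x) = c *\<^sub>R T x"
    and T_sym: "x \<in> Dm \<Longrightarrow> y \<in> Dm \<Longrightarrow> T x \<bullet> y = x \<bullet> T y"
    and Dm_iff: "x \<in> Dm \<longleftrightarrow> integrable (spectral_mu P x) (\<lambda>t. t\<^sup>2)"
    and T_form: "x \<in> Dm \<Longrightarrow> T x \<bullet> x = (\<integral>t. t \<partial>spectral_mu P x)"
begin

abbreviation "\<mu> \<equiv> spectral_mu P"

lemmas P_add = linear_add[OF P_linear] and P_diff = linear_diff[OF P_linear]
  and P_zero = linear_0[OF P_linear] and P_scaleR = linear_scale[OF P_linear]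

lemma P_empty: "P {} x = 0"
proof -
  have "(\<lambda>k::nat. P {} x) sums P (\<Union>k::nat. {}) x"
    by (rule P_sums) (auto simp: disjoint_family_on_def)
  then have "(\<lambda>k::nat. P {} x) \<longlonglongrightarrow> 0"
    by (intro summable_LIMSEQ_zero sums_summable)
  then show ?thesis by (simp add: LIMSEQ_const_iff)
qed

lemma P_Un:
  assumes "A \<in> sets borel" "B \<in> sets borel" "A \<inter> B = {}"
  shows "P (A \<union> B) x = P A x + P B x"
proof -
  have "(\<lambda>k. P (binaryset A B k) x) sums P (\<Union>k. binaryset A B k) x"
    using assms by (intro P_sums) (auto simp: range_binaryset_eq disjoint_family_on_def binaryset_def)
  moreover have "(\<lambda>k. P (binaryset A B k) x) sums (P A x + P B x)"
    by (rule binaryset_sums) (rule P_empty)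
  ultimately show ?thesis by (simp add: UN_binaryset_eq sums_unique2)
qed

lemma P_compl: "\<omega> \<in> sets borel \<Longrightarrow> P \<omega> x + P (- \<omega>) x = x"
  using P_Un[of \<omega> "- \<omega>" x] P_UNIV by (simp add: Compl_partition)

lemma P_idem: "\<omega> \<in> sets borel \<Longrightarrow> P \<omega> (P \<omega> x) = P \<omega> x"
  using P_Int[of \<omega> \<omega> x] by simp

lemma P_P_subset: "\<omega> \<in> sets borel \<Longrightarrow> \<omega>' \<in> sets borel \<Longrightarrow> \<omega> \<subseteq> \<omega>' \<Longrightarrow> P \<omega>' (P \<omega> x) = P \<omega> x"
  using P_Int[of \<omega>' \<omega> x] by (simp add: Int_absorb1)

lemma P_P_disjoint: "\<omega> \<in> sets borel \<Longrightarrow> \<omega>' \<in> sets borel \<Longrightarrow> \<omega> \<inter> \<omega>' = {} \<Longrightarrow> P \<omega> (P \<omega>' x) = 0"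
  using P_Int[of \<omega> \<omega>' x] by (simp add: P_empty)

lemma P_form: "\<omega> \<in> sets borel \<Longrightarrow> P \<omega> x \<bullet> x = (norm (P \<omega> x))\<^sup>2"
  using P_sym[of \<omega> "P \<omega> x" x] P_idem[of \<omega> x] by (simp add: power2_norm_eq_inner)

lemma P_orthogonal:
  "\<omega> \<in> sets borel \<Longrightarrow> \<omega>' \<in> sets borel \<Longrightarrow> \<omega> \<inter> \<omega>' = {} \<Longrightarrow> P \<omega> x \<bullet> P \<omega>' y = 0"
  by (simp add: P_sym P_P_disjoint)

lemma norm_P_le: "\<omega> \<in> sets borel \<Longrightarrow> norm (P \<omega> x) \<le> norm x"
proof -
  assume \<omega>: "\<omega> \<in> sets borel"
  have "(norm (P \<omega> x))\<^sup>2 \<le> norm (P \<omega> x) * norm x"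
    using P_form[OF \<omega>, of x] norm_cauchy_schwarz[of "P \<omega> x" x] by simp
  then show ?thesis
    by (cases "norm (P \<omega> x) = 0") (auto simp: power2_eq_square)
qed

lemma space_\<mu>[simp]: "space (\<mu> x) = UNIV" and sets_\<mu>[simp, measurable_cong]: "sets (\<mu> x) = sets borel"
  using sets.sigma_sets_eq[of borel] by (auto simp: spectral_mu_def)

lemma emeasure_\<mu>: "\<omega> \<in> sets borel \<Longrightarrow> emeasure (\<mu> x) \<omega> = ennreal (P \<omega> x \<bullet> x)"
proof (rule emeasure_measure_of[OF spectral_mu_def])
  show "countably_additive (sets (\<mu> x)) (\<lambda>\<omega>. ennreal (P \<omega> x \<bullet> x))"
  proof (rule countably_additiveI)
    fix A :: "nat \<Rightarrow> real set"
    assume A: "range A \<subseteq> sets (\<mu> x)" "disjoint_family A"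
    then have "(\<lambda>k. P (A k) x \<bullet> x) sums (P (\<Union>k. A k) x \<bullet> x)"
      by (intro bounded_linear.sums[OF bounded_linear_inner_left] P_sums) auto
    moreover have "P (A k) x \<bullet> x \<ge> 0" for k
      using A by (subst P_form) auto
    ultimately show "(\<Sum>i. ennreal (P (A i) x \<bullet> x)) = ennreal (P (\<Union>i. A i) x \<bullet> x)"
      by (intro suminf_ennreal_eq) auto
  qed
qed (auto simp: positive_def P_empty)

lemma measure_\<mu>: "\<omega> \<in> sets borel \<Longrightarrow> measure (\<mu> x) \<omega> = P \<omega> x \<bullet> x"
  by (simp add: measure_def emeasure_\<mu> P_form)

sublocale \<mu>: finite_measure "\<mu> x" for x
  by (rule finite_measureI) (simp add: emeasure_\<mu>)

lemma \<mu>_P: "\<omega> \<in> sets borel \<Longrightarrow> \<mu> (P \<omega> x) = density (\<mu> x) (\<lambda>t. ennreal (indicator \<omega> t))"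
proof (rule measure_eqI)
  fix A assume \<omega>: "\<omega> \<in> sets borel" and "A \<in> sets (\<mu> (P \<omega> x))"
  then have A: "A \<in> sets borel" by simp
  have "emeasure (density (\<mu> x) (\<lambda>t. ennreal (indicator \<omega> t))) A = emeasure (\<mu> x) (\<omega> \<inter> A)"
    unfolding ennreal_indicator using \<omega> A by (intro emeasure_restricted) auto
  also have "\<dots> = ennreal (P \<omega> (P A (P \<omega> x)) \<bullet> x)"
    using \<omega> A P_Int[of \<omega> "A \<inter> \<omega>" x] P_Int[of A \<omega> x] by (simp add: emeasure_\<mu> Int_ac)
  also have "\<dots> = emeasure (\<mu> (P \<omega> x)) A"
    using \<omega> A by (simp add: emeasure_\<mu> P_sym[of \<omega> "P A (P \<omega> x)"])
  finally show "emeasure (\<mu> (P \<omega> x)) A = emeasure (density (\<mu> x) (\<lambda>t. ennreal (indicator \<omega> t))) A" ..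
qed simp

lemma P_in_Dm: "\<omega> \<in> sets borel \<Longrightarrow> x \<in> Dm \<Longrightarrow> P \<omega> x \<in> Dm"
  unfolding Dm_iff
  using integrable_mult_indicator[of \<omega> "\<mu> x" "\<lambda>t. t\<^sup>2"] by (simp add: \<mu>_P integrable_density)

lemma P_bounded_in_Dm:
  assumes "\<omega> \<in> sets borel" "bounded \<omega>"
  shows "P \<omega> x \<in> Dm"
proof -
  obtain R where R: "\<And>t. t \<in> \<omega> \<Longrightarrow> \<bar>t\<bar> \<le> R"
    using \<open>bounded \<omega>\<close> unfolding bounded_iff by auto
  have "AE t in \<mu> x. norm (indicator \<omega> t *\<^sub>R t\<^sup>2) \<le> R\<^sup>2"
  proof (intro AE_I2)
    fix t :: real
    show "norm (indicator \<omega> t *\<^sub>R t\<^sup>2) \<le> R\<^sup>2"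
      using power_mono[OF R[of t], of 2] by (auto simp: indicator_def)
  qed
  then have "integrable (\<mu> x) (\<lambda>t. indicator \<omega> t *\<^sub>R t\<^sup>2)"
    using assms(1) by (intro \<mu>.integrable_const_bound) auto
  then show ?thesis
    unfolding Dm_iff using assms(1) by (simp add: \<mu>_P integrable_density)
qed

lemma integrable_id: "x \<in> Dm \<Longrightarrow> integrable (\<mu> x) (\<lambda>t. t)"
proof -
  assume "x \<in> Dm"
  then have "integrable (\<mu> x) (\<lambda>t. 1 + t\<^sup>2)"
    by (simp add: Dm_iff)
  moreover have "\<bar>t\<bar> \<le> 1 + t\<^sup>2" for t :: real
  proof -
    have "2 * \<bar>t\<bar> \<le> 1 + t\<^sup>2"
      using zero_le_power2[of "\<bar>t\<bar> - 1"] by (simp add: power2_diff)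
    then show ?thesis using abs_ge_zero[of t] by linarith
  qed
  ultimately show ?thesis
    by (intro Bochner_Integration.integrable_bound[of "\<mu> x" "\<lambda>t. 1 + t\<^sup>2" "\<lambda>t. t"]) auto
qed

lemma T_form_P:
  assumes "\<omega> \<in> sets borel" "x \<in> Dm"
  shows "T (P \<omega> x) \<bullet> P \<omega> x = (\<integral>t. indicator \<omega> t * t \<partial>\<mu> x)"
  using assms by (simp add: T_form P_in_Dm \<mu>_P integral_density)

lemmas Dm_add = subspace_add[OF Dm_subspace] and Dm_scaleR = subspace_scale[OF Dm_subspace]
  and Dm_diff = subspace_diff[OF Dm_subspace] and Dm_zero = subspace_0[OF Dm_subspace]

lemma T_zero: "T 0 = 0"
  using T_scale[OF Dm_zero, of 0] by simp

lemma T_diff: "x \<in> Dm \<Longrightarrow> y \<in> Dm \<Longrightarrow> T (x - y) = T x - T y"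
  using T_add[of x "(-1) *\<^sub>R y"] T_scale[of y "-1"] Dm_scaleR[of y "-1"] by simp

text \<open>The quadratic form of \<open>T\<close> is the sum of its restrictions to the ranges of \<open>P \<omega>\<close> and
  \<open>P (- \<omega>)\<close>, so the mixed terms vanish.\<close>

lemma T_P_orthogonal:
  assumes \<omega>: "\<omega> \<in> sets borel" and "x \<in> Dm" "z \<in> Dm"
  shows "T (P \<omega> x) \<bullet> P (- \<omega>) z = 0"
proof -
  have \<omega>': "- \<omega> \<in> sets borel" using \<omega> by auto
  define u where "u = P \<omega> x + P (- \<omega>) z"
  have mem: "P \<omega> x \<in> Dm" "P (- \<omega>) z \<in> Dm" "u \<in> Dm"
    using assms \<omega>' by (auto simp: u_def intro!: P_in_Dm Dm_add)
  have Pu: "P \<omega> u = P \<omega> x" "P (- \<omega>) u = P (- \<omega>) z"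
    using \<omega> \<omega>' by (auto simp: u_def P_add P_idem P_P_disjoint)
  have "T u \<bullet> u = (\<integral>t. indicator \<omega> t * t + indicator (- \<omega>) t * t \<partial>\<mu> u)"
    using mem(3) by (subst T_form) (auto intro!: Bochner_Integration.integral_cong simp: indicator_def)
  also have "\<dots> = (\<integral>t. indicator \<omega> t * t \<partial>\<mu> u) + (\<integral>t. indicator (- \<omega>) t * t \<partial>\<mu> u)"
    using integrable_id[OF mem(3)] \<omega>
    by (intro Bochner_Integration.integral_add) (auto intro!: integrable_real_mult_indicator simp: mult.commute)
  also have "\<dots> = T (P \<omega> x) \<bullet> P \<omega> x + T (P (- \<omega>) z) \<bullet> P (- \<omega>) z"
    using T_form_P[OF \<omega> mem(3)] T_form_P[OF \<omega>' mem(3)] by (simp add: Pu)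
  finally have "T (P \<omega> x) \<bullet> P (- \<omega>) z + T (P (- \<omega>) z) \<bullet> P \<omega> x = 0"
    using mem by (simp add: u_def T_add inner_add_left inner_add_right)
  moreover have "T (P (- \<omega>) z) \<bullet> P \<omega> x = T (P \<omega> x) \<bullet> P (- \<omega>) z"
    using T_sym[OF mem(2,1)] by (simp add: inner_commute)
  ultimately show ?thesis by simp
qed

lemma eq_zero_of_orthogonal_Dm:
  assumes "\<And>z. z \<in> Dm \<Longrightarrow> x \<bullet> z = 0"
  shows "x = 0"
proof -
  have "closure Dm \<subseteq> {z. x \<bullet> z = 0}"
    using assms by (intro closure_minimal closed_hyperplane) auto
  then have "x \<in> {z. x \<bullet> z = 0}" unfolding Dm_dense by blast
  then show ?thesis by simp
qed

text \<open>By \<open>T_P_orthogonal\<close>, the component of \<open>T (P \<omega> x)\<close> in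
  the range of \<open>P (- \<omega>)\<close> is orthogonal to the dense subspace \<open>Dm\<close>,
  hence zero; the same holds with \<open>\<omega>\<close> and its complement exchanged. Thus the
  ranges reduce \<open>T\<close>, without any functional calculus.\<close>

lemma T_P_commute:
  assumes \<omega>: "\<omega> \<in> sets borel" and x: "x \<in> Dm"
  shows "T (P \<omega> x) = P \<omega> (T x)"
proof -
  have zero: "P (- A) (T (P A x)) = 0" if A: "A \<in> sets borel" for A
  proof (rule eq_zero_of_orthogonal_Dm)
    fix z assume "z \<in> Dm"
    then show "P (- A) (T (P A x)) \<bullet> z = 0"
      using T_P_orthogonal[OF A x, of z] A by (simp add: P_sym)
  qed
  have \<omega>': "- \<omega> \<in> sets borel" using \<omega> by auto
  have "P \<omega> (T x) = P \<omega> (T (P \<omega> x + P (- \<omega>) x))"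
    using P_compl[OF \<omega>, of x] by simp
  also have "\<dots> = P \<omega> (T (P \<omega> x)) + P \<omega> (T (P (- \<omega>) x))"
    using \<omega> \<omega>' x by (simp add: T_add P_in_Dm P_add)
  also have "\<dots> = P \<omega> (T (P \<omega> x)) + P (- \<omega>) (T (P \<omega> x))"
    using zero[OF \<omega>] zero[OF \<omega>'] by simp
  finally show ?thesis using P_compl[OF \<omega>] by simp
qed

section \<open>Estimates for \<open>T - l\<close> on spectral subspaces\<close>

text \<open>The form of \<open>T - l\<close> at \<open>x\<close> is the integral of
  \<open>t - l\<close> over \<open>\<omega>\<close>. The factor \<open>s\<close> will be
  \<open>1\<close> or \<open>- 1\<close>, so that one statement yields lower and upper
  bounds.\<close>

lemma form_ge:
  assumes \<omega>: "\<omega> \<in> sets borel" and x: "x \<in> Dm" "P \<omega> x = x"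
    and ge: "\<And>t. t \<in> \<omega> \<Longrightarrow> c \<le> s * (t - l)"
  shows "c * (norm x)\<^sup>2 \<le> s * ((T x - l *\<^sub>R x) \<bullet> x)"
proof -
  have int: "integrable (\<mu> x) (\<lambda>t. indicator \<omega> t * t)"
    using integrable_real_mult_indicator[OF _ integrable_id[OF x(1)], of \<omega>] \<omega>
    by (simp add: mult.commute)
  have int': "integrable (\<mu> x) (\<lambda>t. indicator \<omega> t * c)" for c :: real
    using \<omega> by (intro integrable_mult_left integrable_real_indicator) (auto simp: less_top[symmetric])
  have norm: "(\<integral>t. indicator \<omega> t * d \<partial>\<mu> x) = d * (norm x)\<^sup>2" for d
    using \<omega> x(2) by (simp add: measure_\<mu> power2_norm_eq_inner)
  have "c * (norm x)\<^sup>2 = (\<integral>t. indicator \<omega> t * c \<partial>\<mu> x)"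
    by (simp only: norm)
  also have "\<dots> \<le> (\<integral>t. s * (indicator \<omega> t * t - indicator \<omega> t * l) \<partial>\<mu> x)"
    using ge by (intro integral_mono int' Bochner_Integration.integrable_diff integrable_mult_right int)
      (auto simp: indicator_def)
  also have "\<dots> = s * ((\<integral>t. indicator \<omega> t * t \<partial>\<mu> x) - (\<integral>t. indicator \<omega> t * l \<partial>\<mu> x))"
    by (simp only: integral_mult_right_zero Bochner_Integration.integral_diff[OF int int'])
  also have "\<dots> = s * ((T x - l *\<^sub>R x) \<bullet> x)"
    using T_form_P[OF \<omega> x(1)] x(2)
    by (simp only: norm) (simp add: inner_diff_left power2_norm_eq_inner)
  finally show ?thesis .
qed

lemma P_commute: "\<omega> \<in> sets borel \<Longrightarrow> x \<in> Dm \<Longrightarrow> T (P \<omega> x) - l *\<^sub>R P \<omega> x = P \<omega> (T x - l *\<^sub>R x)"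
  by (simp add: T_P_commute P_diff P_scaleR)

text \<open>The form of \<open>S = T - l\<close> is bounded by \<open>e\<close> on the range of
  \<open>P \<omega>\<close>. Since \<open>S\<close> is symmetric and leaves this range invariant,
  polarization and the parallelogram law turn this into a norm bound.\<close>

lemma norm_shift_le:
  assumes \<omega>: "\<omega> \<in> sets borel" and Px: "P \<omega> x = x" and "\<omega> \<subseteq> cball l e" "e > 0"
  shows "norm (T x - l *\<^sub>R x) \<le> e * norm x"
proof -
  have "bounded \<omega>"
    using \<open>\<omega> \<subseteq> cball l e\<close> bounded_cball bounded_subset by blast
  then have x: "x \<in> Dm" "P \<omega> x = x"
    using P_bounded_in_Dm[OF \<omega>, of x] Px by auto
  have Tx: "T x \<in> Dm"
    using P_bounded_in_Dm[OF \<omega> \<open>bounded \<omega>\<close>, of "T x"] T_P_commute[OF \<omega> x(1)] x(2) by simp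
  define S where "S x = T x - l *\<^sub>R x" for x
  have bound: "\<bar>S y \<bullet> y\<bar> \<le> e * (norm y)\<^sup>2" if "y \<in> Dm" "P \<omega> y = y" for y
  proof -
    have "- e \<le> 1 * (t - l)" "- e \<le> - 1 * (t - l)" if "t \<in> \<omega>" for t
      using subsetD[OF \<open>\<omega> \<subseteq> cball l e\<close> that] by (auto simp: dist_real_def)
    then have "- e * (norm y)\<^sup>2 \<le> 1 * (S y \<bullet> y)" "- e * (norm y)\<^sup>2 \<le> - 1 * (S y \<bullet> y)"
      using form_ge[OF \<omega> that, of "- e" 1 l] form_ge[OF \<omega> that, of "- e" "- 1" l] by (simp_all add: S_def)
    then show ?thesis by linarith
  qed
  show ?thesis
  proof (cases "S x = 0")
    case False
    define n where "n = norm (S x)"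
    have n: "n > 0" using False by (simp add: n_def)
    \<comment> \<open>The multiple of \<open>S x\<close> with the norm of \<open>x\<close>; it
      attains the Cauchy-Schwarz bound for \<open>S x \<bullet> y\<close>.\<close>
    define y where "y = (norm x / n) *\<^sub>R S x"
    have Sx: "S x \<in> Dm" "P \<omega> (S x) = S x"
      using x Tx P_commute[OF \<omega> x(1), of l] by (auto simp: S_def intro: Dm_diff Dm_scaleR)
    then have y: "y \<in> Dm" "P \<omega> y = y" "norm y = norm x"
      using \<omega> n by (auto simp: y_def P_scaleR n_def intro: Dm_scaleR)
    have S_add: "S (x + y) = S x + S y" "S (x - y) = S x - S y"
      using x y by (simp_all add: S_def T_add T_diff algebra_simps)
    have S_sym: "S y \<bullet> x = S x \<bullet> y"
      by (simp only: S_def inner_diff_left inner_scaleR_left T_sym[OF y(1) x(1)] inner_commute[of y])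
    have "4 * (S x \<bullet> y) = S (x + y) \<bullet> (x + y) - S (x - y) \<bullet> (x - y)"
      using S_sym by (simp add: S_add inner_add_left inner_add_right inner_diff_left inner_diff_right)
    also have "\<dots> \<le> e * (norm (x + y))\<^sup>2 + e * (norm (x - y))\<^sup>2"
      using bound[of "x + y"] bound[of "x - y"] \<omega> x y
      by (auto simp: P_add P_diff Dm_add Dm_diff)
    also have "\<dots> = 4 * (e * (norm x)\<^sup>2)"
    proof -
      have "(norm (x + y))\<^sup>2 + (norm (x - y))\<^sup>2 = 2 * (norm x)\<^sup>2 + 2 * (norm y)\<^sup>2"
        unfolding power2_norm_eq_inner
        by (simp add: inner_add_left inner_add_right inner_diff_left inner_diff_right)
      then show ?thesis using y(3) by (simp add: distrib_left[symmetric])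
    qed
    finally have "S x \<bullet> y \<le> e * (norm x)\<^sup>2" by simp
    moreover have "S x \<bullet> y = norm x * n"
      using n by (simp add: y_def n_def power2_norm_eq_inner[symmetric] power2_eq_square)
    ultimately have "norm x * n \<le> norm x * (e * norm x)"
      by (simp add: power2_eq_square mult_ac)
    then show ?thesis
      using \<open>e > 0\<close> False n by (cases "norm x = 0") (auto simp: S_def n_def T_zero)
  qed (use \<open>e > 0\<close> in \<open>simp add: S_def\<close>)
qed

text \<open>The form of \<open>T - l\<close> is at least \<open>a\<close> on the part of
  \<open>\<omega>\<close> to the right of \<open>l\<close> and at most \<open>- a\<close> on the
  part to the left. Testing against \<open>P A x - P B x\<close>, which has the norm of
  \<open>x\<close>, adds up both contributions with the right sign.\<close>

lemma norm_shift_ge: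
  assumes \<omega>: "\<omega> \<in> sets borel" and x: "x \<in> Dm" "P \<omega> x = x" and a: "\<And>t. t \<in> \<omega> \<Longrightarrow> a \<le> \<bar>t - l\<bar>"
  shows "a * norm x \<le> norm (T x - l *\<^sub>R x)"
proof -
  define S where "S x = T x - l *\<^sub>R x" for x
  define A B where "A = \<omega> \<inter> {l..}" and "B = \<omega> \<inter> {..<l}"
  have AB: "A \<in> sets borel" "B \<in> sets borel" "A \<inter> B = {}" "A \<union> B = \<omega>"
    using \<omega> by (auto simp: A_def B_def)
  have mem: "P A x \<in> Dm" "P B x \<in> Dm"
    using AB x by (auto intro: P_in_Dm)
  have split: "x = P A x + P B x"
    using P_Un[OF AB(1,2,3), of x] AB(4) x(2) by simp
  have "a * (norm (P A x))\<^sup>2 \<le> 1 * (S (P A x) \<bullet> P A x)"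
    unfolding S_def
  proof (rule form_ge[OF AB(1) mem(1) P_idem[OF AB(1)]])
    show "a \<le> 1 * (t - l)" if "t \<in> A" for t
      using a[of t] that by (simp add: A_def)
  qed
  moreover have "a * (norm (P B x))\<^sup>2 \<le> - 1 * (S (P B x) \<bullet> P B x)"
    unfolding S_def
  proof (rule form_ge[OF AB(2) mem(2) P_idem[OF AB(2)]])
    show "a \<le> - 1 * (t - l)" if "t \<in> B" for t
      using a[of t] that by (simp add: B_def)
  qed
  moreover have orth: "S (P A x) \<bullet> P B x = 0" "S (P B x) \<bullet> P A x = 0"
    using P_commute[OF AB(1) x(1), of l] P_commute[OF AB(2) x(1), of l] AB P_orthogonal[of A B] P_orthogonal[of B A]
    by (auto simp: S_def Int_commute)
  moreover have "S x = S (P A x) + S (P B x)"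
    using T_add[OF mem] scaleR_add_right[of l "P A x" "P B x"] by (simp add: S_def split[symmetric])
  then have "S x \<bullet> (P A x - P B x) = S (P A x) \<bullet> P A x - S (P B x) \<bullet> P B x"
    using orth by (simp add: inner_add_left inner_diff_right)
  moreover have pyth: "(norm (P A x))\<^sup>2 + (norm (P B x))\<^sup>2 = (norm x)\<^sup>2"
    using arg_cong[OF split[symmetric], of "\<lambda>z. z \<bullet> z"] P_orthogonal[OF AB(1,2,3), of x x]
    by (simp add: power2_norm_eq_inner inner_add_left inner_add_right inner_commute)
  ultimately have "a * (norm x)\<^sup>2 \<le> S x \<bullet> (P A x - P B x)"
    using distrib_left[of a "(norm (P A x))\<^sup>2" "(norm (P B x))\<^sup>2"] by simp
  also have "\<dots> \<le> norm (S x) * norm (P A x - P B x)"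
    by (rule norm_cauchy_schwarz)
  also have "norm (P A x - P B x) = norm x"
  proof -
    have "(norm (P A x - P B x))\<^sup>2 = (norm x)\<^sup>2"
      using pyth P_orthogonal[OF AB(1,2,3), of x x]
      by (simp add: power2_norm_eq_inner inner_diff_left inner_diff_right inner_commute)
    then show ?thesis by simp
  qed
  finally have "norm x * (a * norm x) \<le> norm x * norm (S x)"
    by (simp add: power2_eq_square mult_ac)
  then show ?thesis
    by (cases "norm x = 0") (auto simp: S_def)
qed

lemma sum_norm_P_le:
  assumes R: "\<And>j::nat. R j \<in> sets borel" "\<And>i j. i \<noteq> j \<Longrightarrow> R i \<inter> R j = {}"
  shows "(\<Sum>j\<le>J. (norm (P (R j) x))\<^sup>2) \<le> (norm x)\<^sup>2" "(\<Sum>j\<le>J. P (R j) x) = P (\<Union>j\<le>J. R j) x"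
proof -
  show eq: "(\<Sum>j\<le>J. P (R j) x) = P (\<Union>j\<le>J. R j) x"
  proof (induction J)
    case (Suc J)
    have "P ((\<Union>j\<le>J. R j) \<union> R (Suc J)) x = P (\<Union>j\<le>J. R j) x + P (R (Suc J)) x"
    proof (rule P_Un)
      show "(\<Union>j\<le>J. R j) \<inter> R (Suc J) = {}"
      proof -
        have "R i \<inter> R (Suc J) = {}" if "i \<le> J" for i
          using R(2)[of i "Suc J"] that by simp
        then show ?thesis by auto
      qed
    qed (use R(1) in auto)
    then show ?case using Suc by (simp add: atMost_Suc Un_commute)
  qed simp
  have "(\<Sum>j\<le>J. (norm (P (R j) x))\<^sup>2) = (\<Sum>j\<le>J. P (R j) x) \<bullet> x"
    by (simp add: inner_sum_left P_form[OF R(1)])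
  also have "\<dots> = (norm (P (\<Union>j\<le>J. R j) x))\<^sup>2"
    unfolding eq using R(1) by (intro P_form) auto
  also have "\<dots> \<le> (norm x)\<^sup>2"
    using R(1) by (intro power_mono norm_P_le) auto
  finally show "(\<Sum>j\<le>J. (norm (P (R j) x))\<^sup>2) \<le> (norm x)\<^sup>2" .
qed

text \<open>Cauchy--Schwarz over the annuli \<open>4\<^sup>j\<^sup>-\<^sup>1 e \<le> \<bar>t - l\<bar> < 4\<^sup>j e\<close>, on which \<open>T - l\<close> is bounded
  below by \<open>4\<^sup>j\<^sup>-\<^sup>1 e\<close>.\<close>

lemma inner_P_ball_le:
  assumes y: "y \<in> Dm" and "e > 0"
  shows "(P (ball l (4 ^ J * e)) x \<bullet> y)\<^sup>2 \<le> (\<Sum>j\<le>J. (1 / 16) ^ j * measure (\<mu> x) (ball l (4 ^ j * e)))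
    * ((norm y)\<^sup>2 + 16 / e\<^sup>2 * (norm (T y - l *\<^sub>R y))\<^sup>2)"
proof -
  define g where "g = T y - l *\<^sub>R y"
  define R where "R j = (if j = 0 then ball l e else ball l (4 ^ j * e) - ball l (4 ^ (j - 1) * e))" for j :: nat
  have R: "R j \<in> sets borel" for j by (auto simp: R_def)
  have mono: "ball l (4 ^ i * e) \<subseteq> ball l (4 ^ j * e)" if "i \<le> j" for i j :: nat
    using \<open>e > 0\<close> that by (intro subset_ball mult_right_mono power_increasing) auto
  have R_sub: "R j \<subseteq> ball l (4 ^ j * e)" for j
    by (auto simp: R_def)
  have R_lt: "R i \<inter> R j = {}" if "i < j" for i j
  proof -
    have "R i \<subseteq> ball l (4 ^ (j - 1) * e)"
      using mono[of i "j - 1"] R_sub[of i] that by force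
    then show ?thesis using that by (auto simp: R_def[of j])
  qed
  have disj: "R i \<inter> R j = {}" if "i \<noteq> j" for i j
    using R_lt[of i j] R_lt[of j i] that by (cases "i < j") (auto simp: Int_commute)
  have UN: "(\<Union>j\<le>J. R j) = ball l (4 ^ J * e)" for J
  proof (induction J)
    case 0
    then show ?case by (simp add: R_def)
  next
    case (Suc J)
    then show ?case using mono[of J "Suc J"] by (auto simp: atMost_Suc R_def[of "Suc J"] simp del: power_Suc)
  qed
  have sum_P: "(\<Sum>j\<le>J. P (R j) x) = P (\<Union>j\<le>J. R j) x" for x
    by (rule sum_norm_P_le(2)) (use R disj in auto)
  have sum_norm: "(\<Sum>j\<le>J. (norm (P (R j) x))\<^sup>2) \<le> (norm x)\<^sup>2" for x
    by (rule sum_norm_P_le(1)) (use R disj in auto)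
  have "P (ball l (4 ^ J * e)) x \<bullet> y = (\<Sum>j\<le>J. P (R j) x \<bullet> y)"
    by (simp only: sum_P UN inner_sum_left[symmetric])
  also have "\<dots> = (\<Sum>j\<le>J. P (R j) x \<bullet> P (R j) y)"
    using P_sym[OF R, of j "P (R j) x" y for j] P_idem[OF R] by simp
  finally have "\<bar>P (ball l (4 ^ J * e)) x \<bullet> y\<bar> \<le> (\<Sum>j\<le>J. \<bar>P (R j) x \<bullet> P (R j) y\<bar>)"
    by (simp add: sum_abs)
  \<comment> \<open>The factor \<open>4 ^ j\<close> goes to \<open>y\<close>, where the lower bound
    for \<open>T - l\<close> on the annulus absorbs it; the squares of the factors
    \<open>(1 / 4) ^ j\<close> left to \<open>x\<close> are the weights
    \<open>(1 / 16) ^ j\<close>.\<close>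
  also have "\<dots> \<le> (\<Sum>j\<le>J. ((1 / 4) ^ j * norm (P (R j) x)) * (4 ^ j * norm (P (R j) y)))"
    by (intro sum_mono order_trans[OF Cauchy_Schwarz_ineq2]) (simp add: power_one_over)
  finally have "(P (ball l (4 ^ J * e)) x \<bullet> y)\<^sup>2
      \<le> (\<Sum>j\<le>J. ((1 / 4) ^ j * norm (P (R j) x)) * (4 ^ j * norm (P (R j) y)))\<^sup>2"
    by (intro abs_le_square_iff[THEN iffD1] order_trans[OF _ abs_ge_self])
  also have "\<dots> \<le> (\<Sum>j\<le>J. ((1 / 4) ^ j * norm (P (R j) x))\<^sup>2) * (\<Sum>j\<le>J. (4 ^ j * norm (P (R j) y))\<^sup>2)"
    by (rule Cauchy_Schwarz_ineq_sum)
  also have "\<dots> \<le> (\<Sum>j\<le>J. (1 / 16) ^ j * measure (\<mu> x) (ball l (4 ^ j * e)))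
      * ((norm y)\<^sup>2 + 16 / e\<^sup>2 * (norm g)\<^sup>2)"
  proof (intro mult_mono sum_mono sum_nonneg mult_nonneg_nonneg)
    fix j
    have "(norm (P (R j) x))\<^sup>2 = measure (\<mu> x) (R j)"
      using R by (simp add: measure_\<mu> P_form)
    also have "\<dots> \<le> measure (\<mu> x) (ball l (4 ^ j * e))"
      using R_sub by (intro \<mu>.finite_measure_mono) auto
    finally have "(1 / 16) ^ j * (norm (P (R j) x))\<^sup>2 \<le> (1 / 16) ^ j * measure (\<mu> x) (ball l (4 ^ j * e))"
      by (intro mult_left_mono) auto
    moreover have "((1 / 4) ^ j)\<^sup>2 = (1 / 16 :: real) ^ j"
      by (simp add: power2_eq_square power_mult_distrib[symmetric])
    ultimately show "((1 / 4) ^ j * norm (P (R j) x))\<^sup>2 \<le> (1 / 16) ^ j * measure (\<mu> x) (ball l (4 ^ j * e))"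
      by (simp add: power_mult_distrib)
  next
    \<comment> \<open>The innermost set \<open>R 0\<close> is a full ball, where
      \<open>T - l\<close> has no lower bound; it is responsible for the separate term in
      \<open>y\<close> itself.\<close>
    have "(4 ^ j * norm (P (R j) y))\<^sup>2 \<le> (if j = 0 then (norm (P (R 0) y))\<^sup>2 else 0) + 16 / e\<^sup>2 * (norm (P (R j) g))\<^sup>2" for j
    proof (cases "j = 0")
      case False
      then obtain i where j: "j = Suc i" by (cases j) auto
      have "4 ^ i * e * norm (P (R j) y) \<le> norm (T (P (R j) y) - l *\<^sub>R P (R j) y)"
        using y R by (intro norm_shift_ge[of "R j"] P_in_Dm P_idem) (auto simp: R_def j dist_real_def abs_minus_commute)
      then have "4 ^ i * e * norm (P (R j) y) \<le> norm (P (R j) g)"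
        using P_commute[OF R y] by (simp add: g_def)
      then have "4 ^ j * norm (P (R j) y) \<le> 4 / e * norm (P (R j) g)"
        using \<open>e > 0\<close> by (simp add: j field_simps)
      then have "(4 ^ j * norm (P (R j) y))\<^sup>2 \<le> (4 / e * norm (P (R j) g))\<^sup>2"
        using \<open>e > 0\<close> by (intro power_mono) auto
      then show ?thesis using False by (simp add: power_mult_distrib power_divide)
    qed simp
    then have "(\<Sum>j\<le>J. (4 ^ j * norm (P (R j) y))\<^sup>2)
        \<le> (\<Sum>j\<le>J. (if j = 0 then (norm (P (R 0) y))\<^sup>2 else 0) + 16 / e\<^sup>2 * (norm (P (R j) g))\<^sup>2)"
      by (intro sum_mono)
    also have "\<dots> = (norm (P (R 0) y))\<^sup>2 + 16 / e\<^sup>2 * (\<Sum>j\<le>J. (norm (P (R j) g))\<^sup>2)"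
      by (simp add: sum.distrib sum_distrib_left)
    also have "\<dots> \<le> (norm y)\<^sup>2 + 16 / e\<^sup>2 * (norm g)\<^sup>2"
      using sum_norm[of g] R by (intro add_mono mult_left_mono power_mono norm_P_le) auto
    finally show "(\<Sum>j\<le>J. (4 ^ j * norm (P (R j) y))\<^sup>2) \<le> (norm y)\<^sup>2 + 16 / e\<^sup>2 * (norm g)\<^sup>2" .
  qed auto
  finally show ?thesis unfolding g_def .
qed

end

section \<open>The Hilbert space of square-summable sequences\<close>

lemma summable_inner:
  fixes u v :: "nat \<Rightarrow> 'a::real_inner"
  assumes "summable (\<lambda>n. (norm (u n))\<^sup>2)" "summable (\<lambda>n. (norm (v n))\<^sup>2)"
  shows "summable (\<lambda>n. u n \<bullet> v n)"
proof (rule summable_comparison_test'[OF summable_add[OF assms]])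
  fix n
  have "norm (u n) * norm (v n) \<le> (norm (u n))\<^sup>2 + (norm (v n))\<^sup>2"
    using zero_le_power2[of "norm (u n) - norm (v n)"] zero_le_power2[of "norm (u n)"] zero_le_power2[of "norm (v n)"]
    unfolding power2_diff by linarith
  then show "norm (u n \<bullet> v n) \<le> (norm (u n))\<^sup>2 + (norm (v n))\<^sup>2"
    using Cauchy_Schwarz_ineq2[of "u n" "v n"] by simp
qed

lemma summable_norm_add:
  fixes u v :: "nat \<Rightarrow> 'a::real_inner"
  assumes "summable (\<lambda>n. (norm (u n))\<^sup>2)" "summable (\<lambda>n. (norm (v n))\<^sup>2)"
  shows "summable (\<lambda>n. (norm (u n + v n))\<^sup>2)"
proof -
  have "(norm (u n + v n))\<^sup>2 = (norm (u n))\<^sup>2 + (norm (v n))\<^sup>2 + 2 * (u n \<bullet> v n)" for n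
    by (simp add: power2_norm_eq_inner inner_add_left inner_add_right inner_commute)
  then show ?thesis
    using assms by (auto intro!: summable_add summable_mult summable_inner)
qed

text \<open>\<open>ell2\<close> is only a set of functions, whereas \<open>spectral_operator\<close>
  works over a type of class \<open>real_inner\<close>. For entries in \<open>complex^'d\<close> the
  inner product of this type is the real part of \<open>ell2_inner\<close>.\<close>

typedef (overloaded) ('a::real_inner) sqsum = "{u :: nat \<Rightarrow> 'a. summable (\<lambda>n. (norm (u n))\<^sup>2)}"
  morphisms seq_of Abs_sqsum
  by (rule exI[of _ "\<lambda>_. 0"]) simp

setup_lifting type_definition_sqsum

instantiation sqsum :: (real_inner) real_inner
begin

lift_definition zero_sqsum :: "'a sqsum" is "\<lambda>_. 0" by simp
lift_definition plus_sqsum :: "'a sqsum \<Rightarrow> 'a sqsum \<Rightarrow> 'a sqsum" is "\<lambda>u v n. u n + v n"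
  by (rule summable_norm_add)
lift_definition uminus_sqsum :: "'a sqsum \<Rightarrow> 'a sqsum" is "\<lambda>u n. - u n" by simp
lift_definition minus_sqsum :: "'a sqsum \<Rightarrow> 'a sqsum \<Rightarrow> 'a sqsum" is "\<lambda>u v n. u n - v n"
  using summable_norm_add[of _ "\<lambda>n. - v n" for v] by simp
lift_definition scaleR_sqsum :: "real \<Rightarrow> 'a sqsum \<Rightarrow> 'a sqsum" is "\<lambda>c u n. c *\<^sub>R u n"
  by (auto simp: power_mult_distrib intro: summable_mult)
lift_definition inner_sqsum :: "'a sqsum \<Rightarrow> 'a sqsum \<Rightarrow> real" is "\<lambda>u v. \<Sum>n. u n \<bullet> v n" .

definition norm_sqsum :: "'a sqsum \<Rightarrow> real" where "norm_sqsum x = sqrt (x \<bullet> x)"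
definition dist_sqsum :: "'a sqsum \<Rightarrow> 'a sqsum \<Rightarrow> real" where "dist_sqsum x y = norm (x - y)"
definition sgn_sqsum :: "'a sqsum \<Rightarrow> 'a sqsum" where "sgn_sqsum x = scaleR (inverse (norm x)) x"
definition uniformity_sqsum :: "('a sqsum \<times> 'a sqsum) filter" where
  "uniformity_sqsum = (INF e\<in>{0<..}. principal {(x, y). dist x y < e})"
definition open_sqsum :: "'a sqsum set \<Rightarrow> bool" where
  "open_sqsum U = (\<forall>x\<in>U. eventually (\<lambda>(x', y). x' = x \<longrightarrow> y \<in> U) uniformity)"

instance
proof
  fix x y z :: "'a sqsum" and c d :: real
  show "x + y + z = x + (y + z)" by transfer (simp add: add.assoc)
  show "x + y = y + x" by transfer (simp add: add.commute)
  show "0 + x = x" by transfer simp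
  show "- x + x = 0" by transfer simp
  show "x - y = x + - y" by transfer simp
  show "c *\<^sub>R (x + y) = c *\<^sub>R x + c *\<^sub>R y" by transfer (simp add: scaleR_add_right)
  show "(c + d) *\<^sub>R x = c *\<^sub>R x + d *\<^sub>R x" by transfer (simp add: scaleR_add_left)
  show "c *\<^sub>R d *\<^sub>R x = (c * d) *\<^sub>R x" by transfer simp
  show "1 *\<^sub>R x = x" by transfer simp
  show "x \<bullet> y = y \<bullet> x" by transfer (simp add: inner_commute)
  show "(x + y) \<bullet> z = x \<bullet> z + y \<bullet> z"
    by transfer (simp add: inner_add_left suminf_add summable_inner)
  show "(c *\<^sub>R x) \<bullet> y = c * (x \<bullet> y)"
    by transfer (simp add: suminf_mult summable_inner)
  show "0 \<le> x \<bullet> x"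
    by transfer (simp add: suminf_nonneg power2_norm_eq_inner)
  show "(x \<bullet> x = 0) = (x = 0)"
    by transfer (auto simp: power2_norm_eq_inner suminf_eq_zero_iff fun_eq_iff)
qed (fact norm_sqsum_def dist_sqsum_def sgn_sqsum_def uniformity_sqsum_def open_sqsum_def)+

end

lemma seq_of_simps:
  "seq_of 0 = (\<lambda>_. 0)"
  "seq_of (x + y) = (\<lambda>n. seq_of x n + seq_of y n)"
  "seq_of (x - y) = (\<lambda>n. seq_of x n - seq_of y n)"
  "seq_of (c *\<^sub>R x) = (\<lambda>n. c *\<^sub>R seq_of x n)"
  by (transfer, simp)+

lemma seq_of_sum: "seq_of (\<Sum>k\<in>A. f k) = (\<lambda>n. \<Sum>k\<in>A. seq_of (f k) n)"
  by (induction A rule: infinite_finite_induct) (auto simp: seq_of_simps)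

lemma sums_inner_sqsum: "(\<lambda>n. seq_of x n \<bullet> seq_of y n) sums (x \<bullet> y)"
  using seq_of[of x] seq_of[of y] by (simp add: inner_sqsum.rep_eq summable_inner summable_sums)

lemma sums_norm_sqsum: "(\<lambda>n. (norm (seq_of x n))\<^sup>2) sums (norm x)\<^sup>2"
  using sums_inner_sqsum[of x x] by (simp add: power2_norm_eq_inner)

lemma norm_seq_of_sum_le: "finite K \<Longrightarrow> (\<Sum>n\<in>K. (norm (seq_of x n))\<^sup>2) \<le> (norm x)\<^sup>2"
  using sum_le_suminf[OF sums_summable[OF sums_norm_sqsum[of x]], of K] sums_unique[OF sums_norm_sqsum[of x]]
  by simp

text \<open>The squared error is the tail of the series for the squared norm. This density of finite
  sequences carries vanishing from the coordinate vectors to the whole space.\<close>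

lemma sqsum_truncate:
  "(\<lambda>N. \<Sum>n<N. Abs_sqsum (\<lambda>k. if k = n then seq_of x n else 0)) \<longlonglongrightarrow> x"
proof -
  have mem: "summable (\<lambda>k. (norm (if k = n then v else 0))\<^sup>2)" for n and v :: 'a
    by (rule summable_finite[of "{n}"]) auto
  have seq: "seq_of (\<Sum>n<N. Abs_sqsum (\<lambda>k. if k = n then seq_of x n else 0)) k = (if k < N then seq_of x k else 0)" for N k
    by (simp add: seq_of_sum Abs_sqsum_inverse mem)
  define r where "r N = x - (\<Sum>n<N. Abs_sqsum (\<lambda>k. if k = n then seq_of x n else 0))" for N
  have sumr: "(norm (r N))\<^sup>2 = (norm x)\<^sup>2 - (\<Sum>n<N. (norm (seq_of x n))\<^sup>2)" for N
  proof -
    have "(\<lambda>n. (norm (seq_of x n))\<^sup>2 - (if n \<in> {..<N} then (norm (seq_of x n))\<^sup>2 else 0)) sums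
        ((norm x)\<^sup>2 - (\<Sum>n\<in>{..<N}. (norm (seq_of x n))\<^sup>2))"
      by (intro sums_diff sums_norm_sqsum sums_If_finite_set) auto
    moreover have "(norm (seq_of (r N) n))\<^sup>2 = (norm (seq_of x n))\<^sup>2 - (if n \<in> {..<N} then (norm (seq_of x n))\<^sup>2 else 0)" for n
      by (simp add: r_def seq_of_simps(3) seq)
    ultimately show ?thesis
      using sums_norm_sqsum[of "r N"] by (simp add: sums_unique2)
  qed
  have "(\<lambda>N. (norm x)\<^sup>2 - (\<Sum>n<N. (norm (seq_of x n))\<^sup>2)) \<longlonglongrightarrow> (norm x)\<^sup>2 - (norm x)\<^sup>2"
    using sums_norm_sqsum[of x] by (intro tendsto_intros) (simp add: sums_def)
  then have "(\<lambda>N. sqrt ((norm (r N))\<^sup>2)) \<longlonglongrightarrow> sqrt 0"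
    unfolding sumr by (intro tendsto_real_sqrt) simp
  then have "r \<longlonglongrightarrow> 0" by (simp add: tendsto_norm_zero_iff)
  then have "(\<lambda>N. x - r N) \<longlonglongrightarrow> x - 0" by (intro tendsto_intros)
  then show ?thesis by (simp add: r_def)
qed

section \<open>The complex structure and the transfer of spectral measures\<close>

lemma Re_cinner: "Re (cinner v w) = v \<bullet> w"
  by (simp add: cinner_def inner_vec_def inner_complex_def)

lemma cinner_scale_left: "cinner (c *s v) w = c * cinner v w"
  by (simp add: cinner_def sum_distrib_left mult.assoc)

lemma Im_cinner: "Im (cinner v w) = - ((\<i> *s v) \<bullet> w)"
  by (simp add: Re_cinner[symmetric] cinner_scale_left)

lemma of_real_smult: "complex_of_real c *s v = c *\<^sub>R v"
  unfolding vec_eq_iff vector_smult_component vector_scaleR_component by (simp add: scaleR_conv_of_real)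

lemma norm_smult: "norm (c *s v) = cmod c * norm v" for v :: "complex^'d"
  by (simp add: norm_vec_def norm_mult L2_set_right_distrib)

lemma ell2_iff: "u \<in> ell2 \<longleftrightarrow> (\<exists>x. u = seq_of x)"
  using seq_of by (auto simp: ell2_def intro: Abs_sqsum_inverse[symmetric])

lemma seq_of_in_ell2[simp]: "seq_of x \<in> ell2"
  using ell2_iff by blast

lemma seq_of_Abs: "u \<in> ell2 \<Longrightarrow> seq_of (Abs_sqsum u) = u"
  by (simp add: ell2_def Abs_sqsum_inverse)

text \<open>Multiplication by the imaginary unit expresses the imaginary part of
  \<open>ell2_inner\<close> by the real inner product; in this way the complex series is seen to
  converge.\<close>

lift_definition imult :: "(complex^'d) sqsum \<Rightarrow> (complex^'d) sqsum" is "\<lambda>u n. \<i> *s u n"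
  by (simp add: norm_smult)

lemma ell2_inner_sums: "(\<lambda>n. cinner (seq_of x n) (seq_of y n)) sums ell2_inner (seq_of x) (seq_of y)"
proof -
  have "(\<lambda>n. cinner (seq_of x n) (seq_of y n)) sums Complex (x \<bullet> y) (- (imult x \<bullet> y))"
    using sums_inner_sqsum[of x y] sums_minus[OF sums_inner_sqsum[of "imult x" y]]
    by (simp add: sums_complex_iff Re_cinner Im_cinner imult.rep_eq)
  then show ?thesis
    by (simp add: ell2_inner_def sums_iff)
qed

lemma Re_ell2_inner: "Re (ell2_inner (seq_of x) (seq_of y)) = x \<bullet> y"
  using sums_Re[OF ell2_inner_sums[of x y]] sums_inner_sqsum[of x y]
  by (simp add: Re_cinner sums_iff)

lemma ell2_norm_seq_of: "ell2_norm (seq_of x) = norm x"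
  using sums_norm_sqsum[of x] by (simp add: ell2_norm_def sums_iff)

lemma spectral_operator_of:
  fixes T :: "('d::finite) vop"
  assumes sp: "spectral_measure_of T E" and dense: "densely_defined T"
    and range: "\<And>u. u \<in> fst T \<Longrightarrow> snd T u \<in> ell2"
    and sym: "\<And>u v. u \<in> fst T \<Longrightarrow> v \<in> fst T \<Longrightarrow> ell2_inner (snd T u) v = ell2_inner u (snd T v)"
    and zero: "(\<lambda>_. 0) \<in> fst T"
    and lin: "\<And>u v c. u \<in> fst T \<Longrightarrow> v \<in> fst T \<Longrightarrow>
      (\<lambda>n. c *\<^sub>R u n + v n) \<in> fst T \<and> snd T (\<lambda>n. c *\<^sub>R u n + v n) = (\<lambda>n. c *\<^sub>R snd T u n + snd T v n)"
  defines "P \<equiv> \<lambda>\<omega> x. Abs_sqsum (E \<omega> (seq_of x))"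
    and "Dm \<equiv> {x. seq_of x \<in> fst T}"
    and "S \<equiv> \<lambda>x. Abs_sqsum (snd T (seq_of x))"
  shows "spectral_operator P Dm S"
    and "\<And>\<omega> x. \<omega> \<in> sets borel \<Longrightarrow> seq_of (P \<omega> x) = E \<omega> (seq_of x)"
    and "\<And>x. x \<in> Dm \<Longrightarrow> seq_of (S x) = snd T (seq_of x)"
    and "\<And>x. scalar_measure E (seq_of x) = spectral_mu P x"
proof -
  have pvm: "proj_valued_measure E"
    and dom: "fst T = {x \<in> ell2. integrable (scalar_measure E x) (\<lambda>t. t\<^sup>2)}"
    and form: "\<And>x. x \<in> fst T \<Longrightarrow> ell2_inner (snd T x) x = complex_of_real (\<integral>t. t \<partial>scalar_measure E x)"
    using sp by (auto simp: spectral_measure_of_def)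
  have proj: "ortho_projection (E \<omega>)" if "\<omega> \<in> sets borel" for \<omega>
    using pvm that by (simp add: proj_valued_measure_def)
  show seq_P: "seq_of (P \<omega> x) = E \<omega> (seq_of x)" if "\<omega> \<in> sets borel" for \<omega> x
    unfolding P_def using proj[OF that] by (intro seq_of_Abs) (simp add: ortho_projection_def)
  show seq_S: "seq_of (S x) = snd T (seq_of x)" if "x \<in> Dm" for x
    using that unfolding S_def Dm_def by (intro seq_of_Abs range) simp
  have inner_P: "P \<omega> x \<bullet> y = Re (ell2_inner (E \<omega> (seq_of x)) (seq_of y))" if "\<omega> \<in> sets borel" for \<omega> x y
    using seq_P[OF that, of x] Re_ell2_inner[of "P \<omega> x" y] by simp
  show mu: "scalar_measure E (seq_of x) = spectral_mu P x" for x
    unfolding scalar_measure_def spectral_mu_def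
    by (intro measure_of_eq) (auto simp: inner_P sets.sigma_sets_eq[of borel, simplified])
  have S_lin: "c *\<^sub>R x + y \<in> Dm \<and> S (c *\<^sub>R x + y) = c *\<^sub>R S x + S y" if "x \<in> Dm" "y \<in> Dm" for x y c
  proof -
    have L: "c *\<^sub>R x + y \<in> Dm" "snd T (seq_of (c *\<^sub>R x + y)) = (\<lambda>n. c *\<^sub>R snd T (seq_of x) n + snd T (seq_of y) n)"
      using lin[of "seq_of x" "seq_of y" c] that by (auto simp: Dm_def seq_of_simps)
    then have "seq_of (S (c *\<^sub>R x + y)) = seq_of (c *\<^sub>R S x + S y)"
      using that by (simp add: seq_S seq_of_simps)
    then show ?thesis using L(1) by (simp add: seq_of_inject)
  qed
  have zero_Dm: "0 \<in> Dm" using zero by (simp add: Dm_def seq_of_simps)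
  have S_zero: "S 0 = 0"
    using S_lin[OF zero_Dm zero_Dm, of 1] by simp
  show "spectral_operator P Dm S"
  proof (rule spectral_operator.intro)
    fix \<omega> :: "real set" assume \<omega>: "\<omega> \<in> sets borel"
    have lin: "P \<omega> (c *\<^sub>R x + y) = c *\<^sub>R P \<omega> x + P \<omega> y" for c x y
    proof -
      have "E \<omega> (\<lambda>n. complex_of_real c *s seq_of x n + seq_of y n) = (\<lambda>n. complex_of_real c *s E \<omega> (seq_of x) n + E \<omega> (seq_of y) n)"
        using proj[OF \<omega>] unfolding ortho_projection_def by (meson seq_of_in_ell2)
      then have "seq_of (P \<omega> (c *\<^sub>R x + y)) = seq_of (c *\<^sub>R P \<omega> x + P \<omega> y)"
        by (simp add: seq_P[OF \<omega>] seq_of_simps of_real_smult)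
      then show ?thesis by (simp add: seq_of_inject)
    qed
    have zero: "P \<omega> 0 = 0"
      using lin[of 1 0 0] by simp
    show "linear (P \<omega>)"
    proof (rule linearI)
      show "P \<omega> (x + y) = P \<omega> x + P \<omega> y" for x y
        using lin[of 1 x y] by simp
      show "P \<omega> (c *\<^sub>R x) = c *\<^sub>R P \<omega> x" for c x
        using lin[of c x 0] zero by simp
    qed
    show "P \<omega> x \<bullet> y = x \<bullet> P \<omega> y" for x y
      using proj[OF \<omega>] inner_P[OF \<omega>, of x y] Re_ell2_inner[of x "P \<omega> y"]
      by (simp add: seq_P[OF \<omega>] ortho_projection_def)
  next
    show "P UNIV x = x" for x
      using pvm by (simp add: P_def proj_valued_measure_def seq_of_inverse)
  next
    fix \<omega> \<omega>' :: "real set" and x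
    assume "\<omega> \<in> sets borel" "\<omega>' \<in> sets borel"
    then have "seq_of (P (\<omega> \<inter> \<omega>') x) = seq_of (P \<omega> (P \<omega>' x))"
      using pvm by (simp add: seq_P proj_valued_measure_def)
    then show "P (\<omega> \<inter> \<omega>') x = P \<omega> (P \<omega>' x)" by (simp add: seq_of_inject)
  next
    fix W :: "nat \<Rightarrow> real set" and x
    assume W: "range W \<subseteq> sets borel" "disjoint_family W"
    have "(\<lambda>N. ell2_norm (\<lambda>n. E (\<Union>k. W k) (seq_of x) n - (\<Sum>k<N. E (W k) (seq_of x) n))) \<longlonglongrightarrow> 0"
      using pvm W by (simp add: proj_valued_measure_def)
    moreover have "ell2_norm (\<lambda>n. E (\<Union>k. W k) (seq_of x) n - (\<Sum>k<N. E (W k) (seq_of x) n))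
        = norm (P (\<Union>k. W k) x - (\<Sum>k<N. P (W k) x))" for N
    proof -
      have "(\<Union>k. W k) \<in> sets borel" "\<And>k. W k \<in> sets borel" using W(1) by auto
      then show ?thesis
        unfolding ell2_norm_seq_of[symmetric] by (simp add: seq_of_simps seq_of_sum seq_P)
    qed
    ultimately have "(\<lambda>N. P (\<Union>k. W k) x - (\<Sum>k<N. P (W k) x)) \<longlonglongrightarrow> 0"
      by (simp add: tendsto_norm_zero_iff)
    then have "(\<lambda>N. P (\<Union>k. W k) x - (P (\<Union>k. W k) x - (\<Sum>k<N. P (W k) x))) \<longlonglongrightarrow> P (\<Union>k. W k) x - 0"
      by (intro tendsto_intros)
    then show "(\<lambda>k. P (W k) x) sums P (\<Union>k. W k) x"
      by (simp add: sums_def)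
  next
    show "subspace Dm"
      unfolding subspace_def using zero_Dm S_lin[of _ _ 1] S_lin[OF _ zero_Dm] by auto
    show "closure Dm = UNIV"
    proof (intro equalityI subset_UNIV subsetI)
      fix x
      show "x \<in> closure Dm"
        unfolding closure_approachable
      proof (intro allI impI)
        fix e :: real assume "e > 0"
        then obtain v where v: "v \<in> fst T" "ell2_norm (\<lambda>n. seq_of x n - v n) < e"
          using dense unfolding densely_defined_def by (meson seq_of_in_ell2)
        then obtain y where y: "v = seq_of y"
          using dense unfolding densely_defined_def by (meson ell2_iff subsetD)
        have "norm (x - y) < e"
          using v(2) ell2_norm_seq_of[of "x - y"] by (simp add: y seq_of_simps)
        then show "\<exists>y\<in>Dm. dist y x < e"
          using v(1) by (auto simp: y Dm_def dist_norm norm_minus_commute)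
      qed
    qed
    fix x y and c :: real assume x: "x \<in> Dm"
    show "S (c *\<^sub>R x) = c *\<^sub>R S x"
      using S_lin[OF x zero_Dm, of c] S_zero by simp
    show "S x \<bullet> x = (\<integral>t. t \<partial>spectral_mu P x)"
      using x form[of "seq_of x"] Re_ell2_inner[of "S x" x] by (simp add: seq_S mu Dm_def)
    assume y: "y \<in> Dm"
    show "S (x + y) = S x + S y"
      using S_lin[OF x y, of 1] by simp
    show "S x \<bullet> y = x \<bullet> S y"
      using x y sym[of "seq_of x" "seq_of y"] Re_ell2_inner[of "S x" y] Re_ell2_inner[of x "S y"]
      by (simp add: seq_S Dm_def)
  next
    show "x \<in> Dm \<longleftrightarrow> integrable (spectral_mu P x) (\<lambda>t. t\<^sup>2)" for x
      by (simp add: Dm_def dom mu)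
  qed
qed

section \<open>Three-term recursions\<close>

text \<open>Sequences are shifted by one: \<open>x 0\<close> stands for the entry at \<open>-1\<close>, and \<open>C 0\<close> for
  $A_{-1} = -I$.\<close>

locale three_term_recursion =
  fixes C Cs B :: "nat \<Rightarrow> 'v \<Rightarrow> 'v::euclidean_space" and l :: real
  assumes C_adj: "C n x \<bullet> y = x \<bullet> Cs n y"
    and C_linear: "linear (C n)" and Cs_linear: "linear (Cs n)" and B_linear: "linear (B n)"
    and C_bij: "bij (C n)" and Cs_surj: "surj (Cs n)"
    and B_sym: "B n x \<bullet> y = x \<bullet> B n y"
    and C_0: "C 0 x = - x"
begin

text \<open>The source \<open>g\<close> is not shifted: \<open>g n\<close> belongs to the equation
  at position \<open>n\<close>, whose central entry is \<open>x (Suc n)\<close>.\<close>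

definition is_sol :: "(nat \<Rightarrow> 'v) \<Rightarrow> (nat \<Rightarrow> 'v) \<Rightarrow> bool" where
  "is_sol g x \<longleftrightarrow> (\<forall>n. Cs n (x n) + B n (x (Suc n)) + C (Suc n) (x (Suc (Suc n))) = l *\<^sub>R x (Suc n) + g n)"

fun solve :: "(nat \<Rightarrow> 'v) \<Rightarrow> 'v \<times> 'v \<Rightarrow> nat \<Rightarrow> 'v" where
  "solve g p 0 = fst p"
| "solve g p (Suc 0) = snd p"
| "solve g p (Suc (Suc n)) = inv (C (Suc n))
     (l *\<^sub>R solve g p (Suc n) + g n - B n (solve g p (Suc n)) - Cs n (solve g p n))"

declare solve.simps(3) [simp del]

abbreviation "sol \<equiv> solve (\<lambda>_. 0)"

lemma C_inv: "C n (inv (C n) y) = y" "inv (C n) (C n y) = y"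
  using C_bij[of n] by (auto simp: bij_def surj_f_inv_f)

lemma is_sol_solve: "is_sol g (solve g p)"
  by (simp add: is_sol_def C_inv solve.simps(3))

lemma is_sol_unique:
  assumes "is_sol g x" "is_sol g y" "x 0 = y 0" "x (Suc 0) = y (Suc 0)"
  shows "x = y"
proof
  fix n
  have "x n = y n \<and> x (Suc n) = y (Suc n)"
  proof (induction n)
    case (Suc n)
    have "C (Suc n) (x (Suc (Suc n))) = C (Suc n) (y (Suc (Suc n)))"
      using assms(1,2)[unfolded is_sol_def, THEN spec[of _ n]] Suc by (metis add_left_cancel)
    then have "x (Suc (Suc n)) = y (Suc (Suc n))" by (metis C_inv(2))
    then show ?case using Suc by simp
  qed (use assms in simp)
  then show "x n = y n" ..
qed

lemma is_sol_lincomb: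
  assumes "is_sol g x" "is_sol h y"
  shows "is_sol (\<lambda>n. c *\<^sub>R g n + h n) (\<lambda>n. c *\<^sub>R x n + y n)"
  unfolding is_sol_def
proof
  fix n
  have "Cs n (x n) + B n (x (Suc n)) + C (Suc n) (x (Suc (Suc n))) = l *\<^sub>R x (Suc n) + g n"
    "Cs n (y n) + B n (y (Suc n)) + C (Suc n) (y (Suc (Suc n))) = l *\<^sub>R y (Suc n) + h n"
    using assms by (auto simp: is_sol_def)
  then have "c *\<^sub>R (Cs n (x n) + B n (x (Suc n)) + C (Suc n) (x (Suc (Suc n)))) +
      (Cs n (y n) + B n (y (Suc n)) + C (Suc n) (y (Suc (Suc n))))
    = c *\<^sub>R (l *\<^sub>R x (Suc n) + g n) + (l *\<^sub>R y (Suc n) + h n)"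
    by simp
  then show "Cs n (c *\<^sub>R x n + y n) + B n (c *\<^sub>R x (Suc n) + y (Suc n))
      + C (Suc n) (c *\<^sub>R x (Suc (Suc n)) + y (Suc (Suc n)))
    = l *\<^sub>R (c *\<^sub>R x (Suc n) + y (Suc n)) + (c *\<^sub>R g n + h n)"
    by (simp add: linear_add linear_scale C_linear Cs_linear B_linear scaleR_add_right algebra_simps)
qed

lemma is_sol_diff:
  assumes "is_sol g x" "is_sol h y"
  shows "is_sol (\<lambda>n. g n - h n) (\<lambda>n. x n - y n)"
  using is_sol_lincomb[OF assms(2,1), of "-1"] by simp

lemma sol_linear: "linear (\<lambda>p. sol p n)"
proof -
  have *: "sol (c *\<^sub>R p + q) = (\<lambda>n. c *\<^sub>R sol p n + sol q n)" for c p q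
    using is_sol_lincomb[OF is_sol_solve[of "\<lambda>_. 0" p] is_sol_solve[of "\<lambda>_. 0" q], of c]
    by (intro is_sol_unique[OF is_sol_solve]) auto
  have zero: "sol 0 n = 0"
    using *[of 1 0 0] by (simp add: fun_eq_iff)
  show ?thesis
    using *[of 1] *[of _ _ 0] zero by (intro linearI) simp_all
qed

definition wronskian :: "(nat \<Rightarrow> 'v) \<Rightarrow> (nat \<Rightarrow> 'v) \<Rightarrow> nat \<Rightarrow> real" where
  "wronskian x w n = C n (x (Suc n)) \<bullet> w n - x n \<bullet> C n (w (Suc n))"

text \<open>Summation by parts: by \<open>B_sym\<close> and \<open>C_adj\<close> each summand is a
  difference of consecutive Wronskians. In particular the Wronskian of two solutions without source
  is constant.\<close>

lemma lagrange:
  assumes x: "is_sol g x" and w: "is_sol (\<lambda>_. 0) w"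
  shows "(\<Sum>j<n. g j \<bullet> w (Suc j)) = wronskian x w n - wronskian x w 0"
proof (induction n)
  case (Suc n)
  have g: "g n = Cs n (x n) + B n (x (Suc n)) + C (Suc n) (x (Suc (Suc n))) - l *\<^sub>R x (Suc n)"
    using x by (simp add: is_sol_def)
  have w: "l *\<^sub>R w (Suc n) = Cs n (w n) + B n (w (Suc n)) + C (Suc n) (w (Suc (Suc n)))"
    using w by (simp add: is_sol_def)
  have "g n \<bullet> w (Suc n) = x n \<bullet> C n (w (Suc n)) + x (Suc n) \<bullet> B n (w (Suc n))
      + C (Suc n) (x (Suc (Suc n))) \<bullet> w (Suc n) - x (Suc n) \<bullet> (l *\<^sub>R w (Suc n))"
    unfolding g inner_add_left inner_diff_left B_sym[symmetric]
    using C_adj[of n "w (Suc n)" "x n"] by (simp add: inner_commute)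
  also have "\<dots> = wronskian x w (Suc n) - wronskian x w n"
    unfolding w by (simp add: wronskian_def inner_add_right C_adj[of n "x (Suc n)" "w n"])
  finally show ?case using Suc by simp
qed simp

text \<open>The recursion can be run backwards because each \<open>Cs n\<close> is surjective. This
  makes it possible to choose test solutions by their values far out.\<close>

lemma sol_through: "\<exists>s. sol s n = p \<and> sol s (Suc n) = q"
proof (induction n arbitrary: p q)
  case 0
  show ?case by (rule exI[of _ "(p, q)"]) simp
next
  case (Suc n)
  obtain r where r: "Cs n r = l *\<^sub>R p - B n p - C (Suc n) q"
    using Cs_surj[of n] by (metis surjD)
  obtain s where s: "sol s n = r" "sol s (Suc n) = p"
    using Suc by blast
  have "sol s (Suc (Suc n)) = inv (C (Suc n)) (C (Suc n) q)"
    by (simp add: solve.simps(3) s r)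
  then show ?case using s by (metis C_inv(2))
qed

text \<open>The Hilbert-Schmidt norm of the map from starting values to the entry at
  \<open>n\<close>. Its square is a sum over a basis, so that weighted sums of it are exact sums of
  weighted norms of solutions.\<close>

definition \<tau> :: "nat \<Rightarrow> real" where
  "\<tau> n = sqrt (\<Sum>e\<in>Basis. (norm (sol e n))\<^sup>2)"

lemma \<tau>_nonneg: "\<tau> n \<ge> 0"
  by (simp add: \<tau>_def sum_nonneg)

lemma \<tau>_sq: "(\<tau> n)\<^sup>2 = (\<Sum>e\<in>Basis. (norm (sol e n))\<^sup>2)"
  by (simp add: \<tau>_def sum_nonneg)

lemma norm_sol_le: "norm (sol p n) \<le> norm p * \<tau> n"
proof (rule power2_le_imp_le)
  have "sol p n = sol (\<Sum>e\<in>Basis. (p \<bullet> e) *\<^sub>R e) n"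
    by (simp add: euclidean_representation)
  also have "\<dots> = (\<Sum>e\<in>Basis. (p \<bullet> e) *\<^sub>R sol e n)"
    using linear_sum[OF sol_linear, of "\<lambda>e. (p \<bullet> e) *\<^sub>R e" Basis n] by (simp add: linear_scale[OF sol_linear])
  finally have "norm (sol p n) \<le> (\<Sum>e\<in>Basis. \<bar>p \<bullet> e\<bar> * norm (sol e n))"
    by (metis (mono_tags, lifting) norm_scaleR norm_sum sum.cong)
  then have "(norm (sol p n))\<^sup>2 \<le> (\<Sum>e\<in>Basis. \<bar>p \<bullet> e\<bar> * norm (sol e n))\<^sup>2"
    by (intro power_mono) auto
  also have "\<dots> \<le> (\<Sum>e\<in>Basis. \<bar>p \<bullet> e\<bar>\<^sup>2) * (\<Sum>e\<in>Basis. (norm (sol e n))\<^sup>2)"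
    by (rule Cauchy_Schwarz_ineq_sum)
  also have "(\<Sum>e\<in>Basis. \<bar>p \<bullet> e\<bar>\<^sup>2) = (norm p)\<^sup>2"
    unfolding power2_norm_eq_inner by (subst euclidean_inner) (simp add: power2_eq_square)
  finally show "(norm (sol p n))\<^sup>2 \<le> (norm p * \<tau> n)\<^sup>2"
    by (simp add: power_mult_distrib \<tau>_sq)
qed (simp add: \<tau>_nonneg)

text \<open>The Wronskian of the perturbation with the solution \<open>w\<close> vanishing at \<open>n\<close> recovers
  \<open>e n\<close>; the Wronskian of \<open>w\<close> with its rotation by a right angle at the start bounds the
  starting values of \<open>w\<close>.\<close>

lemma perturbation_le:
  assumes e: "is_sol g e" "e 0 = 0" "e (Suc 0) = 0"
  shows "(norm (e (Suc n)))\<^sup>2 \<le> (\<tau> (Suc n))\<^sup>2 * ((\<Sum>j<n. (norm (g j))\<^sup>2) * (\<Sum>j<n. (\<tau> (Suc j))\<^sup>2))"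
proof -
  define m where "m = Suc n"
  obtain s where s: "sol s m = 0" "sol s (Suc m) = inv (C m) (- e m)"
    using sol_through by blast
  have Cw: "C m (sol s (Suc m)) = - e m"
    by (simp add: s C_inv)
  have "norm s \<le> norm (e m) * \<tau> m"
  proof (cases "s = 0")
    case False
    define s' where "s' = (- snd s, fst s)"
    have "wronskian (sol s) (sol s') m - wronskian (sol s) (sol s') 0 = 0"
      using lagrange[OF is_sol_solve[of "\<lambda>_. 0" s] is_sol_solve[of _ s'], where n = m] by simp
    then have "- (e m \<bullet> sol s' m) = fst s \<bullet> fst s + snd s \<bullet> snd s"
      by (simp add: wronskian_def s(1) Cw C_0 s'_def)
    also have "\<dots> = (norm s)\<^sup>2"
      by (simp add: power2_norm_eq_inner inner_prod_def)
    finally have "(norm s)\<^sup>2 \<le> norm (e m) * norm (sol s' m)"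
      using Cauchy_Schwarz_ineq2[of "e m" "sol s' m"] by linarith
    also have "\<dots> \<le> norm (e m) * (norm s' * \<tau> m)"
      by (intro mult_left_mono norm_sol_le) auto
    also have "norm s' = norm s"
      by (simp add: s'_def norm_prod_def add.commute)
    finally have "norm s * norm s \<le> norm s * (norm (e m) * \<tau> m)"
      by (simp add: power2_eq_square mult_ac)
    then show ?thesis using False by simp
  qed (simp add: \<tau>_nonneg)
  note s_le = this
  have "(\<Sum>j<m. g j \<bullet> sol s (Suc j)) = (norm (e m))\<^sup>2"
    using lagrange[OF e(1) is_sol_solve, of s m]
    by (simp add: wronskian_def s(1) Cw C_0 e(2,3) power2_norm_eq_inner)
  \<comment> \<open>The last summand \<open>j = n\<close> drops out because \<open>sol s\<close>
    vanishes at \<open>m = Suc n\<close>.\<close>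
  then have "(norm (e m))\<^sup>2 = (\<Sum>j<n. g j \<bullet> sol s (Suc j))"
    using s(1) by (simp add: m_def)
  also have "\<dots> \<le> (\<Sum>j<n. norm (g j) * (norm (e m) * \<tau> m * \<tau> (Suc j)))"
  proof (intro sum_mono)
    fix j
    have "norm (sol s (Suc j)) \<le> norm (e m) * \<tau> m * \<tau> (Suc j)"
      using mult_right_mono[OF s_le \<tau>_nonneg, of "Suc j"] norm_sol_le[of s "Suc j"] by linarith
    then show "g j \<bullet> sol s (Suc j) \<le> norm (g j) * (norm (e m) * \<tau> m * \<tau> (Suc j))"
      by (intro order_trans[OF norm_cauchy_schwarz] mult_left_mono) auto
  qed
  also have "\<dots> = norm (e m) * (\<tau> m * (\<Sum>j<n. norm (g j) * \<tau> (Suc j)))"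
    by (simp add: sum_distrib_left mult_ac)
  finally have "norm (e m) \<le> \<tau> m * (\<Sum>j<n. norm (g j) * \<tau> (Suc j))"
    by (cases "norm (e m) = 0") (auto simp: power2_eq_square \<tau>_nonneg intro!: mult_nonneg_nonneg sum_nonneg)
  then have "(norm (e m))\<^sup>2 \<le> (\<tau> m * (\<Sum>j<n. norm (g j) * \<tau> (Suc j)))\<^sup>2"
    by (intro power_mono) auto
  also have "\<dots> \<le> (\<tau> m)\<^sup>2 * ((\<Sum>j<n. (norm (g j))\<^sup>2) * (\<Sum>j<n. (\<tau> (Suc j))\<^sup>2))"
    unfolding power_mult_distrib by (intro mult_left_mono Cauchy_Schwarz_ineq_sum) auto
  finally show ?thesis by (simp add: m_def)
qed

text \<open>With \<open>N\<close> and \<open>\<theta>\<close> the integer and fractional part of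
  \<open>t\<close>, \<open>W\<close> is the square of the truncated norm for shifted sequences. The
  numbers \<open>m\<close> and \<open>T\<close> bound it from below and above on solutions with
  starting vector of norm one.\<close>

context
  fixes N :: nat and \<theta> m T :: real and W :: "(nat \<Rightarrow> real) \<Rightarrow> real"
  assumes \<theta>: "0 \<le> \<theta>" "\<theta> \<le> 1" and m: "m > 0"
  defines "W \<equiv> \<lambda>f. (\<Sum>k\<le>N. f (Suc k)) + \<theta> * f (Suc (Suc N))"
  defines "T \<equiv> W (\<lambda>k. (\<tau> k)\<^sup>2)"
  assumes W_ge: "\<And>p. m * (norm p)\<^sup>2 \<le> W (\<lambda>k. (norm (sol p k))\<^sup>2)"
begin

lemma W_mono: "(\<And>k. k \<le> Suc N \<Longrightarrow> f (Suc k) \<le> g (Suc k)) \<Longrightarrow> W f \<le> W g"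
  unfolding W_def using \<theta> by (intro add_mono sum_mono mult_left_mono) auto

lemma W_linear: "W (\<lambda>k. c * f k + d * g k) = c * W f + d * W g"
  by (simp add: W_def sum.distrib sum_distrib_left algebra_simps)

lemma W_add_le: "W (\<lambda>k. (norm (x k + y k))\<^sup>2) \<le> 2 * W (\<lambda>k. (norm (x k))\<^sup>2) + 2 * W (\<lambda>k. (norm (y k))\<^sup>2)"
  for x y :: "nat \<Rightarrow> 'v"
proof -
  have "(norm (x k + y k))\<^sup>2 \<le> 2 * (norm (x k))\<^sup>2 + 2 * (norm (y k))\<^sup>2" for k
    using zero_le_power2[of "norm (x k - y k)"]
    by (simp add: power2_norm_eq_inner inner_add_left inner_add_right inner_diff_left inner_diff_right)
  then have "W (\<lambda>k. (norm (x k + y k))\<^sup>2) \<le> W (\<lambda>k. 2 * (norm (x k))\<^sup>2 + 2 * (norm (y k))\<^sup>2)"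
    by (intro W_mono)
  then show ?thesis by (simp only: W_linear)
qed

lemma W_sol_le: "W (\<lambda>k. (norm (sol p k))\<^sup>2) \<le> T * (norm p)\<^sup>2"
proof -
  \<comment> \<open>The term \<open>0 * 0\<close> merely matches the two-term shape of
    \<open>W_linear\<close>.\<close>
  have "W (\<lambda>k. (norm (sol p k))\<^sup>2) \<le> W (\<lambda>k. (norm p)\<^sup>2 * (\<tau> k)\<^sup>2 + 0 * 0)"
    by (intro W_mono) (simp add: norm_sol_le power_mono flip: power_mult_distrib)
  also have "\<dots> = (norm p)\<^sup>2 * T" unfolding W_linear by (simp add: T_def)
  finally show ?thesis by (simp add: mult.commute)
qed

text \<open>One factor \<open>T\<close> comes from the sum inside \<open>perturbation_le\<close>,
  the other from summing the resulting pointwise bound. The entry at \<open>Suc k\<close> sees only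
  the sources \<open>g j\<close> with \<open>j < k\<close>, so sources up to \<open>N\<close>
  suffice even for the fractional entry.\<close>

lemma W_perturbation_le:
  assumes e: "is_sol g e" "e 0 = 0" "e (Suc 0) = 0"
  shows "W (\<lambda>k. (norm (e k))\<^sup>2) \<le> T\<^sup>2 * (\<Sum>j\<le>N. (norm (g j))\<^sup>2)"
proof -
  define Q where "Q = (\<Sum>j\<le>N. (norm (g j))\<^sup>2)"
  have "W (\<lambda>k. (norm (e k))\<^sup>2) \<le> W (\<lambda>k. (Q * T) * (\<tau> k)\<^sup>2 + 0 * 0)"
  proof (intro W_mono)
    fix k assume k: "k \<le> Suc N"
    have "(norm (e (Suc k)))\<^sup>2 \<le> (\<tau> (Suc k))\<^sup>2 * ((\<Sum>j<k. (norm (g j))\<^sup>2) * (\<Sum>j<k. (\<tau> (Suc j))\<^sup>2))"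
      by (rule perturbation_le[OF e])
    also have "\<dots> \<le> (\<tau> (Suc k))\<^sup>2 * (Q * T)"
    proof (intro mult_left_mono mult_mono)
      show "(\<Sum>j<k. (norm (g j))\<^sup>2) \<le> Q"
        unfolding Q_def using k by (intro sum_mono2) auto
      have "(\<Sum>j<k. (\<tau> (Suc j))\<^sup>2) \<le> (\<Sum>j\<le>N. (\<tau> (Suc j))\<^sup>2)"
        using k by (intro sum_mono2) auto
      also have "\<dots> \<le> T"
        using \<theta> by (simp add: T_def W_def)
      finally show "(\<Sum>j<k. (\<tau> (Suc j))\<^sup>2) \<le> T" .
    qed (auto simp: Q_def intro!: sum_nonneg)
    finally show "(norm (e (Suc k)))\<^sup>2 \<le> (Q * T) * (\<tau> (Suc k))\<^sup>2 + 0 * 0"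
      by (simp add: mult_ac)
  qed
  also have "\<dots> = Q * T * T" unfolding W_linear by (simp add: T_def)
  finally show ?thesis by (simp add: Q_def power2_eq_square mult_ac)
qed

text \<open>The unperturbed solution with the starting values of \<open>x\<close> differs from
  \<open>x\<close> by a perturbation which the last hypothesis bounds by \<open>X\<close>. Its
  weighted norm is therefore at most \<open>2 * X + 2 * X\<close>, and \<open>W_ge\<close> converts
  this into a bound for the start.\<close>

lemma start_le:
  assumes x: "is_sol g x" "x 0 = 0" and X: "W (\<lambda>k. (norm (x k))\<^sup>2) \<le> X"
    and g: "T\<^sup>2 * (\<Sum>j\<le>N. (norm (g j))\<^sup>2) \<le> X"
  shows "m * (norm (x (Suc 0)))\<^sup>2 \<le> 4 * X"
proof -
  define p where "p = (0 :: 'v, x (Suc 0))"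
  have e: "is_sol g (\<lambda>k. x k - sol p k)"
    using is_sol_diff[OF x(1) is_sol_solve, of "\<lambda>_. 0" p] by simp
  have "is_sol (\<lambda>k. - g k) (\<lambda>k. sol p k - x k)"
    using is_sol_diff[OF is_sol_solve x(1), of "\<lambda>_. 0" p] by simp
  then have "W (\<lambda>k. (norm (sol p k - x k))\<^sup>2) \<le> T\<^sup>2 * (\<Sum>j\<le>N. (norm (- g j))\<^sup>2)"
    using x(2) by (intro W_perturbation_le) (auto simp: p_def)
  then have "W (\<lambda>k. (norm (sol p k))\<^sup>2) \<le> 2 * X + 2 * X"
    using W_add_le[of x "\<lambda>k. sol p k - x k"] X g by simp
  moreover have "norm p = norm (x (Suc 0))"
    by (simp add: p_def norm_prod_def)
  ultimately show ?thesis
    using W_ge[of p] by simp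
qed

text \<open>The source \<open>g\<close> is the weighted Riesz representative, among the solutions, of
  \<open>w \<mapsto> v \<bullet> w\<^sub>-\<^sub>1\<close>; by the Lagrange identity this choice makes \<open>y\<close> vanish beyond \<open>N\<close>.\<close>

lemma finite_solution:
  obtains y g where "is_sol g y" "y 0 = 0" "y (Suc 0) = v"
    "\<And>k. k > N \<Longrightarrow> y (Suc k) = 0" "\<And>k. k > Suc N \<Longrightarrow> g k = 0"
    "(\<Sum>k\<le>Suc N. (norm (g k))\<^sup>2) \<le> (norm v)\<^sup>2 / m"
    "(\<Sum>k\<le>N. (norm (y (Suc k)))\<^sup>2) \<le> 2 * T * (1 + T / m) * (norm v)\<^sup>2"
proof -
  \<comment> \<open>The Gram operator of the \<open>W\<close>-weighted inner product of solutions,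
    on the space of starting values. \<open>W_ge\<close> makes it positive definite, hence
    invertible.\<close>
  define L where "L p = (\<Sum>k\<le>N. adjoint (\<lambda>p. sol p (Suc k)) (sol p (Suc k)))
    + \<theta> *\<^sub>R adjoint (\<lambda>p. sol p (Suc (Suc N))) (sol p (Suc (Suc N)))" for p
  have L_inner: "L p \<bullet> q = W (\<lambda>k. sol p k \<bullet> sol q k)" for p q
    using adjoint_clauses(2)[OF sol_linear]
    by (simp add: L_def W_def inner_add_left inner_sum_left)
  have "linear L"
    unfolding L_def
    by (intro linear_compose_add linear_compose_sum linear_compose_scale_right ballI
        linear_compose[OF sol_linear adjoint_linear[OF sol_linear], unfolded o_def])
  have L_pos: "m * (norm p)\<^sup>2 \<le> L p \<bullet> p" for p
    using W_ge[of p] by (simp add: L_inner power2_norm_eq_inner)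
  have "inj L"
  proof (rule linear_injective_0[OF \<open>linear L\<close>, THEN iffD2], intro allI impI)
    fix p assume "L p = 0"
    then have "m * (norm p)\<^sup>2 \<le> 0" using L_pos[of p] by simp
    then show "p = 0" using m by (simp add: mult_le_0_iff)
  qed
  then have "surj L"
    using \<open>linear L\<close> by (intro linear_injective_imp_surjective) simp_all
  then obtain p where p: "L p = (v, 0)" by (metis surjD)
  \<comment> \<open>The factor \<open>\<theta>\<close> at \<open>Suc N\<close> is the weight of the
    fractional entry, so that pairing \<open>g\<close> with a solution gives exactly the form of
    \<open>L\<close>.\<close>
  define g where "g k = (if k \<le> N then sol p (Suc k) else if k = Suc N then \<theta> *\<^sub>R sol p (Suc k) else 0)" for k
  define y where "y = solve g (0, v)"
  have y: "is_sol g y" "y 0 = 0" "y (Suc 0) = v"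
    by (auto simp: y_def is_sol_solve)
  have wr: "wronskian y (sol q) (Suc (Suc N)) = 0" for q
  proof -
    have "wronskian y (sol q) (Suc (Suc N)) - wronskian y (sol q) 0 = (\<Sum>j<Suc (Suc N). g j \<bullet> sol q (Suc j))"
      using lagrange[OF y(1) is_sol_solve, of q "Suc (Suc N)"] by simp
    also have "\<dots> = W (\<lambda>k. sol p k \<bullet> sol q k)"
      by (simp add: W_def g_def lessThan_Suc_atMost)
    also have "\<dots> = v \<bullet> fst q"
      using L_inner[of p q] by (simp add: p inner_prod_def)
    finally show ?thesis
      by (simp add: wronskian_def y C_0)
  qed
  have y_zero: "y (Suc (Suc N)) = 0 \<and> y (Suc (Suc (Suc N))) = 0"
  proof -
    define M where "M = Suc (Suc N)"
    \<comment> \<open>With these values the vanishing Wronskian at \<open>M\<close> becomes a sum of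
      two squares, so both boundary values of \<open>y\<close> are zero; the recursion without
      source then keeps \<open>y\<close> at zero.\<close>
    obtain q where q: "sol q M = C M (y (Suc M))" "sol q (Suc M) = inv (C M) (- y M)"
      using sol_through by blast
    have "C M (y (Suc M)) \<bullet> C M (y (Suc M)) + y M \<bullet> y M = 0"
      using wr[of q] unfolding M_def[symmetric] wronskian_def q C_inv by simp
    then have "C M (y (Suc M)) = 0" "y M = 0"
      by (auto simp: add_nonneg_eq_0_iff)
    then show ?thesis
      using C_inv(2)[of M "y (Suc M)"] C_inv(2)[of M 0] linear_0[OF C_linear, of M] by (simp add: M_def)
  qed
  have y_zero: "y (Suc (Suc N) + k) = 0 \<and> y (Suc (Suc (Suc N) + k)) = 0" for k
  proof (induction k)
    case (Suc k)
    define M where "M = Suc (Suc N) + k"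
    have "C (Suc M) (y (Suc (Suc M))) = 0"
      using y(1)[unfolded is_sol_def, THEN spec[of _ M]] Suc
      by (simp add: M_def g_def linear_0 C_linear Cs_linear B_linear)
    then have "y (Suc (Suc M)) = 0"
      using C_inv(2)[of "Suc M"] linear_0[OF C_linear, of "Suc M"] by metis
    then show ?case using Suc by (simp add: M_def)
  qed (use y_zero in simp)
  have Lp: "L p \<bullet> p \<le> (norm v)\<^sup>2 / m"
  proof -
    have "L p \<bullet> p = v \<bullet> fst p" by (simp add: p inner_prod_def)
    also have "\<dots> \<le> norm v * norm p"
      using norm_fst_le[of "fst p" "snd p"]
      by (intro order_trans[OF norm_cauchy_schwarz] mult_left_mono) auto
    finally have vp: "L p \<bullet> p \<le> norm v * norm p" .
    then have "m * norm p * norm p \<le> norm v * norm p"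
      using L_pos[of p] by (simp add: power2_eq_square mult_ac)
    then have "m * norm p \<le> norm v"
      by (cases "norm p = 0") auto
    then have "norm p \<le> norm v / m"
      using m by (simp add: field_simps)
    then have "norm v * norm p \<le> norm v * (norm v / m)"
      by (intro mult_left_mono) auto
    then show ?thesis using vp by (simp add: power2_eq_square)
  qed
  have g_le: "(\<Sum>k\<le>Suc N. (norm (g k))\<^sup>2) \<le> (norm v)\<^sup>2 / m"
  proof -
    \<comment> \<open>The last entry of \<open>g\<close> contributes the factor
      \<open>\<theta>\<close> squared to its norm, but only \<open>\<theta>\<close> to
      \<open>W\<close>.\<close>
    have "\<theta>\<^sup>2 \<le> \<theta>" using \<theta> by (simp add: power2_eq_square mult_left_le)
    then have "(\<Sum>k\<le>Suc N. (norm (g k))\<^sup>2) \<le> W (\<lambda>k. (norm (sol p k))\<^sup>2)"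
      using \<theta> by (simp add: W_def g_def power_mult_distrib mult_right_mono)
    also have "\<dots> = L p \<bullet> p"
      by (simp add: L_inner power2_norm_eq_inner)
    finally show ?thesis using Lp by linarith
  qed
  \<comment> \<open>The solution with the starting values of \<open>y\<close>; the distance from it
    to \<open>y\<close> is a perturbation with source \<open>g\<close>.\<close>
  define q where "q = (0 :: 'v, v)"
  have "is_sol g (\<lambda>k. y k - sol q k)"
    using is_sol_diff[OF y(1) is_sol_solve, of "\<lambda>_. 0" q] by simp
  then have "W (\<lambda>k. (norm (y k - sol q k))\<^sup>2) \<le> T\<^sup>2 * (\<Sum>j\<le>N. (norm (g j))\<^sup>2)"
    using y by (intro W_perturbation_le) (auto simp: q_def)
  also have "\<dots> \<le> T\<^sup>2 * ((norm v)\<^sup>2 / m)"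
  proof (intro mult_left_mono)
    have "(\<Sum>j\<le>N. (norm (g j))\<^sup>2) \<le> (\<Sum>j\<le>Suc N. (norm (g j))\<^sup>2)" by simp
    then show "(\<Sum>j\<le>N. (norm (g j))\<^sup>2) \<le> (norm v)\<^sup>2 / m" using g_le by linarith
  qed auto
  finally have "W (\<lambda>k. (norm (y k))\<^sup>2) \<le> 2 * (T * (norm q)\<^sup>2) + 2 * (T\<^sup>2 * ((norm v)\<^sup>2 / m))"
    using W_add_le[of "sol q" "\<lambda>k. y k - sol q k"] W_sol_le[of q] by simp
  also have "\<dots> = 2 * T * (1 + T / m) * (norm v)\<^sup>2"
    by (simp add: q_def norm_prod_def power2_eq_square algebra_simps)
  finally have "W (\<lambda>k. (norm (y k))\<^sup>2) \<le> 2 * T * (1 + T / m) * (norm v)\<^sup>2" .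
  moreover have "(\<Sum>k\<le>N. (norm (y (Suc k)))\<^sup>2) \<le> W (\<lambda>k. (norm (y k))\<^sup>2)"
    using \<theta> by (simp add: W_def)
  ultimately have y_le: "(\<Sum>k\<le>N. (norm (y (Suc k)))\<^sup>2) \<le> 2 * T * (1 + T / m) * (norm v)\<^sup>2"
    by linarith
  have y_far: "y (Suc k) = 0" if "k > N" for k
    using y_zero[of "k - Suc N"] that by simp
  have g_far: "g k = 0" if "k > Suc N" for k
    using that by (simp add: g_def)
  show ?thesis
    by (rule that[OF y y_far g_far g_le y_le])
qed

end

end

section \<open>Block Jacobi operators and their solutions\<close>

lemma adj_inner: "(X *v x) \<bullet> y = x \<bullet> (adj X *v y)" for X :: "complex^'d^'d"
proof -
  have "cinner (X *v x) y = cinner x (adj X *v y)"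
    unfolding cinner_def matrix_vector_mult_def adj_def
    by (simp add: sum_distrib_left sum_distrib_right mult_ac) (rule sum.swap)
  then show ?thesis by (simp add: Re_cinner[symmetric])
qed

lemma matrix_vector_scaleR: "X *v (c *\<^sub>R x) = c *\<^sub>R (X *v x)" for X :: "complex^'d^'d"
  by (simp add: vec_eq_iff matrix_vector_mult_def scaleR_sum_right)

lemma matrix_vector_linear: "linear ((*v) X)" for X :: "complex^'d^'d"
  by (rule linearI) (simp_all add: matrix_vector_right_distrib matrix_vector_scaleR)

lemma adj_mult: "adj (X ** Y) = adj Y ** adj X"
  by (simp add: adj_def matrix_matrix_mult_def vec_eq_iff mult.commute)

lemma adj_mat: "adj (mat c) = mat (cnj c)"
  by (auto simp: adj_def mat_def vec_eq_iff)

lemma bij_matrix_vector: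
  assumes "invertible X"
  shows "bij ((*v) X)"
proof -
  obtain Y where Y: "X ** Y = mat 1" "Y ** X = mat 1"
    using assms by (auto simp: invertible_def)
  show ?thesis
    by (rule o_bij[of "(*v) Y"]) (auto simp: fun_eq_iff matrix_vector_mul_assoc Y)
qed

lemma invertible_adj: "invertible X \<Longrightarrow> invertible (adj X)"
proof -
  assume "invertible X"
  then obtain Y where Y: "X ** Y = mat 1" "Y ** X = mat 1"
    by (auto simp: invertible_def)
  have "adj X ** adj Y = mat 1" "adj Y ** adj X = mat 1"
    by (simp_all add: adj_mult[symmetric] Y adj_mat)
  then show ?thesis unfolding invertible_def by blast
qed

lemma finite_support_in_ell2: "(\<And>k. k > N \<Longrightarrow> u k = 0) \<Longrightarrow> u \<in> ell2"
  unfolding ell2_def by (auto intro!: summable_finite[of "{..N}"]) (metis not_le)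

lemma jacobi_expr_lincomb:
  "jacobi_expr A B (\<lambda>n. c *\<^sub>R u n + v n) = (\<lambda>n. c *\<^sub>R jacobi_expr A B u n + jacobi_expr A B v n)"
proof
  fix n show "jacobi_expr A B (\<lambda>n. c *\<^sub>R u n + v n) n = c *\<^sub>R jacobi_expr A B u n + jacobi_expr A B v n"
    by (cases n) (simp_all add: jacobi_expr_def matrix_vector_right_distrib matrix_vector_scaleR scaleR_add_right)
qed

locale block_jacobi =
  fixes A B :: "nat \<Rightarrow> complex^('d::finite)^'d"
    and E :: "real set \<Rightarrow> 'd vseq \<Rightarrow> 'd vseq"
  assumes det_A: "\<And>n. det (A n) \<noteq> 0"
    and hermitian_B: "\<And>n. hermitian (B n)"
    and sa: "selfadjoint (jacobi_op A B)"
    and spectral: "spectral_measure_of (jacobi_op A B) E"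
begin

definition P :: "real set \<Rightarrow> (complex^'d) sqsum \<Rightarrow> (complex^'d) sqsum" where
  "P = (\<lambda>\<omega> x. Abs_sqsum (E \<omega> (seq_of x)))"

definition Dm :: "(complex^'d) sqsum set" where
  "Dm = {x. seq_of x \<in> fst (jacobi_op A B)}"

definition S :: "(complex^'d) sqsum \<Rightarrow> (complex^'d) sqsum" where
  "S = (\<lambda>x. Abs_sqsum (snd (jacobi_op A B) (seq_of x)))"

lemma jacobi_sym:
  assumes "u \<in> fst (jacobi_op A B)" "v \<in> fst (jacobi_op A B)"
  shows "ell2_inner (snd (jacobi_op A B) u) v = ell2_inner u (snd (jacobi_op A B) v)"
proof -
  have "(v, snd (jacobi_op A B) v) \<in> op_graph (jacobi_op A B)"
    using assms by (auto simp: op_graph_def)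
  then have "(v, snd (jacobi_op A B) v) \<in> adjoint_graph (jacobi_op A B)"
    using sa by (simp add: selfadjoint_def)
  then show ?thesis using assms(1) by (auto simp: adjoint_graph_def)
qed

lemma ell2_lincomb: "u \<in> ell2 \<Longrightarrow> v \<in> ell2 \<Longrightarrow> (\<lambda>n. c *\<^sub>R u n + v n) \<in> ell2"
  for u v :: "'d vseq"
proof -
  assume "u \<in> ell2" "v \<in> ell2"
  then obtain x y where "u = seq_of x" "v = seq_of y" by (auto simp: ell2_iff)
  then have "(\<lambda>n. c *\<^sub>R u n + v n) = seq_of (c *\<^sub>R x + y)" by (simp add: seq_of_simps)
  then show ?thesis by simp
qed

lemma
  shows spectral_operator: "spectral_operator P Dm S"
    and seq_of_P: "\<omega> \<in> sets borel \<Longrightarrow> seq_of (P \<omega> x) = E \<omega> (seq_of x)"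
    and seq_of_S: "x \<in> Dm \<Longrightarrow> seq_of (S x) = jacobi_expr A B (seq_of x)"
    and scalar_measure_eq: "scalar_measure E (seq_of x) = spectral_mu P x"
proof -
  have range: "snd (jacobi_op A B) u \<in> ell2" if "u \<in> fst (jacobi_op A B)" for u
    using that by (simp add: jacobi_op_def)
  have lin: "(\<lambda>n. c *\<^sub>R u n + v n) \<in> fst (jacobi_op A B) \<and>
      snd (jacobi_op A B) (\<lambda>n. c *\<^sub>R u n + v n) = (\<lambda>n. c *\<^sub>R snd (jacobi_op A B) u n + snd (jacobi_op A B) v n)"
    if "u \<in> fst (jacobi_op A B)" "v \<in> fst (jacobi_op A B)" for u v c
    using that by (auto simp: jacobi_op_def jacobi_expr_lincomb intro: ell2_lincomb)
  have "jacobi_expr A B (\<lambda>_. 0) = (\<lambda>_. 0)"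
    using jacobi_expr_lincomb[of A B 0 "\<lambda>_. 0" "\<lambda>_. 0"]
    by (auto simp: fun_eq_iff jacobi_expr_def split: nat.split)
  then have zero: "(\<lambda>_. 0) \<in> fst (jacobi_op A B)"
    using finite_support_in_ell2[of 0 "\<lambda>_. 0 :: complex^'d"] by (simp add: jacobi_op_def)
  have dense: "densely_defined (jacobi_op A B)"
    using sa by (simp add: selfadjoint_def)
  note * = spectral_operator_of[OF spectral dense range jacobi_sym zero lin]
  show "spectral_operator P Dm S"
    unfolding P_def Dm_def S_def by (rule *(1))
  show "\<omega> \<in> sets borel \<Longrightarrow> seq_of (P \<omega> x) = E \<omega> (seq_of x)"
    unfolding P_def by (rule *(2))
  show "x \<in> Dm \<Longrightarrow> seq_of (S x) = jacobi_expr A B (seq_of x)"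
    using *(3)[of x] by (simp add: Dm_def S_def jacobi_op_def)
  show "scalar_measure E (seq_of x) = spectral_mu P x"
    unfolding P_def by (rule *(4))
qed

sublocale spectral_operator P Dm S
  by (rule spectral_operator)

lemma Dm_seq: "x \<in> Dm \<longleftrightarrow> jacobi_expr A B (seq_of x) \<in> ell2"
  by (simp add: Dm_def jacobi_op_def)

abbreviation "CC \<equiv> \<lambda>n. (*v) (prev_coeff A n)"
abbreviation "CCs \<equiv> \<lambda>n. (*v) (adj (prev_coeff A n))"
abbreviation "BB \<equiv> \<lambda>n. (*v) (B n)"

lemma invertible_prev_coeff: "invertible (prev_coeff A n)"
proof (cases n)
  case 0
  have "- mat 1 *v x = - x" for x :: "complex^'d"
    using matrix_vector_mult_diff_rdistrib[of 0 "mat 1" x] by simp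
  then have "- mat 1 ** - mat 1 = (mat 1 :: complex^'d^'d)"
    by (simp add: matrix_eq matrix_vector_mul_assoc[symmetric])
  then show ?thesis using 0 by (auto simp: prev_coeff_def invertible_def)
next
  case (Suc m)
  then show ?thesis using det_A by (simp add: prev_coeff_def invertible_det_nz)
qed

sublocale R: three_term_recursion CC CCs BB l for l :: real
proof (rule three_term_recursion.intro)
  fix n and x y :: "complex^'d"
  show "(prev_coeff A n *v x) \<bullet> y = x \<bullet> (adj (prev_coeff A n) *v y)"
    by (rule adj_inner)
  show "(B n *v x) \<bullet> y = x \<bullet> (B n *v y)"
    using adj_inner[of "B n" x y] hermitian_B[of n] by (simp add: hermitian_def)
  show "bij ((*v) (prev_coeff A n))" "surj ((*v) (adj (prev_coeff A n)))"
    by (simp_all add: bij_matrix_vector bij_is_surj invertible_adj invertible_prev_coeff)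
  show "prev_coeff A 0 *v x = - x"
    using matrix_vector_mult_diff_rdistrib[of 0 "mat 1" x] by (simp add: prev_coeff_def)
qed (rule matrix_vector_linear)+

text \<open>Since \<open>A\<close> at index \<open>-1\<close> is minus the identity, the entry at
  \<open>-1\<close> acts on the Jacobi expression as a source at position \<open>0\<close>.
  Sequences with entry zero at \<open>-1\<close> thus obey the plain Jacobi equation.\<close>

lemma is_sol_iff:
  "R.is_sol l g z \<longleftrightarrow>
    (\<forall>n. jacobi_expr A B (\<lambda>n. z (Suc n)) n = l *\<^sub>R z (Suc n) + g n + (if n = 0 then z 0 else 0))"
proof -
  have "adj (prev_coeff A n) *v z n + B n *v z (Suc n) + prev_coeff A (Suc n) *v z (Suc (Suc n))
      = jacobi_expr A B (\<lambda>n. z (Suc n)) n - (if n = 0 then z 0 else 0)" for n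
  proof (cases n)
    case 0
    have "adj (prev_coeff A 0) *v z 0 = - z 0"
    proof -
      have "adj (- mat 1) = (- mat 1 :: complex^'d^'d)"
        by (auto simp: adj_def mat_def vec_eq_iff)
      then show ?thesis
        using R.C_0[of "z 0"] by (simp add: prev_coeff_def)
    qed
    then show ?thesis using 0 by (simp add: jacobi_expr_def prev_coeff_def)
  next
    case (Suc m)
    then show ?thesis by (simp add: jacobi_expr_def prev_coeff_def)
  qed
  then show ?thesis
    unfolding R.is_sol_def by (simp only: diff_eq_eq)
qed

definition \<delta> :: "nat \<Rightarrow> complex^'d \<Rightarrow> (complex^'d) sqsum" where
  "\<delta> n v = Abs_sqsum (\<lambda>k. if k = n then v else 0)"

lemma seq_of_\<delta>: "seq_of (\<delta> n v) = (\<lambda>k. if k = n then v else 0)"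
  unfolding \<delta>_def by (rule seq_of_Abs) (rule finite_support_in_ell2[of n], simp)

lemma delta0_eq: "delta0 v = seq_of (\<delta> 0 v)"
  by (simp add: seq_of_\<delta> delta0_def)

lemma inner_\<delta>: "x \<bullet> \<delta> n v = seq_of x n \<bullet> v"
proof -
  have "(\<lambda>k. seq_of x k \<bullet> seq_of (\<delta> n v) k) sums (\<Sum>k\<in>{n}. seq_of x k \<bullet> seq_of (\<delta> n v) k)"
    by (rule sums_finite) (auto simp: seq_of_\<delta>)
  then show ?thesis
    using sums_inner_sqsum[of x "\<delta> n v"] by (simp add: sums_unique2 seq_of_\<delta>)
qed

lemma finite_support_in_Dm:
  assumes "\<And>k. k > N \<Longrightarrow> seq_of x k = 0"
  shows "x \<in> Dm"
  unfolding Dm_seq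
proof (rule finite_support_in_ell2)
  fix k assume "k > Suc N"
  then show "jacobi_expr A B (seq_of x) k = 0"
    using assms by (cases k) (auto simp: jacobi_expr_def)
qed

lemma \<delta>_in_Dm: "\<delta> n v \<in> Dm"
  by (rule finite_support_in_Dm[of n]) (simp add: seq_of_\<delta>)

lemma S_\<delta>: "S (\<delta> n v) = \<delta> (Suc n) (adj (A n) *v v) + \<delta> n (B n *v v)
    + (case n of 0 \<Rightarrow> 0 | Suc m \<Rightarrow> \<delta> m (A m *v v))"
proof -
  have "seq_of (S (\<delta> n v)) k = seq_of (\<delta> (Suc n) (adj (A n) *v v) + \<delta> n (B n *v v)
    + (case n of 0 \<Rightarrow> 0 | Suc m \<Rightarrow> \<delta> m (A m *v v))) k" for k
    unfolding seq_of_S[OF \<delta>_in_Dm]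
    by (cases n; cases k) (auto simp: jacobi_expr_def seq_of_\<delta> seq_of_simps)
  then show ?thesis by (simp add: seq_of_inject[symmetric] fun_eq_iff)
qed

text \<open>\<open>S\<close> sends \<open>\<delta> m w\<close> to
  \<open>\<delta> (Suc m) (adj (A m) *v w)\<close> plus terms at lower positions, and
  \<open>adj (A m)\<close> is surjective. As \<open>P \<omega>\<close> commutes with
  \<open>S\<close>, vanishing propagates from position \<open>0\<close> to all positions, and by
  density to all vectors.\<close>

lemma P_eq_zero_of_cyclic:
  assumes \<omega>: "\<omega> \<in> sets borel" and zero: "\<And>v. P \<omega> (\<delta> 0 v) = 0"
  shows "P \<omega> x = 0"
proof -
  have P_\<delta>: "P \<omega> (\<delta> n v) = 0" for n v
  proof (induction n arbitrary: v rule: less_induct)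
    case (less n)
    show ?case
    proof (cases n)
      case (Suc m)
      obtain w where w: "v = adj (A m) *v w"
        using R.Cs_surj[of "Suc m"] by (auto simp: prev_coeff_def surj_def)
      have "P \<omega> (S (\<delta> m w)) = 0"
        using T_P_commute[OF \<omega> \<delta>_in_Dm, of m w] less[of m w] Suc T_zero by simp
      moreover have "P \<omega> (case m of 0 \<Rightarrow> 0 | Suc i \<Rightarrow> \<delta> i (A i *v w)) = 0"
        using less Suc \<omega> by (cases m) (auto simp: P_zero)
      ultimately have "P \<omega> (\<delta> (Suc m) (adj (A m) *v w)) = 0"
        using less[of m "B m *v w"] Suc \<omega> by (simp add: S_\<delta> P_add)
      then show ?thesis using Suc w by simp
    qed (use zero in simp)
  qed
  have "bounded_linear (P \<omega>)"
    using norm_P_le[OF \<omega>] P_linear[OF \<omega>]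
    by (intro bounded_linear_intro[of _ 1]) (auto simp: linear_add linear_scale)
  then have "(\<lambda>N. P \<omega> (\<Sum>n<N. \<delta> n (seq_of x n))) \<longlonglongrightarrow> P \<omega> x"
    using sqsum_truncate[of x] unfolding \<delta>_def by (rule bounded_linear.tendsto)
  moreover have "P \<omega> (\<Sum>n<N. \<delta> n (seq_of x n)) = 0" for N
    by (simp add: linear_sum[OF P_linear[OF \<omega>]] P_\<delta>)
  ultimately show ?thesis by (simp add: LIMSEQ_const_iff)
qed

text \<open>If all solutions were square-summable, then those with starting values \<open>(v, 0)\<close> and
  \<open>(0, v)\<close> would violate the symmetry of the operator.\<close>

lemma \<tau>_sum_unbounded: "\<exists>N. (\<Sum>k\<le>N. (R.\<tau> l (Suc k))\<^sup>2) > c"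
proof (rule ccontr)
  assume "\<not> (\<exists>N. (\<Sum>k\<le>N. (R.\<tau> l (Suc k))\<^sup>2) > c)"
  then have le: "(\<Sum>k\<le>N. (R.\<tau> l (Suc k))\<^sup>2) \<le> c" for N by (simp add: not_less)
  have \<tau>: "summable (\<lambda>k. (R.\<tau> l (Suc k))\<^sup>2)"
  proof (rule summableI_nonneg_bounded)
    show "(\<Sum>k<N. (R.\<tau> l (Suc k))\<^sup>2) \<le> c" for N
      using le[of N] sum_mono2[of "{..N}" "{..<N}" "\<lambda>k. (R.\<tau> l (Suc k))\<^sup>2"] by fastforce
  qed auto
  have ell2: "(\<lambda>n. R.sol l p (Suc n)) \<in> ell2" for p
  proof -
    have "(norm (R.sol l p (Suc n)))\<^sup>2 \<le> (norm p)\<^sup>2 * (R.\<tau> l (Suc n))\<^sup>2" for n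
      using power_mono[OF R.norm_sol_le[of l p "Suc n"], of 2] by (simp add: power_mult_distrib)
    then show ?thesis
      unfolding ell2_def
      by (intro CollectI summable_comparison_test'[OF summable_mult[OF \<tau>, of "(norm p)\<^sup>2"], of 0]) simp
  qed
  define X where "X p = Abs_sqsum (\<lambda>n. R.sol l p (Suc n))" for p
  have seq_X: "seq_of (X p) = (\<lambda>n. R.sol l p (Suc n))" for p
    unfolding X_def by (rule seq_of_Abs[OF ell2])
  have J: "jacobi_expr A B (seq_of (X p)) = seq_of (l *\<^sub>R X p + \<delta> 0 (fst p))" for p
    using R.is_sol_solve[of l "\<lambda>_. 0" p, unfolded is_sol_iff]
    by (auto simp: seq_X seq_of_simps seq_of_\<delta> fun_eq_iff)
  have mem: "X p \<in> Dm" for p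
    unfolding Dm_seq J by simp
  have SX: "S (X p) = l *\<^sub>R X p + \<delta> 0 (fst p)" for p
    using seq_of_S[OF mem, of p] J[of p] by (simp add: seq_of_inject)
  define v :: "complex^'d" where "v = axis undefined 1"
  have "S (X (v, 0)) \<bullet> X (0, v) = X (v, 0) \<bullet> S (X (0, v))"
    by (rule T_sym[OF mem mem])
  then have "\<delta> 0 v \<bullet> X (0, v) = X (v, 0) \<bullet> \<delta> 0 0"
    by (simp add: SX inner_add_left inner_add_right)
  then have "v \<bullet> v = 0"
    by (simp add: inner_commute[of "\<delta> 0 v"] inner_\<delta> seq_X)
  then show False by (simp add: v_def axis_eq_0_iff)
qed

text \<open>For a projection the squared distance from \<open>x\<close> to its image is
  \<open>x \<bullet> x - P \<omega> x \<bullet> x\<close>, which tends to zero by continuity of the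
  measure from below.\<close>

lemma P_ball_tendsto:
  assumes "e > 0"
  shows "(\<lambda>J. P (ball l (4 ^ J * e)) x) \<longlonglongrightarrow> x"
proof -
  have "incseq (\<lambda>J. ball l (4 ^ J * e))"
    using assms by (intro incseq_SucI subset_ball) auto
  then have "(\<lambda>J. measure (\<mu> x) (ball l (4 ^ J * e))) \<longlonglongrightarrow> measure (\<mu> x) (\<Union>J. ball l (4 ^ J * e))"
    by (intro \<mu>.finite_Lim_measure_incseq) auto
  also have "(\<Union>J. ball l (4 ^ J * e)) = UNIV"
  proof (intro equalityI subset_UNIV subsetI)
    fix t
    obtain J where "dist l t / e < 4 ^ J"
      using real_arch_pow[of 4 "dist l t / e"] by auto
    then show "t \<in> (\<Union>J. ball l (4 ^ J * e))"
      using assms by (auto simp: field_simps)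
  qed
  finally have "(\<lambda>J. P (ball l (4 ^ J * e)) x \<bullet> x) \<longlonglongrightarrow> x \<bullet> x"
    by (simp add: measure_\<mu> P_UNIV)
  then have "(\<lambda>J. sqrt (x \<bullet> x - P (ball l (4 ^ J * e)) x \<bullet> x)) \<longlonglongrightarrow> sqrt (x \<bullet> x - x \<bullet> x)"
    by (intro tendsto_real_sqrt tendsto_diff tendsto_const)
  moreover have "sqrt (x \<bullet> x - P (ball l (4 ^ J * e)) x \<bullet> x) = norm (P (ball l (4 ^ J * e)) x - x)" for J
    using P_form[of "ball l (4 ^ J * e)" x]
    by (simp add: norm_eq_sqrt_inner inner_diff_left inner_diff_right inner_commute power2_norm_eq_inner)
  ultimately have "(\<lambda>J. norm (P (ball l (4 ^ J * e)) x - x)) \<longlonglongrightarrow> 0"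
    by (simp only: diff_self real_sqrt_zero)
  then show ?thesis
    by (simp only: tendsto_norm_zero_iff LIM_zero_iff)
qed

section \<open>The two spectral estimates at scale \<open>1 / T\<close>\<close>

text \<open>The radius \<open>1 / T\<close> makes the source \<open>(S - l) z\<close> so small that
  \<open>start_le\<close> applies with \<open>X\<close> the squared norm of \<open>z\<close>. As
  this squared norm equals \<open>seq_of z 0 \<bullet> v\<close>, the bound for the entry at
  \<open>0\<close> can be fed back and one factor cancelled.\<close>

lemma norm_P_ball_le:
  assumes \<theta>: "0 \<le> \<theta>" "\<theta> \<le> 1" and m: "m > 0"
    and T: "T = (\<Sum>k\<le>N. (R.\<tau> l (Suc k))\<^sup>2) + \<theta> * (R.\<tau> l (Suc (Suc N)))\<^sup>2" "T > 0"
    and W_ge: "\<And>p. m * (norm p)\<^sup>2 \<le>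
      (\<Sum>k\<le>N. (norm (R.sol l p (Suc k)))\<^sup>2) + \<theta> * (norm (R.sol l p (Suc (Suc N))))\<^sup>2"
  shows "(norm (P (cball l (1 / T)) (\<delta> 0 v)))\<^sup>2 \<le> 4 / m * (norm v)\<^sup>2"
proof -
  define z where "z = P (cball l (1 / T)) (\<delta> 0 v)"
  have meas: "cball l (1 / T) \<in> sets borel" by auto
  have Pz: "P (cball l (1 / T)) z = z"
    unfolding z_def by (rule P_idem[OF meas])
  have z: "z \<in> Dm"
    unfolding z_def by (rule P_bounded_in_Dm[OF meas bounded_cball])
  define g where "g n = seq_of (S z - l *\<^sub>R z) n" for n
  \<comment> \<open>The value \<open>0\<close> at \<open>-1\<close> ensures that
    \<open>is_sol_iff\<close> adds no source at position \<open>0\<close>.\<close>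
  define x where "x k = (case k of 0 \<Rightarrow> 0 | Suc n \<Rightarrow> seq_of z n)" for k
  have x: "R.is_sol l g x" "x 0 = 0"
    unfolding is_sol_iff using seq_of_S[OF z] by (auto simp: x_def g_def seq_of_simps)
  have "norm (S z - l *\<^sub>R z) \<le> 1 / T * norm z"
    using meas Pz \<open>T > 0\<close> by (intro norm_shift_le) auto
  then have "T * norm (S z - l *\<^sub>R z) \<le> norm z"
    using \<open>T > 0\<close> by (simp add: field_simps)
  then have Sz: "T\<^sup>2 * (norm (S z - l *\<^sub>R z))\<^sup>2 \<le> (norm z)\<^sup>2"
    using \<open>T > 0\<close> power_mono[of "T * norm (S z - l *\<^sub>R z)" "norm z" 2] by (simp add: power_mult_distrib)
  have "m * (norm (x (Suc 0)))\<^sup>2 \<le> 4 * (norm z)\<^sup>2"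
  proof (rule R.start_le[OF \<theta> m W_ge x])
    have "(\<Sum>k\<le>N. (norm (x (Suc k)))\<^sup>2) + \<theta> * (norm (x (Suc (Suc N))))\<^sup>2
        \<le> (\<Sum>k\<le>Suc N. (norm (seq_of z k))\<^sup>2)"
      using \<theta> by (simp add: x_def mult_left_le_one_le)
    also have "\<dots> \<le> (norm z)\<^sup>2"
      by (rule norm_seq_of_sum_le) simp
    finally show "(\<Sum>k\<le>N. (norm (x (Suc k)))\<^sup>2) + \<theta> * (norm (x (Suc (Suc N))))\<^sup>2 \<le> (norm z)\<^sup>2" .
    have "(\<Sum>j\<le>N. (norm (g j))\<^sup>2) \<le> (norm (S z - l *\<^sub>R z))\<^sup>2"
      unfolding g_def by (rule norm_seq_of_sum_le) simp
    then show "((\<Sum>k\<le>N. (R.\<tau> l (Suc k))\<^sup>2) + \<theta> * (R.\<tau> l (Suc (Suc N)))\<^sup>2)\<^sup>2 * (\<Sum>j\<le>N. (norm (g j))\<^sup>2) \<le> (norm z)\<^sup>2"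
      unfolding T(1)[symmetric] using Sz mult_left_mono[of _ _ "T\<^sup>2"] by (meson order_trans zero_le_power2)
  qed
  then have z0: "m * (norm (seq_of z 0))\<^sup>2 \<le> 4 * (norm z)\<^sup>2"
    by (simp add: x_def)
  have "(norm z)\<^sup>2 = seq_of z 0 \<bullet> v"
    using P_form[OF meas, of "\<delta> 0 v"] by (simp add: z_def inner_\<delta>)
  also have "\<dots> \<le> norm (seq_of z 0) * norm v"
    by (rule norm_cauchy_schwarz)
  finally have "((norm z)\<^sup>2)\<^sup>2 \<le> (norm (seq_of z 0))\<^sup>2 * (norm v)\<^sup>2"
    using power_mono[of "(norm z)\<^sup>2" "norm (seq_of z 0) * norm v" 2] by (simp add: power_mult_distrib)
  then have "m * ((norm z)\<^sup>2)\<^sup>2 \<le> m * ((norm (seq_of z 0))\<^sup>2 * (norm v)\<^sup>2)"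
    using m by simp
  also have "\<dots> \<le> 4 * (norm z)\<^sup>2 * (norm v)\<^sup>2"
    using mult_right_mono[OF z0, of "(norm v)\<^sup>2"] by (simp add: mult_ac)
  finally have "(norm z)\<^sup>2 * (m * (norm z)\<^sup>2) \<le> (norm z)\<^sup>2 * (4 * (norm v)\<^sup>2)"
    by (simp only: power2_eq_square[of "(norm z)\<^sup>2"] mult_ac)
  then have "m * (norm z)\<^sup>2 \<le> 4 * (norm v)\<^sup>2"
    by (cases "z = 0") simp_all
  then show ?thesis
    using m by (simp add: z_def field_simps)
qed

text \<open>The finitely supported \<open>Y\<close> satisfies
  \<open>\<delta> 0 v \<bullet> Y = (norm v)\<^sup>2\<close>, and both norms entering
  \<open>inner_P_ball_le\<close> are controlled by \<open>finite_solution\<close>. What remains is a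
  lower bound for the sum over the balls.\<close>

lemma sum_measure_ball_ge:
  assumes \<theta>: "0 \<le> \<theta>" "\<theta> \<le> 1" and m: "m > 0"
    and T: "T = (\<Sum>k\<le>N. (R.\<tau> l (Suc k))\<^sup>2) + \<theta> * (R.\<tau> l (Suc (Suc N)))\<^sup>2" "T > 0"
    and W_ge: "\<And>p. m * (norm p)\<^sup>2 \<le>
      (\<Sum>k\<le>N. (norm (R.sol l p (Suc k)))\<^sup>2) + \<theta> * (norm (R.sol l p (Suc (Suc N))))\<^sup>2"
    and v: "v \<noteq> 0"
  shows "\<exists>J. (norm v)\<^sup>2 / T \<le> (4 + 36 * (T / m)) *
    (\<Sum>j\<le>J. (1 / 16) ^ j * measure (\<mu> (\<delta> 0 v)) (ball l (4 ^ j * (1 / T))))"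
proof -
  obtain y g where y: "R.is_sol l g y" "y 0 = 0" "y (Suc 0) = v"
    and far: "\<And>k. k > N \<Longrightarrow> y (Suc k) = 0" "\<And>k. k > Suc N \<Longrightarrow> g k = 0"
    and g_le: "(\<Sum>k\<le>Suc N. (norm (g k))\<^sup>2) \<le> (norm v)\<^sup>2 / m"
    and y_le: "(\<Sum>k\<le>N. (norm (y (Suc k)))\<^sup>2) \<le> 2 * T * (1 + T / m) * (norm v)\<^sup>2"
    by (rule R.finite_solution[OF \<theta> m W_ge, where v = v, folded T(1)]) (rule that)
  define Y where "Y = Abs_sqsum (\<lambda>n. y (Suc n))"
  have seq_Y: "seq_of Y = (\<lambda>n. y (Suc n))"
    unfolding Y_def by (rule seq_of_Abs) (rule finite_support_in_ell2[of N], simp add: far)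
  have Y: "Y \<in> Dm"
    by (rule finite_support_in_Dm[of N]) (simp add: seq_Y far)
  have seq_SY: "seq_of (S Y - l *\<^sub>R Y) = g"
    using y(1,2)[unfolded is_sol_iff] by (auto simp: seq_of_simps seq_of_S[OF Y] seq_Y fun_eq_iff)
  have norm_finite: "(norm x)\<^sup>2 = (\<Sum>k\<le>K. (norm (seq_of x k))\<^sup>2)" if "\<And>k. k > K \<Longrightarrow> seq_of x k = 0"
    for K and x :: "(complex^'d) sqsum"
  proof -
    have "(\<lambda>k. (norm (seq_of x k))\<^sup>2) sums (\<Sum>k\<le>K. (norm (seq_of x k))\<^sup>2)"
      using that by (intro sums_finite) (auto simp: not_le)
    then show ?thesis using sums_norm_sqsum sums_unique2 by blast
  qed
  have norm_Y: "(norm Y)\<^sup>2 \<le> 2 * T * (1 + T / m) * (norm v)\<^sup>2"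
    using norm_finite[of N Y] y_le far by (simp add: seq_Y)
  have norm_g: "(norm (S Y - l *\<^sub>R Y))\<^sup>2 \<le> (norm v)\<^sup>2 / m"
    using norm_finite[of "Suc N" "S Y - l *\<^sub>R Y"] g_le far unfolding seq_SY by simp
  have "\<delta> 0 v \<bullet> Y = (norm v)\<^sup>2"
    by (simp add: inner_commute[of _ Y] inner_\<delta> seq_Y y power2_norm_eq_inner)
  moreover have "(\<lambda>J. (P (ball l (4 ^ J * (1 / T))) (\<delta> 0 v) \<bullet> Y)\<^sup>2) \<longlonglongrightarrow> (\<delta> 0 v \<bullet> Y)\<^sup>2"
    using \<open>T > 0\<close> by (intro tendsto_intros P_ball_tendsto) simp
  ultimately have "(\<lambda>J. (P (ball l (4 ^ J * (1 / T))) (\<delta> 0 v) \<bullet> Y)\<^sup>2) \<longlonglongrightarrow> ((norm v)\<^sup>2)\<^sup>2"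
    by simp
  \<comment> \<open>Giving away a factor 2 allows a finite \<open>J\<close>, since the balls exhaust
    the line.\<close>
  moreover have "((norm v)\<^sup>2)\<^sup>2 / 2 < ((norm v)\<^sup>2)\<^sup>2"
    using v by simp
  ultimately have "eventually (\<lambda>J. ((norm v)\<^sup>2)\<^sup>2 / 2 < (P (ball l (4 ^ J * (1 / T))) (\<delta> 0 v) \<bullet> Y)\<^sup>2) sequentially"
    by (rule order_tendstoD)
  then obtain J where J: "((norm v)\<^sup>2)\<^sup>2 / 2 < (P (ball l (4 ^ J * (1 / T))) (\<delta> 0 v) \<bullet> Y)\<^sup>2"
    by (auto simp: eventually_sequentially)
  define Q where "Q = (\<Sum>j\<le>J. (1 / 16) ^ j * measure (\<mu> (\<delta> 0 v)) (ball l (4 ^ j * (1 / T))))"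
  have "Q \<ge> 0" by (simp add: Q_def sum_nonneg)
  have "(P (ball l (4 ^ J * (1 / T))) (\<delta> 0 v) \<bullet> Y)\<^sup>2
      \<le> Q * ((norm Y)\<^sup>2 + 16 / (1 / T)\<^sup>2 * (norm (S Y - l *\<^sub>R Y))\<^sup>2)"
    unfolding Q_def using Y \<open>T > 0\<close> by (intro inner_P_ball_le) auto
  also have "\<dots> \<le> Q * (2 * T * (1 + T / m) * (norm v)\<^sup>2 + 16 / (1 / T)\<^sup>2 * ((norm v)\<^sup>2 / m))"
    using \<open>Q \<ge> 0\<close> by (intro mult_left_mono add_mono norm_Y norm_g) auto
  \<comment> \<open>With \<open>e = 1 / T\<close> the second term is
    \<open>16 * T * (T / m)\<close>, to be added to \<open>2 * T + 2 * T * (T / m)\<close>. Doubling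
    the result yields \<open>4 + 36 * (T / m)\<close>.\<close>
  also have "\<dots> = Q * T * (2 + 18 * (T / m)) * (norm v)\<^sup>2"
    using m by (simp add: power_divide power2_eq_square[of T] field_simps)
  finally have "((norm v)\<^sup>2)\<^sup>2 / 2 \<le> Q * T * (2 + 18 * (T / m)) * (norm v)\<^sup>2"
    using J by linarith
  then have "(norm v)\<^sup>2 * (norm v)\<^sup>2 \<le> (Q * T * (4 + 36 * (T / m))) * (norm v)\<^sup>2"
    by (simp add: power2_eq_square[of "(norm v)\<^sup>2"] algebra_simps)
  then have "(norm v)\<^sup>2 \<le> Q * T * (4 + 36 * (T / m))"
    by (rule mult_right_le_imp_le) (use v in simp)
  then have "(norm v)\<^sup>2 / T \<le> (4 + 36 * (T / m)) * Q"
    using \<open>T > 0\<close> by (simp add: pos_divide_le_eq mult_ac)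
  then show ?thesis unfolding Q_def by blast
qed

end

section \<open>The barrier\<close>

lemma mat_opnorm_single_column:
  "mat_opnorm (\<chi> i j. if j = k then v $ i else 0 :: complex^'d^('d::finite)) = norm (v :: complex^'d)"
proof -
  have mult: "(\<chi> i j. if j = k then v $ i else 0) *v x = (x $ k) *s v" for x :: "complex^'d"
    by (simp add: vec_eq_iff matrix_vector_mult_def if_distrib if_distribR mult.commute cong: if_cong)
  have le: "norm ((x $ k) *s v) \<le> norm v * norm x" for x :: "complex^'d"
    using mult_right_mono[OF Finite_Cartesian_Product.norm_nth_le[of x k], of "norm v"] by (simp add: norm_smult mult.commute)
  show ?thesis
    unfolding mat_opnorm_def mult
  proof (rule antisym)
    show "onorm (\<lambda>x. (x $ k) *s v) \<le> norm v"
      by (rule onorm_bound) (use le in auto)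
    have lin: "bounded_linear (\<lambda>x :: complex^'d. (x $ k) *s v)"
      by (rule bounded_linear_intro[where K = "norm v"])
        (use le in \<open>auto simp: vec_eq_iff algebra_simps mult.commute\<close>)
    show "norm v \<le> onorm (\<lambda>x. (x $ k) *s v)"
      using onorm[OF lin, of "axis k 1"] by (simp add: norm_axis_1)
  qed
qed

lemma mat_vector_mult: "mat c *v x = c *s x" for x :: "complex^'d"
  by (simp add: vec_eq_iff matrix_vector_mult_def mat_def if_distrib if_distribR cong: if_cong)

context block_jacobi
begin

abbreviation weighted :: "real \<Rightarrow> (nat \<Rightarrow> complex^'d) \<Rightarrow> real" where
  "weighted t x \<equiv> (\<Sum>k\<le>nat \<lfloor>t\<rfloor>. (norm (x (Suc k)))\<^sup>2) + frac t * (norm (x (Suc (Suc (nat \<lfloor>t\<rfloor>)))))\<^sup>2"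

text \<open>For \<open>t \<ge> 1\<close> the sum contains the entries at positions \<open>0\<close>
  and \<open>1\<close>. If both vanish, the recursion at position \<open>0\<close> also kills the
  entry at \<open>-1\<close>, hence the whole solution.\<close>

lemma weighted_sol_pos:
  assumes "t \<ge> 1" "norm q = 1"
  shows "weighted t (R.sol l q) > 0"
proof (rule ccontr)
  assume "\<not> weighted t (R.sol l q) > 0"
  moreover have "frac t * (norm (R.sol l q (Suc (Suc (nat \<lfloor>t\<rfloor>)))))\<^sup>2 \<ge> 0"
    by (simp add: frac_ge_0)
  moreover have "(\<Sum>k\<le>nat \<lfloor>t\<rfloor>. (norm (R.sol l q (Suc k)))\<^sup>2) \<ge> (\<Sum>k\<le>1. (norm (R.sol l q (Suc k)))\<^sup>2)"
    using assms(1) by (intro sum_mono2) (auto simp: le_nat_iff)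
  ultimately have "(\<Sum>k\<le>1. (norm (R.sol l q (Suc k)))\<^sup>2) \<le> 0" by linarith
  then have "(norm (R.sol l q (Suc 0)))\<^sup>2 + (norm (R.sol l q (Suc (Suc 0))))\<^sup>2 \<le> 0" by simp
  then have z: "R.sol l q (Suc 0) = 0" "R.sol l q (Suc (Suc 0)) = 0"
    by (auto simp: sum_power2_le_zero_iff)
  then have "CCs 0 (R.sol l q 0) = 0"
    using R.is_sol_solve[of l "\<lambda>_. 0" q, unfolded R.is_sol_def, THEN spec[of _ 0]] by simp
  then have "R.sol l q 0 \<bullet> R.sol l q 0 = 0"
    using R.C_adj[of 0 "R.sol l q 0" "R.sol l q 0"] by (simp only: R.C_0) simp
  then have "q = 0" using z(1) by (simp add: prod_eq_iff)
  then show False using assms(2) by simp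
qed

text \<open>Vector solutions are tested against the barrier as the single nonzero column of a matrix
  solution.\<close>

lemma barrier_weighted:
  assumes barrier: "barrier A B G b" and "l \<in> G" "t \<ge> 1" "norm p = 1" "norm q = 1"
  shows "weighted t (R.sol l p) \<le> b l t * weighted t (R.sol l q)"
proof -
  \<comment> \<open>The column index \<open>undefined\<close> is an arbitrary fixed one, and
    \<open>nat (i + 1)\<close> undoes the shift by one of the vector solutions.\<close>
  define U :: "(complex^'d) \<times> (complex^'d) \<Rightarrow> int \<Rightarrow> complex^'d^'d"
    where "U p i = (\<chi> i' j. if j = undefined then R.sol l p (nat (i + 1)) $ i' else 0)" for p i
  have U_norm: "mat_opnorm (U p i) = norm (R.sol l p (nat (i + 1)))" for p i
    unfolding U_def by (rule mat_opnorm_single_column)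
  have mult: "X ** U p i = (\<chi> i' j. if j = undefined then (X *v R.sol l p (nat (i + 1))) $ i' else 0)"
    for X :: "complex^'d^'d" and p i
    by (auto simp: U_def vec_eq_iff matrix_matrix_mult_def matrix_vector_mult_def)
  have emgev: "emgev A B (complex_of_real l) (U p)" for p
    unfolding emgev_def
  proof
    fix n
    have "adj (prev_coeff A n) *v R.sol l p n + B n *v R.sol l p (Suc n) + A n *v R.sol l p (Suc (Suc n))
        = l *\<^sub>R R.sol l p (Suc n)"
    proof -
      have "prev_coeff A (Suc n) = A n" by (simp add: prev_coeff_def)
      then show ?thesis
        using R.is_sol_solve[of l "\<lambda>_. 0" p, unfolded R.is_sol_def, THEN spec[of _ n]] by simp
    qed
    also have "\<dots> = mat (complex_of_real l) *v R.sol l p (Suc n)"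
      by (simp add: mat_vector_mult of_real_smult)
    finally have "(adj (prev_coeff A n) *v R.sol l p n) $ i + (B n *v R.sol l p (Suc n)) $ i
        + (A n *v R.sol l p (Suc (Suc n))) $ i = (mat (complex_of_real l) *v R.sol l p (Suc n)) $ i" for i
      by (metis vector_add_component)
    moreover have "nat (int n - 1 + 1) = n" "nat (int n + 1) = Suc n" "nat (int n + 1 + 1) = Suc (Suc n)"
      by auto
    ultimately show "adj (prev_coeff A n) ** U p (int n - 1) + B n ** U p (int n) + A n ** U p (int n + 1)
        = mat (complex_of_real l) ** U p (int n)"
      unfolding mult by (simp add: vec_eq_iff)
  qed
  have start: "normalized_start (U p)" if "norm p = 1" for p
    using that by (simp add: normalized_start_def U_norm norm_prod_def)
  have trunc: "(trunc_norm (U p) t)\<^sup>2 = weighted t (R.sol l p)" for p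
  proof -
    have "\<lfloor>t\<rfloor> \<ge> 0" using \<open>t \<ge> 1\<close> by simp
    have "(\<Sum>k\<in>{0..\<lfloor>t\<rfloor>}. (mat_opnorm (U p k))\<^sup>2) = (\<Sum>k\<le>nat \<lfloor>t\<rfloor>. (norm (R.sol l p (Suc k)))\<^sup>2)"
      using \<open>\<lfloor>t\<rfloor> \<ge> 0\<close>
      by (intro sum.reindex_bij_witness[of _ int nat]) (auto simp: U_norm nat_add_distrib le_nat_iff)
    moreover have "nat (\<lfloor>t\<rfloor> + 1 + 1) = Suc (Suc (nat \<lfloor>t\<rfloor>))"
      using \<open>\<lfloor>t\<rfloor> \<ge> 0\<close> by arith
    ultimately show ?thesis
      by (simp add: trunc_norm_def U_norm frac_ge_0 sum_nonneg)
  qed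
  have "(trunc_norm (U p) t / trunc_norm (U q) t)\<^sup>2 \<le> b l t"
    using barrier assms(2-5) emgev start unfolding barrier_def by blast
  then have "weighted t (R.sol l p) / weighted t (R.sol l q) \<le> b l t"
    by (simp only: power_divide trunc)
  then show ?thesis
    using weighted_sol_pos[OF \<open>t \<ge> 1\<close> \<open>norm q = 1\<close>, of l] by (simp add: pos_divide_le_eq)
qed

text \<open>The real dimension of the space of starting values, that is, \<open>4 * d\<close> for
  matrices of size \<open>d\<close>; it counts the summands of \<open>T\<close>.\<close>

definition dim :: real where
  "dim = real DIM((complex^'d) \<times> (complex^'d))"

lemma dim_pos: "dim > 0"
  by (simp add: dim_def)

text \<open>The scale \<open>e\<close> will be \<open>1 / T\<close>, and the weights \<open>16\<^sup>-\<^sup>j\<close> at distance \<open>4\<^sup>j e\<close> are those of the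
  Poisson kernel.\<close>

definition two_sided :: "real \<Rightarrow> real \<Rightarrow> bool" where
  "two_sided K l \<longleftrightarrow> (\<forall>d>0. \<exists>e>0. e < d \<and>
    (\<forall>v. measure (\<mu> (\<delta> 0 v)) (cball l e) \<le> K * (norm v)\<^sup>2 * e) \<and>
    (\<forall>v. v \<noteq> 0 \<longrightarrow> (\<exists>J. e * (norm v)\<^sup>2 / K \<le>
       (\<Sum>j\<le>J. (1 / 16) ^ j * measure (\<mu> (\<delta> 0 v)) (ball l (4 ^ j * e))))))"

text \<open>\<open>T\<close> is a sum of \<open>dim\<close> weighted norms of normalized solutions,
  each at most \<open>\<beta>\<close> times that of any other normalized solution. Hence
  \<open>T / m\<close> can be kept equal to \<open>dim * \<beta>\<close> for every admissible
  \<open>t\<close>, while \<open>T\<close> exceeds \<open>1 / d\<close> once \<open>t\<close> is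
  large.\<close>

lemma two_sided_of_barrier:
  assumes barrier: "barrier A B G b" and l: "l \<in> G" and \<beta>: "\<beta> > 0"
    and freq: "frequently (\<lambda>t. b l t \<le> \<beta>) at_top"
  shows "two_sided (4 + 36 * (dim * \<beta>)) l"
  unfolding two_sided_def
proof (intro allI impI)
  fix d :: real assume "d > 0"
  obtain N0 where N0: "(\<Sum>k\<le>N0. (R.\<tau> l (Suc k))\<^sup>2) > 1 / d"
    using \<tau>_sum_unbounded by blast
  have "\<forall>c. \<exists>t\<ge>c. b l t \<le> \<beta>"
    using freq by (auto simp: frequently_def eventually_at_top_linorder)
  then obtain t where t: "t \<ge> max 1 (real N0)" "b l t \<le> \<beta>" by blast
  then have "t \<ge> 1" by simp
  define T where "T = (\<Sum>k\<le>nat \<lfloor>t\<rfloor>. (R.\<tau> l (Suc k))\<^sup>2) + frac t * (R.\<tau> l (Suc (Suc (nat \<lfloor>t\<rfloor>))))\<^sup>2"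
  have "N0 \<le> nat \<lfloor>t\<rfloor>" using t by (simp add: le_nat_floor)
  then have "(\<Sum>k\<le>N0. (R.\<tau> l (Suc k))\<^sup>2) \<le> (\<Sum>k\<le>nat \<lfloor>t\<rfloor>. (R.\<tau> l (Suc k))\<^sup>2)"
    by (intro sum_mono2) auto
  moreover have "frac t * (R.\<tau> l (Suc (Suc (nat \<lfloor>t\<rfloor>))))\<^sup>2 \<ge> 0"
    by (simp add: frac_ge_0)
  ultimately have T: "T > 1 / d" unfolding T_def using N0 by linarith
  moreover have "1 / d > 0" using \<open>d > 0\<close> by simp
  ultimately have "T > 0" by linarith
  have "1 / T < d" using T \<open>T > 0\<close> \<open>d > 0\<close> by (simp add: field_simps)
  define m where "m = T / (dim * \<beta>)"
  have "m > 0" using \<open>T > 0\<close> \<beta> dim_pos by (simp add: m_def)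
  have T_m: "T / m = dim * \<beta>"
    using \<open>T > 0\<close> \<beta> dim_pos by (simp add: m_def)
  have T_le: "T \<le> dim * (\<beta> * weighted t (R.sol l q))" if q: "norm q = 1" for q
  proof -
    have "T = (\<Sum>e\<in>Basis. weighted t (R.sol l e))"
      unfolding T_def R.\<tau>_sq sum.distrib sum_distrib_left by (simp add: sum.swap[of _ Basis])
    also have "\<dots> \<le> (\<Sum>e\<in>(Basis :: ((complex^'d) \<times> (complex^'d)) set). \<beta> * weighted t (R.sol l q))"
    proof (intro sum_mono)
      fix e :: "(complex^'d) \<times> (complex^'d)" assume "e \<in> Basis"
      then have "weighted t (R.sol l e) \<le> b l t * weighted t (R.sol l q)"
        using barrier l \<open>t \<ge> 1\<close> q by (intro barrier_weighted) auto
      also have "\<dots> \<le> \<beta> * weighted t (R.sol l q)"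
        using t(2) weighted_sol_pos[OF \<open>t \<ge> 1\<close> q, of l] by (intro mult_right_mono) auto
      finally show "weighted t (R.sol l e) \<le> \<beta> * weighted t (R.sol l q)" .
    qed
    finally show ?thesis by (simp only: sum_constant dim_def)
  qed
  have W_ge: "m * (norm p)\<^sup>2 \<le> weighted t (R.sol l p)" for p
  proof (cases "p = 0")
    case False
    define q where "q = p /\<^sub>R norm p"
    have q: "norm q = 1" "p = norm p *\<^sub>R q" using False by (auto simp: q_def)
    have "R.sol l p k = norm p *\<^sub>R R.sol l q k" for k
      using linear_scale[OF R.sol_linear[of l k], of "norm p" q] unfolding q(2)[symmetric] .
    then have "weighted t (R.sol l p) = (norm p)\<^sup>2 * weighted t (R.sol l q)"
      by (simp add: power_mult_distrib sum_distrib_left algebra_simps)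
    moreover have "m \<le> weighted t (R.sol l q)"
      using T_le[OF q(1)] \<beta> dim_pos by (simp add: m_def pos_divide_le_eq mult_ac)
    ultimately show ?thesis
      by (metis mult.commute mult_left_mono zero_le_power2)
  qed (simp add: frac_ge_0 sum_nonneg)
  have \<theta>: "0 \<le> frac t" "frac t \<le> 1"
    using frac_lt_1[of t] by (auto simp: frac_ge_0)
  define K where "K = 4 + 36 * (dim * \<beta>)"
  have "K > 0" using \<beta> dim_pos by (simp add: K_def add_pos_pos)
  show "\<exists>e>0. e < d \<and>
    (\<forall>v. measure (\<mu> (\<delta> 0 v)) (cball l e) \<le> (4 + 36 * (dim * \<beta>)) * (norm v)\<^sup>2 * e) \<and>
    (\<forall>v. v \<noteq> 0 \<longrightarrow> (\<exists>J. e * (norm v)\<^sup>2 / (4 + 36 * (dim * \<beta>)) \<le>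
       (\<Sum>j\<le>J. (1 / 16) ^ j * measure (\<mu> (\<delta> 0 v)) (ball l (4 ^ j * e)))))"
    unfolding K_def[symmetric]
  proof (intro exI[of _ "1 / T"] conjI allI impI)
    fix v :: "complex^'d"
    have "measure (\<mu> (\<delta> 0 v)) (cball l (1 / T)) = (norm (P (cball l (1 / T)) (\<delta> 0 v)))\<^sup>2"
      by (simp add: measure_\<mu> P_form)
    also have "\<dots> \<le> 4 / m * (norm v)\<^sup>2"
      by (rule norm_P_ball_le[OF \<theta> \<open>m > 0\<close> T_def \<open>T > 0\<close> W_ge])
    also have "4 / m = 4 * (T / m) * (1 / T)"
      using \<open>T > 0\<close> by simp
    \<comment> \<open>The constant \<open>K\<close> stems from the lower estimate; it also dominates
      the constant \<open>4 * (T / m)\<close> of the upper one.\<close>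
    also have "4 * (T / m) * (1 / T) * (norm v)\<^sup>2 \<le> K * (norm v)\<^sup>2 * (1 / T)"
      using \<open>T > 0\<close> \<beta> dim_pos unfolding T_m K_def
      by (simp add: divide_right_mono mult_right_mono)
    finally show "measure (\<mu> (\<delta> 0 v)) (cball l (1 / T)) \<le> K * (norm v)\<^sup>2 * (1 / T)" .
    assume "v \<noteq> 0"
    then obtain J where "(norm v)\<^sup>2 / T \<le> K * (\<Sum>j\<le>J. (1 / 16) ^ j * measure (\<mu> (\<delta> 0 v)) (ball l (4 ^ j * (1 / T))))"
      using sum_measure_ball_ge[OF \<theta> \<open>m > 0\<close> T_def \<open>T > 0\<close> W_ge, of v] unfolding T_m K_def by blast
    then have "(norm v)\<^sup>2 / T / K \<le> (\<Sum>j\<le>J. (1 / 16) ^ j * measure (\<mu> (\<delta> 0 v)) (ball l (4 ^ j * (1 / T))))"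
      unfolding pos_divide_le_eq[OF \<open>K > 0\<close>] by (simp only: mult.commute)
    moreover have "1 / T * (norm v)\<^sup>2 / K = (norm v)\<^sup>2 / T / K" by simp
    ultimately have "1 / T * (norm v)\<^sup>2 / K \<le> (\<Sum>j\<le>J. (1 / 16) ^ j * measure (\<mu> (\<delta> 0 v)) (ball l (4 ^ j * (1 / T))))"
      by (simp only:)
    then show "\<exists>J. 1 / T * (norm v)\<^sup>2 / K \<le> (\<Sum>j\<le>J. (1 / 16) ^ j * measure (\<mu> (\<delta> 0 v)) (ball l (4 ^ j * (1 / T))))"
      by blast
  qed (use \<open>T > 0\<close> \<open>1 / T < d\<close> in auto)
qed

end

lemma frequently_le_of_Liminf_less:
  fixes f :: "real \<Rightarrow> real"
  assumes "Liminf at_top (\<lambda>t. ereal (f t)) < ereal c"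
  shows "frequently (\<lambda>t. f t \<le> c) at_top"
proof (rule ccontr)
  assume "\<not> frequently (\<lambda>t. f t \<le> c) at_top"
  then have "eventually (\<lambda>t. ereal c \<le> ereal (f t)) at_top"
    by (auto simp: not_frequently elim!: eventually_mono)
  then have "ereal c \<le> Liminf at_top (\<lambda>t. ereal (f t))"
    by (rule Liminf_bounded)
  then show False using assms by simp
qed

section \<open>Densities\<close>

text \<open>Stated for Banach-valued set functions, so that densities of matrices and of scalar
  measures are exchanged through bounded linear maps.\<close>

definition has_density :: "(real set \<Rightarrow> 'b::{banach, second_countable_topology}) \<Rightarrow> real set \<Rightarrow> (real \<Rightarrow> 'b) \<Rightarrow> bool" where
  "has_density F G f \<longleftrightarrow> set_borel_measurable lborel G f \<and>
     (\<forall>\<omega>\<in>sets borel. \<omega> \<subseteq> G \<longrightarrow>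
        set_integrable lborel \<omega> f \<and> F \<omega> = set_lebesgue_integral lborel \<omega> f)"

lemma has_density_cong:
  assumes "\<And>\<omega>. \<omega> \<in> sets borel \<Longrightarrow> \<omega> \<subseteq> G \<Longrightarrow> F \<omega> = F' \<omega>" "has_density F G f"
  shows "has_density F' G f"
  using assms by (simp add: has_density_def)

lemma has_density_bounded_linear:
  assumes h: "bounded_linear h" and f: "has_density F G f"
  shows "has_density (\<lambda>\<omega>. h (F \<omega>)) G (\<lambda>x. h (f x))"
proof -
  have eq: "indicator \<omega> x *\<^sub>R h (f x) = h (indicator \<omega> x *\<^sub>R f x)" for \<omega> and x :: real
    using linear_scale[OF bounded_linear.linear[OF h]] by simp
  show ?thesis
    using f unfolding has_density_def set_borel_measurable_def set_integrable_def set_lebesgue_integral_def eq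
    by (auto intro: integrable_bounded_linear[OF h] integral_bounded_linear[OF h, symmetric]
        measurable_compose[OF _ borel_measurable_continuous_onI[OF linear_continuous_on[OF h]]])
qed

lemma has_density_subset:
  assumes f: "has_density F G f" and "G' \<in> sets borel" "G' \<subseteq> G"
  shows "has_density F G' f"
proof -
  have eq: "indicator G' x *\<^sub>R f x = indicator G' x *\<^sub>R (indicator G x *\<^sub>R f x)" for x
    using \<open>G' \<subseteq> G\<close> by (auto simp: indicator_def)
  have "(\<lambda>x. indicator G x *\<^sub>R f x) \<in> borel_measurable lborel"
    using f by (simp add: has_density_def set_borel_measurable_def)
  moreover have "indicator G' \<in> borel_measurable (lborel :: real measure)"
    using \<open>G' \<in> sets borel\<close> by simp
  ultimately have "set_borel_measurable lborel G' f"
    unfolding set_borel_measurable_def eq by (rule borel_measurable_scaleR[rotated])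
  moreover have "set_integrable lborel \<omega> f \<and> F \<omega> = set_lebesgue_integral lborel \<omega> f"
    if "\<omega> \<in> sets borel" "\<omega> \<subseteq> G'" for \<omega>
    using f that \<open>G' \<subseteq> G\<close> unfolding has_density_def by (meson subset_trans)
  ultimately show ?thesis unfolding has_density_def by blast
qed

lemma has_density_zero: "has_density (\<lambda>_. 0) G (\<lambda>_. 0)"
  by (simp add: has_density_def set_borel_measurable_def set_integrable_def set_lebesgue_integral_def)

lemma has_density_add:
  assumes "has_density F G f" "has_density F' G f'"
  shows "has_density (\<lambda>\<omega>. F \<omega> + F' \<omega>) G (\<lambda>x. f x + f' x)"
  using assms
  by (auto simp: has_density_def set_borel_measurable_def scaleR_add_right intro!: set_integral_add)

lemma has_density_sum:
  assumes "\<And>i. i \<in> I \<Longrightarrow> has_density (F i) G (f i)"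
  shows "has_density (\<lambda>\<omega>. \<Sum>i\<in>I. F i \<omega>) G (\<lambda>x. \<Sum>i\<in>I. f i x)"
  using assms
  by (induction I rule: infinite_finite_induct) (auto intro: has_density_zero has_density_add)

text \<open>Testing on the bounded parts of the set where \<open>f\<close> exceeds \<open>c\<close>:
  there the nonnegative function \<open>f - c\<close> has integral at most zero.\<close>

lemma AE_density_le:
  fixes f :: "real \<Rightarrow> real"
  assumes f: "has_density F G f" and G: "G \<in> sets borel"
    and le: "\<And>\<omega>. \<omega> \<in> sets borel \<Longrightarrow> \<omega> \<subseteq> G \<Longrightarrow> emeasure lborel \<omega> < \<infinity> \<Longrightarrow> F \<omega> \<le> c * measure lborel \<omega>"
  shows "AE x in lborel. x \<in> G \<longrightarrow> f x \<le> c"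
proof -
  have "AE x in lborel. x \<notin> {x \<in> G. f x > c} \<inter> cball 0 (real n)" for n
  proof -
    define \<omega> where "\<omega> = {x \<in> G. f x > c} \<inter> cball 0 (real n)"
    have "(\<lambda>x. indicator G x *\<^sub>R f x) \<in> borel_measurable borel"
      using f by (simp add: has_density_def set_borel_measurable_def)
    then have "{x \<in> space borel. indicator G x *\<^sub>R f x > c} \<in> sets borel"
      by measurable
    moreover have "\<omega> = {x \<in> space borel. indicator G x *\<^sub>R f x > c} \<inter> G \<inter> cball 0 (real n)"
      by (auto simp: \<omega>_def)
    ultimately have \<omega>: "\<omega> \<in> sets borel" "\<omega> \<subseteq> G"
      using G by (auto simp: \<omega>_def)
    have fin: "emeasure lborel \<omega> < \<infinity>"
      using emeasure_bounded_finite[of \<omega>] bounded_Int[of "{x \<in> G. f x > c}" "cball 0 (real n)"]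
      by (simp add: \<omega>_def)
    have int: "integrable lborel (\<lambda>x. indicator \<omega> x * f x)" "integrable lborel (\<lambda>x. indicator \<omega> x * c)"
      using f \<omega> fin by (auto simp: has_density_def set_integrable_def)
    have F: "F \<omega> = (\<integral>x. indicator \<omega> x * f x \<partial>lborel)"
      using f \<omega> by (simp add: has_density_def set_lebesgue_integral_def)
    have c: "c * measure lborel \<omega> = (\<integral>x. indicator \<omega> x * c \<partial>lborel)"
      using \<omega> by simp
    have "(\<integral>x. indicator \<omega> x * f x - indicator \<omega> x * c \<partial>lborel) \<le> 0"
      using le[OF \<omega> fin] by (simp only: Bochner_Integration.integral_diff[OF int] F c)
    moreover have nonneg: "AE x in lborel. 0 \<le> indicator \<omega> x * f x - indicator \<omega> x * c"
      by (intro AE_I2) (simp add: \<omega>_def indicator_def)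
    moreover have "(\<integral>x. indicator \<omega> x * f x - indicator \<omega> x * c \<partial>lborel) \<ge> 0"
      using nonneg by (rule integral_nonneg_AE)
    ultimately have "(\<integral>x. indicator \<omega> x * f x - indicator \<omega> x * c \<partial>lborel) = 0"
      by linarith
    then have "AE x in lborel. indicator \<omega> x * f x - indicator \<omega> x * c = 0"
      using integral_nonneg_eq_0_iff_AE[OF Bochner_Integration.integrable_diff[OF int] nonneg] by simp
    then show ?thesis
    proof (rule AE_mp, intro AE_I2 impI notI)
      fix x assume "indicator \<omega> x * f x - indicator \<omega> x * c = 0" "x \<in> {x \<in> G. f x > c} \<inter> cball 0 (real n)"
      then show False by (simp add: \<omega>_def)
    qed
  qed
  then have "AE x in lborel. \<forall>n. x \<notin> {x \<in> G. f x > c} \<inter> cball 0 (real n)"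
    by (intro AE_all_countable[THEN iffD2] allI)
  then show ?thesis
  proof (rule AE_mp, intro AE_I2 impI)
    fix x assume *: "\<forall>n. x \<notin> {x \<in> G. f x > c} \<inter> cball 0 (real n)" and "x \<in> G"
    obtain n where "\<bar>x\<bar> \<le> real n" using real_arch_simple by blast
    then show "f x \<le> c" using *[THEN spec, of n] \<open>x \<in> G\<close> by simp
  qed
qed

text \<open>Radon-Nikodym for the restriction of \<open>\<mu>\<close> to \<open>G\<close>, whose
  absolute continuity on the whole line follows from that on subsets of \<open>G\<close>.\<close>

lemma ex_has_density:
  assumes [measurable_cong]: "sets \<mu> = sets borel" and "finite_measure \<mu>" and G: "G \<in> sets borel"
    and null: "\<And>\<omega>. \<omega> \<in> null_sets lborel \<Longrightarrow> \<omega> \<subseteq> G \<Longrightarrow> emeasure \<mu> \<omega> = 0"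
  shows "\<exists>f. has_density (measure \<mu>) G f"
proof -
  interpret finite_measure \<mu> by fact
  define N where "N = density \<mu> (indicator G)"
  have N: "emeasure N \<omega> = emeasure \<mu> (G \<inter> \<omega>)" if "\<omega> \<in> sets borel" for \<omega>
    unfolding N_def by (rule emeasure_restricted) (use that G in \<open>auto simp: assms\<close>)
  have sets_N: "sets N = sets lborel" by (simp add: N_def assms)
  have fin: "finite_measure N"
    using N[of UNIV] by (intro finite_measureI) (simp add: sets_eq_imp_space_eq[OF sets_N] emeasure_eq_measure)
  have ac: "absolutely_continuous lborel N"
    unfolding absolutely_continuous_def
  proof
    fix \<omega> assume "\<omega> \<in> null_sets (lborel :: real measure)"
    moreover from this have "G \<inter> \<omega> \<in> null_sets lborel"
      using G by (intro null_set_Int1) auto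
    ultimately show "\<omega> \<in> null_sets N"
      using null[of "G \<inter> \<omega>"] N[of \<omega>] sets_N by (auto simp: null_sets_def)
  qed
  obtain D where D: "D \<in> borel_measurable lborel" "AE x in lborel. RN_deriv lborel N x = ennreal (D x)"
    "\<And>x. 0 \<le> D x"
    using sigma_finite_measure.real_RN_deriv[OF lborel.sigma_finite_measure_axioms fin ac sets_N] by metis
  have "N = density lborel (RN_deriv lborel N)"
    using sigma_finite_measure.density_RN_deriv[OF lborel.sigma_finite_measure_axioms ac sets_N] by simp
  also have "\<dots> = density lborel D"
    using D by (intro density_cong) auto
  finally have N_D: "N = density lborel D" .
  have "has_density (measure \<mu>) G D"
    unfolding has_density_def
  proof (intro conjI ballI impI)
    show "set_borel_measurable lborel G D"
      using D(1) G by (simp add: set_borel_measurable_def)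
    fix \<omega> :: "real set" assume \<omega>: "\<omega> \<in> sets borel" "\<omega> \<subseteq> G"
    have "(\<integral>\<^sup>+x. ennreal (indicator \<omega> x * D x) \<partial>lborel) = (\<integral>\<^sup>+x. ennreal (D x) * indicator \<omega> x \<partial>lborel)"
      by (intro nn_integral_cong) (simp add: indicator_def)
    also have "\<dots> = emeasure N \<omega>"
      unfolding N_D using D(1) \<omega> by (subst emeasure_density) auto
    also have "\<dots> = ennreal (measure \<mu> \<omega>)"
      using N[OF \<omega>(1)] \<omega>(2) by (simp add: emeasure_eq_measure Int_absorb1)
    finally have nn: "(\<integral>\<^sup>+x. ennreal (indicator \<omega> x * D x) \<partial>lborel) = ennreal (measure \<mu> \<omega>)" .
    have "integrable lborel (\<lambda>x. indicator \<omega> x * D x)"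
      using D \<omega> nn by (intro integrableI_nonneg) auto
    then show "set_integrable lborel \<omega> D"
      by (simp add: set_integrable_def)
    show "measure \<mu> \<omega> = set_lebesgue_integral lborel \<omega> D"
      unfolding set_lebesgue_integral_def using D \<omega> nn
      by (subst integral_eq_nn_integral) auto
  qed
  then show ?thesis by blast
qed

lemma matrix_density_on_iff: "matrix_density_on M G D \<longleftrightarrow> has_density M G D"
  by (simp add: matrix_density_on_def has_density_def)

lemma bounded_linear_matrix_form: "bounded_linear (\<lambda>X :: complex^'d^'d. (X *v v) \<bullet> w)"
proof -
  have "linear (\<lambda>X :: complex^'d^'d. (X *v v) \<bullet> w)"
  proof (rule linearI)
    fix X Y :: "complex^'d^'d" and c :: real
    show "((X + Y) *v v) \<bullet> w = (X *v v) \<bullet> w + (Y *v v) \<bullet> w"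
      by (simp add: matrix_vector_mult_add_rdistrib inner_add_left)
    have "(c *\<^sub>R X) *v v = c *\<^sub>R (X *v v)"
      by (simp add: vec_eq_iff matrix_vector_mult_def scaleR_sum_right)
    then show "((c *\<^sub>R X) *v v) \<bullet> w = c *\<^sub>R ((X *v v) \<bullet> w)" by simp
  qed
  then show ?thesis by (simp add: linear_conv_bounded_linear)
qed

lemma bounded_linear_adj: "bounded_linear (adj :: complex^'d^'d \<Rightarrow> complex^'d^'d)"
proof -
  have "linear (adj :: complex^'d^'d \<Rightarrow> complex^'d^'d)"
    by (rule linearI) (simp_all add: adj_def vec_eq_iff)
  then show ?thesis by (simp add: linear_conv_bounded_linear)
qed

text \<open>Estimates almost everywhere can be combined for countably many vectors \<open>v\<close>
  only; closedness of the form inequalities then extends them to all \<open>v\<close> outside one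
  null set.\<close>

lemma countable_dense:
  obtains V :: "'v::euclidean_space set" where "countable V" "closure V = UNIV"
proof -
  obtain V :: "'v set" where V: "countable V" "\<And>U. open U \<Longrightarrow> U \<noteq> {} \<Longrightarrow> \<exists>v\<in>V. v \<in> U"
    by (rule countable_dense_setE) blast
  have "x \<in> closure V" for x
    unfolding closure_iff_nhds_not_empty using V(2) by blast
  then show ?thesis using V(1) that by blast
qed

lemma closed_form_le:
  "closed {v :: complex^'d. c * (norm v)\<^sup>2 \<le> (X *v v) \<bullet> v}" "closed {v :: complex^'d. (X *v v) \<bullet> v \<le> c * (norm v)\<^sup>2}"
  by (intro closed_Collect_le continuous_intros linear_continuous_on
      linear_conv_bounded_linear[THEN iffD1, OF matrix_vector_linear])+

section \<open>The spectral matrix measure, its density, and the absolutely continuous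
  spectrum\<close>

context block_jacobi
begin

text \<open>The real locale only records real linearity of \<open>P \<omega>\<close>; complex
  homogeneity is recovered here from the projections \<open>E \<omega>\<close>.\<close>

lemma seq_P_\<delta>_scale:
  assumes "\<omega> \<in> sets borel"
  shows "seq_of (P \<omega> (\<delta> 0 (c *s v))) k = c *s seq_of (P \<omega> (\<delta> 0 v)) k"
proof -
  have "ortho_projection (E \<omega>)"
    using spectral assms by (simp add: spectral_measure_of_def proj_valued_measure_def)
  then have "E \<omega> (\<lambda>n. c *s seq_of (\<delta> 0 v) n + seq_of 0 n) = (\<lambda>n. c *s E \<omega> (seq_of (\<delta> 0 v)) n + E \<omega> (seq_of 0) n)"
    unfolding ortho_projection_def by (meson seq_of_in_ell2)
  moreover have "(\<lambda>n. c *s seq_of (\<delta> 0 v) n + seq_of 0 n) = seq_of (\<delta> 0 (c *s v))"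
    by (auto simp: seq_of_\<delta> seq_of_simps)
  ultimately have "E \<omega> (seq_of (\<delta> 0 (c *s v))) = (\<lambda>n. c *s E \<omega> (seq_of (\<delta> 0 v)) n + E \<omega> (seq_of 0) n)"
    by (simp only:)
  then have "seq_of (P \<omega> (\<delta> 0 (c *s v))) = (\<lambda>n. c *s seq_of (P \<omega> (\<delta> 0 v)) n + seq_of (P \<omega> 0) n)"
    by (simp only: seq_of_P[OF assms])
  then show ?thesis
    by (simp add: P_zero[OF assms] seq_of_simps)
qed

lemma matrix_measure_mult:
  assumes \<omega>: "\<omega> \<in> sets borel"
  shows "matrix_measure E \<omega> *v v = seq_of (P \<omega> (\<delta> 0 v)) 0"
proof -
  have entry: "matrix_measure E \<omega> $ i $ j = seq_of (P \<omega> (\<delta> 0 (axis j 1))) 0 $ i" for i j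
  proof -
    have "matrix_measure E \<omega> $ i $ j
        = (\<Sum>n. cinner (seq_of (P \<omega> (\<delta> 0 (axis j 1))) n) (seq_of (\<delta> 0 (axis i 1)) n))"
      by (simp add: matrix_measure_def ell2_inner_def delta0_eq seq_of_P[OF \<omega>])
    also have "\<dots> = (\<Sum>n\<in>{0}. cinner (seq_of (P \<omega> (\<delta> 0 (axis j 1))) n) (seq_of (\<delta> 0 (axis i 1)) n))"
      by (rule suminf_finite) (auto simp: seq_of_\<delta> cinner_def)
    also have "\<dots> = seq_of (P \<omega> (\<delta> 0 (axis j 1))) 0 $ i"
      by (simp add: seq_of_\<delta> cinner_def axis_def if_distrib cong: if_cong)
    finally show ?thesis .
  qed
  have \<delta>_add: "\<delta> 0 (v + w) = \<delta> 0 v + \<delta> 0 w" "\<delta> 0 0 = 0" for v w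
    by (simp_all add: seq_of_inject[symmetric] seq_of_\<delta> seq_of_simps fun_eq_iff)
  have "seq_of (P \<omega> (\<delta> 0 (\<Sum>j\<in>A. f j))) 0 = (\<Sum>j\<in>A. seq_of (P \<omega> (\<delta> 0 (f j))) 0)" for A and f :: "'d \<Rightarrow> complex^'d"
    by (induction A rule: infinite_finite_induct) (auto simp: \<delta>_add P_zero[OF \<omega>] P_add[OF \<omega>] seq_of_simps)
  then have "seq_of (P \<omega> (\<delta> 0 (\<Sum>j\<in>UNIV. v $ j *s axis j 1))) 0
      = (\<Sum>j\<in>UNIV. v $ j *s seq_of (P \<omega> (\<delta> 0 (axis j 1))) 0)"
    by (simp add: seq_P_\<delta>_scale[OF \<omega>])
  then show ?thesis
    by (simp add: basis_expansion vec_eq_iff matrix_vector_mult_def entry mult.commute)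
qed

lemma matrix_measure_form: "\<omega> \<in> sets borel \<Longrightarrow> (matrix_measure E \<omega> *v v) \<bullet> w = P \<omega> (\<delta> 0 v) \<bullet> \<delta> 0 w"
  by (simp add: matrix_measure_mult inner_\<delta>)

lemma hermitian_matrix_measure: "\<omega> \<in> sets borel \<Longrightarrow> adj (matrix_measure E \<omega>) = matrix_measure E \<omega>"
proof -
  assume \<omega>: "\<omega> \<in> sets borel"
  have "adj (matrix_measure E \<omega>) *v w = matrix_measure E \<omega> *v w" for w
  proof -
    have "v \<bullet> (adj (matrix_measure E \<omega>) *v w) = v \<bullet> (matrix_measure E \<omega> *v w)" for v
    proof -
      have "v \<bullet> (adj (matrix_measure E \<omega>) *v w) = P \<omega> (\<delta> 0 v) \<bullet> \<delta> 0 w"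
        using matrix_measure_form[OF \<omega>, of v w] by (simp only: adj_inner)
      also have "\<dots> = P \<omega> (\<delta> 0 w) \<bullet> \<delta> 0 v"
        by (simp only: P_sym[OF \<omega>, of "\<delta> 0 v"] inner_commute[of "\<delta> 0 v"])
      also have "\<dots> = v \<bullet> (matrix_measure E \<omega> *v w)"
        using matrix_measure_form[OF \<omega>, of w v] by (simp only: inner_commute)
      finally show ?thesis .
    qed
    then show ?thesis by (metis vector_eq_ldot)
  qed
  then show ?thesis by (simp add: matrix_eq)
qed

lemma has_density_form:
  assumes "has_density (matrix_measure E) G D"
  shows "has_density (measure (\<mu> (\<delta> 0 v))) G (\<lambda>x. (D x *v v) \<bullet> v)"
  using has_density_bounded_linear[OF bounded_linear_matrix_form assms, of v v]
  by (rule has_density_cong[rotated]) (simp add: matrix_measure_form measure_\<mu>)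

lemma P_\<delta>_null:
  assumes ts: "\<And>l. l \<in> G \<Longrightarrow> \<exists>K. two_sided K l" and "N \<in> null_sets lborel" "N \<subseteq> G"
  shows "P N (\<delta> 0 v) = 0"
proof -
  have N: "N \<in> sets borel" using assms(2) by auto
  have "emeasure (\<mu> (\<delta> 0 v)) N = 0"
  proof (rule null_of_frequently_ball_le[OF sets_\<mu> \<mu>.finite_measure_axioms assms(2)])
    fix l assume "l \<in> N"
    then obtain K where "two_sided K l" using ts \<open>N \<subseteq> G\<close> by blast
    then show "\<exists>c. \<forall>d>0. \<exists>r>0. r < d \<and> measure (\<mu> (\<delta> 0 v)) (cball l r) \<le> c * r"
      unfolding two_sided_def by (intro exI[of _ "K * (norm v)\<^sup>2"]) blast
  qed
  then show ?thesis using emeasure_\<mu>[OF N, of "\<delta> 0 v"] by (simp add: P_form[OF N] ennreal_eq_0_iff)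
qed

lemma P_null:
  assumes "\<And>l. l \<in> G \<Longrightarrow> \<exists>K. two_sided K l" and "N \<in> null_sets lborel" "N \<subseteq> G"
  shows "P N x = 0"
proof (rule P_eq_zero_of_cyclic)
  show "N \<in> sets borel" using assms(2) by auto
  show "P N (\<delta> 0 v) = 0" for v by (rule P_\<delta>_null[OF assms])
qed

text \<open>Each real coordinate of the matrix measure is a combination of three scalar measures by
  polarization. These have densities by absolute continuity, and the matrix density is assembled
  from the coordinates.\<close>

lemma ex_matrix_density:
  assumes ts: "\<And>l. l \<in> G \<Longrightarrow> \<exists>K. two_sided K l" and G: "G \<in> sets borel"
  shows "\<exists>D. has_density (matrix_measure E) G D"
proof -
  have "\<exists>f. has_density (measure (\<mu> x)) G f" for x
  proof (rule ex_has_density[OF sets_\<mu> \<mu>.finite_measure_axioms G])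
    fix N assume N: "N \<in> null_sets (lborel :: real measure)" "N \<subseteq> G"
    then have "P N x = 0" using P_null[of G N x] ts by blast
    moreover have "N \<in> sets borel" using N(1) by auto
    ultimately show "emeasure (\<mu> x) N = 0" by (simp add: emeasure_\<mu>)
  qed
  then obtain f where f: "\<And>x. has_density (measure (\<mu> x)) G (f x)" by metis
  have "\<exists>g. has_density (\<lambda>\<omega>. matrix_measure E \<omega> \<bullet> b) G g" if "b \<in> Basis" for b
  proof -
    \<comment> \<open>The scalar \<open>c\<close> is \<open>1\<close> or the imaginary unit and
      selects the real or the imaginary part of the entry.\<close>
    obtain i j c where b: "b = axis i (axis j c)"
      using \<open>b \<in> Basis\<close> by (auto simp: Basis_vec_def)
    define x y where "x = \<delta> 0 (axis j 1)" and "y = \<delta> 0 (axis i c)"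
    have "matrix_measure E \<omega> \<bullet> b
        = (1 / 2) *\<^sub>R measure (\<mu> (x + y)) \<omega> + ((- 1 / 2) *\<^sub>R measure (\<mu> x) \<omega> + (- 1 / 2) *\<^sub>R measure (\<mu> y) \<omega>)"
      if \<omega>: "\<omega> \<in> sets borel" for \<omega>
    proof -
      have "matrix_measure E \<omega> \<bullet> b = (matrix_measure E \<omega> *v axis j 1) \<bullet> axis i c"
      proof -
        have "(matrix_measure E \<omega> *v axis j 1) $ i = matrix_measure E \<omega> $ i $ j"
          by (simp add: matrix_vector_mult_def axis_def if_distrib cong: if_cong)
        then show ?thesis by (simp add: b inner_axis)
      qed
      also have "\<dots> = P \<omega> x \<bullet> y"
        unfolding x_def y_def by (rule matrix_measure_form[OF \<omega>])
      finally show ?thesis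
        using P_sym[OF \<omega>, of x y]
        by (simp add: measure_\<mu>[OF \<omega>] P_add[OF \<omega>] inner_add_left inner_add_right inner_commute field_simps)
    qed
    moreover have "has_density (\<lambda>\<omega>. (1 / 2) *\<^sub>R measure (\<mu> (x + y)) \<omega>
          + ((- 1 / 2) *\<^sub>R measure (\<mu> x) \<omega> + (- 1 / 2) *\<^sub>R measure (\<mu> y) \<omega>)) G
        (\<lambda>t. (1 / 2) *\<^sub>R f (x + y) t + ((- 1 / 2) *\<^sub>R f x t + (- 1 / 2) *\<^sub>R f y t))"
      by (intro has_density_add has_density_bounded_linear[OF bounded_linear_scaleR_right] f)
    ultimately show ?thesis
      using has_density_cong[of G] by (metis (no_types, lifting))
  qed
  then obtain g where g: "\<And>b. b \<in> Basis \<Longrightarrow> has_density (\<lambda>\<omega>. matrix_measure E \<omega> \<bullet> b) G (g b)" by metis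
  have "has_density (\<lambda>\<omega>. \<Sum>b\<in>Basis. (matrix_measure E \<omega> \<bullet> b) *\<^sub>R b) G (\<lambda>t. \<Sum>b\<in>Basis. g b t *\<^sub>R b)"
    by (intro has_density_sum has_density_bounded_linear[OF bounded_linear_scaleR_left] g)
  then show ?thesis by (auto simp: euclidean_representation)
qed

text \<open>The quantifier over \<open>K\<close> stands inside the almost-everywhere statement: the
  null set serves all \<open>K\<close> at once, so \<open>K\<close> may depend on \<open>l\<close>.
  For fixed \<open>v\<close>, \<open>AE_density_ge\<close> is used with
  \<open>C = K / (norm v)\<^sup>2\<close>.\<close>

lemma AE_density_lower:
  assumes D: "has_density (matrix_measure E) G D" and G: "G \<in> sets borel"
  shows "AE l in lborel. l \<in> G \<longrightarrow> (\<forall>K>0. two_sided K l \<longrightarrow> (\<forall>v. 1 / (8 * K) * (norm v)\<^sup>2 \<le> (D l *v v) \<bullet> v))"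
proof -
  obtain V :: "(complex^'d) set" where V: "countable V" "closure V = UNIV"
    by (rule countable_dense)
  have "AE l in lborel. \<forall>v\<in>V. l \<in> G \<longrightarrow> (\<forall>C>0.
      (\<forall>d>0. \<exists>e>0. e < d \<and> (\<exists>J. e / C \<le> (\<Sum>j\<le>J. (1 / 16) ^ j * measure (\<mu> (\<delta> 0 v)) (ball l (4 ^ j * e)))))
        \<longrightarrow> 1 / (8 * C) \<le> (D l *v v) \<bullet> v)"
    unfolding AE_ball_countable[OF V(1)]
    using has_density_form[OF D] unfolding has_density_def
    by (intro ballI AE_density_ge[OF sets_\<mu> \<mu>.finite_measure_axioms G]) auto
  then show ?thesis
  proof (rule AE_mp, intro AE_I2 impI allI)
    fix l K and v :: "complex^'d"
    assume *: "\<forall>v\<in>V. l \<in> G \<longrightarrow> (\<forall>C>0.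
      (\<forall>d>0. \<exists>e>0. e < d \<and> (\<exists>J. e / C \<le> (\<Sum>j\<le>J. (1 / 16) ^ j * measure (\<mu> (\<delta> 0 v)) (ball l (4 ^ j * e)))))
        \<longrightarrow> 1 / (8 * C) \<le> (D l *v v) \<bullet> v)" and "l \<in> G" and "K > 0" and ts: "two_sided K l"
    have "V \<subseteq> {v. 1 / (8 * K) * (norm v)\<^sup>2 \<le> (D l *v v) \<bullet> v}"
    proof
      fix v assume "v \<in> V"
      show "v \<in> {v. 1 / (8 * K) * (norm v)\<^sup>2 \<le> (D l *v v) \<bullet> v}"
      proof (cases "v = 0")
        case False
        define C where "C = K / (norm v)\<^sup>2"
        have "C > 0" using False \<open>K > 0\<close> by (simp add: C_def)
        have "\<forall>d>0. \<exists>e>0. e < d \<and> (\<exists>J. e / C \<le> (\<Sum>j\<le>J. (1 / 16) ^ j * measure (\<mu> (\<delta> 0 v)) (ball l (4 ^ j * e))))"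
        proof (intro allI impI)
          fix d :: real assume "d > 0"
          then obtain e where e: "e > 0" "e < d"
            "\<exists>J. e * (norm v)\<^sup>2 / K \<le> (\<Sum>j\<le>J. (1 / 16) ^ j * measure (\<mu> (\<delta> 0 v)) (ball l (4 ^ j * e)))"
            using ts False unfolding two_sided_def by blast
          then show "\<exists>e>0. e < d \<and> (\<exists>J. e / C \<le> (\<Sum>j\<le>J. (1 / 16) ^ j * measure (\<mu> (\<delta> 0 v)) (ball l (4 ^ j * e))))"
            by (auto simp: C_def)
        qed
        then have "1 / (8 * C) \<le> (D l *v v) \<bullet> v"
          using * \<open>v \<in> V\<close> \<open>l \<in> G\<close> \<open>C > 0\<close> by blast
        then show ?thesis by (simp add: C_def)
      qed simp
    qed
    then have "closure V \<subseteq> {v. 1 / (8 * K) * (norm v)\<^sup>2 \<le> (D l *v v) \<bullet> v}"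
      by (rule closure_minimal) (rule closed_form_le)
    then show "1 / (8 * K) * (norm v)\<^sup>2 \<le> (D l *v v) \<bullet> v"
      unfolding V(2) by blast
  qed
qed

text \<open>Here \<open>K\<close> is common to all points of \<open>G\<close>, so the ball estimate
  bounds the scalar measures of all Borel subsets by a multiple of the Lebesgue measure.\<close>

lemma AE_density_upper:
  assumes D: "has_density (matrix_measure E) G D" and G: "G \<in> sets borel"
    and "K > 0" and ts: "\<And>l. l \<in> G \<Longrightarrow> two_sided K l"
  shows "AE l in lborel. l \<in> G \<longrightarrow> (\<forall>v. (D l *v v) \<bullet> v \<le> 5 / 2 * K * (norm v)\<^sup>2)"
proof -
  obtain V :: "(complex^'d) set" where V: "countable V" "closure V = UNIV"
    by (rule countable_dense)
  have "AE l in lborel. l \<in> G \<longrightarrow> (D l *v v) \<bullet> v \<le> 5 / 2 * K * (norm v)\<^sup>2" for v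
  proof (rule AE_density_le[OF has_density_form[OF D] G])
    fix \<omega> :: "real set"
    assume \<omega>: "\<omega> \<in> sets borel" "\<omega> \<subseteq> G" "emeasure lborel \<omega> < \<infinity>"
    have "emeasure (\<mu> (\<delta> 0 v)) \<omega> \<le> ennreal (5 / 2 * (K * (norm v)\<^sup>2)) * emeasure lborel \<omega>"
    proof (rule measure_le_of_frequently_ball_le[OF sets_\<mu> \<omega>(1)])
      fix l d :: real assume "l \<in> \<omega>" "d > 0"
      then obtain e where e: "e > 0" "e < d" "measure (\<mu> (\<delta> 0 v)) (cball l e) \<le> K * (norm v)\<^sup>2 * e"
        using ts[of l] \<omega>(2) unfolding two_sided_def by blast
      moreover have "measure (\<mu> (\<delta> 0 v)) (ball l e) \<le> measure (\<mu> (\<delta> 0 v)) (cball l e)"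
        by (intro \<mu>.finite_measure_mono) auto
      ultimately show "\<exists>r>0. r < d \<and> emeasure (\<mu> (\<delta> 0 v)) (ball l r) \<le> ennreal (K * (norm v)\<^sup>2 * r)"
        by (intro exI[of _ e]) (auto simp: \<mu>.emeasure_eq_measure intro!: ennreal_leI)
    qed (use \<open>K > 0\<close> in simp)
    also have "\<dots> = ennreal (5 / 2 * K * (norm v)\<^sup>2 * measure lborel \<omega>)"
      using \<omega>(3) \<open>K > 0\<close> by (simp add: emeasure_eq_ennreal_measure less_top ennreal_mult[symmetric] mult.assoc)
    finally show "measure (\<mu> (\<delta> 0 v)) \<omega> \<le> 5 / 2 * K * (norm v)\<^sup>2 * measure lborel \<omega>"
      using \<open>K > 0\<close> by (simp add: \<mu>.emeasure_eq_measure ennreal_le_iff)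
  qed
  then have "AE l in lborel. \<forall>v\<in>V. l \<in> G \<longrightarrow> (D l *v v) \<bullet> v \<le> 5 / 2 * K * (norm v)\<^sup>2"
    unfolding AE_ball_countable[OF V(1)] by blast
  then show ?thesis
  proof (rule AE_mp, intro AE_I2 impI allI)
    fix l v assume "\<forall>v\<in>V. l \<in> G \<longrightarrow> (D l *v v) \<bullet> v \<le> 5 / 2 * K * (norm v)\<^sup>2" "l \<in> G"
    then have "closure V \<subseteq> {v. (D l *v v) \<bullet> v \<le> 5 / 2 * K * (norm v)\<^sup>2}"
      by (intro closure_minimal closed_form_le) auto
    then show "(D l *v v) \<bullet> v \<le> 5 / 2 * K * (norm v)\<^sup>2"
      unfolding V(2) by blast
  qed
qed

text \<open>The zero set function \<open>adj M - M\<close> has density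
  \<open>adj (D l) - D l\<close>. Pairing with finitely many basis vectors of either sign reduces
  its vanishing to \<open>AE_density_le\<close> with bound \<open>0\<close>.\<close>

lemma AE_density_hermitian:
  assumes D: "has_density (matrix_measure E) G D" and G: "G \<in> sets borel"
  shows "AE l in lborel. l \<in> G \<longrightarrow> hermitian (D l)"
proof -
  have "AE l in lborel. l \<in> G \<longrightarrow> (adj (D l) - D l) \<bullet> b \<le> 0" for b
  proof -
    have "has_density (\<lambda>\<omega>. (adj (matrix_measure E \<omega>) - matrix_measure E \<omega>) \<bullet> b) G (\<lambda>l. (adj (D l) - D l) \<bullet> b)"
      using has_density_bounded_linear[OF _ D, of "\<lambda>X. (adj X - X) \<bullet> b"]
      by (simp add: bounded_linear_inner_left_comp bounded_linear_sub bounded_linear_adj bounded_linear_ident)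
    then have "AE l in lborel. l \<in> G \<longrightarrow> (adj (D l) - D l) \<bullet> b \<le> 0"
      using G by (rule AE_density_le) (simp add: hermitian_matrix_measure)
    then show ?thesis .
  qed
  then have "AE l in lborel. \<forall>b\<in>(Basis \<union> uminus ` Basis). l \<in> G \<longrightarrow> (adj (D l) - D l) \<bullet> b \<le> 0"
    by (subst AE_finite_all) auto
  then show ?thesis
  proof (rule AE_mp, intro AE_I2 impI)
    fix l assume *: "\<forall>b\<in>(Basis \<union> uminus ` Basis). l \<in> G \<longrightarrow> (adj (D l) - D l) \<bullet> b \<le> 0" "l \<in> G"
    have "(adj (D l) - D l) \<bullet> b = 0 \<bullet> b" if "b \<in> Basis" for b
    proof (rule antisym)
      show "(adj (D l) - D l) \<bullet> b \<le> 0 \<bullet> b" using *(1)[THEN bspec, of b] *(2) that by simp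
      show "0 \<bullet> b \<le> (adj (D l) - D l) \<bullet> b" using *(1)[THEN bspec, of "- b"] *(2) that by simp
    qed
    then have "adj (D l) - D l = 0" by (rule euclidean_eqI)
    then show "hermitian (D l)" by (simp add: hermitian_def)
  qed
qed

lemma abs_cont_in_of_null:
  assumes null: "\<And>N x. N \<in> null_sets lborel \<Longrightarrow> N \<subseteq> G \<Longrightarrow> P N x = 0" and G: "G \<in> sets borel"
  shows "abs_cont_in E G"
proof -
  have "E G (seq_of y) \<in> H_ac E" for y
  proof -
    have "absolutely_continuous lborel (spectral_mu P (P G y))"
      unfolding absolutely_continuous_def
    proof
      fix N assume N: "N \<in> null_sets (lborel :: real measure)"
      then have "N \<in> sets borel" "N \<inter> G \<in> null_sets lborel"
        using G by (auto intro: null_set_Int2)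
      then show "N \<in> null_sets (spectral_mu P (P G y))"
        using null[of "N \<inter> G" y] G by (auto simp: null_sets_def emeasure_\<mu> P_Int)
    qed
    then show ?thesis
      using G by (simp add: H_ac_def seq_of_P[symmetric] scalar_measure_eq)
  qed
  then show ?thesis by (auto simp: abs_cont_in_def ell2_iff)
qed

text \<open>Nonzero vectors in the range of \<open>P (G \<inter> I)\<close>, with \<open>I\<close> a
  short interval around \<open>t\<close>, are approximate eigenvectors inside \<open>H_ac E\<close>.
  They violate the resolvent bound that holds off the spectrum.\<close>

lemma ess_closure_subset_ac_spectrum:
  assumes ac: "abs_cont_in E G" and G: "G \<in> sets borel"
    and pos: "\<And>I. open I \<Longrightarrow> emeasure lborel (G \<inter> I) > 0 \<Longrightarrow> \<exists>x. P (G \<inter> I) x \<noteq> 0"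
  shows "complex_of_real ` ess_closure G \<subseteq> ac_spectrum (jacobi_op A B) E"
proof (rule image_subsetI)
  fix t assume t: "t \<in> ess_closure G"
  show "complex_of_real t \<in> ac_spectrum (jacobi_op A B) E"
  proof (rule ccontr)
    assume "complex_of_real t \<notin> ac_spectrum (jacobi_op A B) E"
    then obtain C where C: "\<And>u. u \<in> fst (jacobi_op A B) \<inter> H_ac E \<Longrightarrow>
        ell2_norm u \<le> C * ell2_norm (\<lambda>n. jacobi_expr A B u n - complex_of_real t *s u n)"
      by (auto simp: ac_spectrum_def spectrum_in_def jacobi_op_def)
    \<comment> \<open>Makes \<open>\<bar>C\<bar> * e < 1\<close>, whatever the sign of
      \<open>C\<close>.\<close>
    define e where "e = 1 / (\<bar>C\<bar> + 1)"
    have "e > 0" by (simp add: e_def add_nonneg_pos)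
    define I where "I = {t - e<..<t + e}"
    have I: "open I" "I \<in> sets borel" "I \<subseteq> cball t e"
      by (auto simp: I_def dist_real_def)
    have "emeasure lborel (G \<inter> I) > 0"
      using t \<open>e > 0\<close> by (simp add: ess_closure_def I_def)
    then obtain y where y: "P (G \<inter> I) y \<noteq> 0" using pos I by blast
    have GI: "G \<inter> I \<in> sets borel" using G I by auto
    define x where "x = P (G \<inter> I) y"
    have x: "P (G \<inter> I) x = x" "x \<noteq> 0"
      using y by (auto simp: x_def P_idem[OF GI])
    have "bounded (G \<inter> I)" using I(3) bounded_cball bounded_subset by blast
    then have Dm: "x \<in> Dm" unfolding x_def using GI by (rule P_bounded_in_Dm[rotated])
    have "P G x = x"
      unfolding x_def by (rule P_P_subset[OF GI G]) auto
    then have "seq_of x = E G (seq_of x)"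
      using seq_of_P[OF G, of x] by simp
    then have "seq_of x \<in> H_ac E"
      using ac unfolding abs_cont_in_def by (metis imageI seq_of_in_ell2 subsetD)
    moreover have "(\<lambda>n. jacobi_expr A B (seq_of x) n - complex_of_real t *s seq_of x n) = seq_of (S x - t *\<^sub>R x)"
      by (simp add: seq_of_simps seq_of_S[OF Dm] of_real_smult)
    ultimately have "norm x \<le> C * norm (S x - t *\<^sub>R x)"
      using C[of "seq_of x"] Dm by (simp add: Dm_def ell2_norm_seq_of)
    also have "\<dots> \<le> \<bar>C\<bar> * (e * norm x)"
      using norm_shift_le[OF GI x(1) _ \<open>e > 0\<close>, of t] I(3) by (intro mult_mono) auto
    finally have "1 * norm x \<le> (\<bar>C\<bar> * e) * norm x" by simp
    then have "1 \<le> \<bar>C\<bar> * e" using x(2) by (simp only: mult_le_cancel_right) simp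
    then show False by (simp add: e_def field_simps)
  qed
qed

end

lemma invertible_of_form_pos:
  fixes X :: "complex^'d^'d"
  assumes "\<And>v. c * (norm v)\<^sup>2 \<le> (X *v v) \<bullet> v" "c > 0"
  shows "invertible X"
proof -
  have "v = 0" if "X *v v = 0" for v
    using assms(1)[of v] \<open>c > 0\<close> that by (simp add: mult_le_0_iff)
  then show ?thesis
    by (metis invertible_left_inverse matrix_left_invertible_ker)
qed

theorem theorem1p3:
  fixes A B :: "nat \<Rightarrow> complex^('d::finite)^'d"
    and E :: "real set \<Rightarrow> 'd vseq \<Rightarrow> 'd vseq"
    and G :: "real set"
    and b :: "real \<Rightarrow> real \<Rightarrow> real"
  assumes "\<And>n. det (A n) \<noteq> 0"
    and "\<And>n. hermitian (B n)"
    and "selfadjoint (jacobi_op A B)"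
    and "spectral_measure_of (jacobi_op A B) E"
    and "G \<noteq> {}" and "G \<in> sets borel"
    and "barrier A B G b"
    and "nonsubordinate b G"
  shows "matrix_abs_cont_on (matrix_measure E) G
    \<and> (\<exists>D. matrix_density_on (matrix_measure E) G D
           \<and> (AE l in lborel. l \<in> G \<longrightarrow> invertible (D l)))
    \<and> abs_cont_in E G
    \<and> complex_of_real ` ess_closure G \<subseteq> ac_spectrum (jacobi_op A B) E
    \<and> (uniformly_nonsubordinate b G \<longrightarrow>
        (\<exists>c1>0. \<exists>c2>0. \<forall>D. matrix_density_on (matrix_measure E) G D \<longrightarrow>
           (AE l in lborel. l \<in> G \<longrightarrow>
              herm_le (mat (complex_of_real c1)) (D l) \<and>
              herm_le (D l) (mat (complex_of_real c2)))))"
proof -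
  interpret block_jacobi A B E
    using assms by unfold_locales
  note G = \<open>G \<in> sets borel\<close>
  have ts_of_Liminf: "two_sided (4 + 36 * (dim * \<beta>)) l"
    if "l \<in> G" "\<beta> > 0" "Liminf at_top (\<lambda>t. ereal (b l t)) < ereal \<beta>" for l \<beta>
    using assms(7) that frequently_le_of_Liminf_less by (intro two_sided_of_barrier) auto
  have K_pos: "4 + 36 * (dim * \<beta>) > 0" if "\<beta> > 0" for \<beta>
    using dim_pos that by (simp add: add_pos_pos)
  have pos_bound: "\<exists>\<beta>>0. x < ereal \<beta>" if "x < \<infinity>" for x
  proof (cases x)
    case (real r)
    then show ?thesis by (intro exI[of _ "\<bar>r\<bar> + 1"]) auto
  qed (use that in \<open>auto intro: exI[of _ 1]\<close>)
  have ts: "\<exists>K>0. two_sided K l" if l: "l \<in> G" for l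
  proof -
    have "Liminf at_top (\<lambda>t. ereal (b l t)) < \<infinity>"
      using assms(8) l by (simp add: nonsubordinate_def)
    then obtain \<beta> where "\<beta> > 0" "Liminf at_top (\<lambda>t. ereal (b l t)) < ereal \<beta>"
      using pos_bound by blast
    then show ?thesis using ts_of_Liminf[OF l] K_pos by blast
  qed
  then have null: "P N x = 0" if "N \<in> null_sets lborel" "N \<subseteq> G" for N x
    using P_null[OF _ that] ts by blast
  obtain D where D: "has_density (matrix_measure E) G D"
    using ex_matrix_density[OF _ G] ts by blast
  have D_pos: "AE l in lborel. l \<in> G \<longrightarrow> (\<exists>c>0. \<forall>v. c * (norm v)\<^sup>2 \<le> (D l *v v) \<bullet> v)"
    using AE_density_lower[OF D G]
  proof (rule AE_mp, intro AE_I2 impI)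
    fix l assume *: "l \<in> G \<longrightarrow> (\<forall>K>0. two_sided K l \<longrightarrow> (\<forall>v. 1 / (8 * K) * (norm v)\<^sup>2 \<le> (D l *v v) \<bullet> v))"
      and l: "l \<in> G"
    obtain K where "K > 0" "two_sided K l" using ts l by blast
    then show "\<exists>c>0. \<forall>v. c * (norm v)\<^sup>2 \<le> (D l *v v) \<bullet> v"
      using * l by (intro exI[of _ "1 / (8 * K)"]) auto
  qed
  have "matrix_abs_cont_on (matrix_measure E) G"
    unfolding matrix_abs_cont_on_def
  proof (intro ballI impI)
    fix N assume N: "N \<in> null_sets (lborel :: real measure)" "N \<subseteq> G"
    then have "matrix_measure E N *v v = 0 *v v" for v
      using null[OF N] by (subst matrix_measure_mult) (auto simp: seq_of_simps)
    then show "matrix_measure E N = 0" by (simp add: matrix_eq)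
  qed
  moreover have "AE l in lborel. l \<in> G \<longrightarrow> invertible (D l)"
    using D_pos by (rule AE_mp) (auto intro!: AE_I2 invertible_of_form_pos)
  moreover have ac: "abs_cont_in E G"
    by (rule abs_cont_in_of_null[OF null G])
  moreover have "complex_of_real ` ess_closure G \<subseteq> ac_spectrum (jacobi_op A B) E"
  \<comment> \<open>If \<open>P (G \<inter> I)\<close> vanished, the form of \<open>D\<close> would
    be nonpositive almost everywhere on \<open>G \<inter> I\<close>. Since it is also positive
    almost everywhere there, \<open>G \<inter> I\<close> would be a null set.\<close>
  proof (rule ess_closure_subset_ac_spectrum[OF ac G], rule ccontr)
    fix I :: "real set"
    assume I: "open I" "emeasure lborel (G \<inter> I) > 0" and "\<not> (\<exists>x. P (G \<inter> I) x \<noteq> 0)"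
    then have zero: "P (G \<inter> I) x = 0" for x by blast
    have GI: "G \<inter> I \<in> sets borel" using G I by auto
    define v :: "complex^'d" where "v = axis undefined 1"
    have v: "norm v = 1" by (simp add: v_def norm_axis_1)
    have "has_density (measure (\<mu> (\<delta> 0 v))) (G \<inter> I) (\<lambda>x. (D x *v v) \<bullet> v)"
      by (rule has_density_subset[OF has_density_form[OF D] GI]) auto
    then have "AE l in lborel. l \<in> G \<inter> I \<longrightarrow> (D l *v v) \<bullet> v \<le> 0"
    proof (rule AE_density_le[OF _ GI])
      fix \<omega> :: "real set" assume \<omega>: "\<omega> \<in> sets borel" "\<omega> \<subseteq> G \<inter> I"
      then show "measure (\<mu> (\<delta> 0 v)) \<omega> \<le> 0 * measure lborel \<omega>"
        using P_P_subset[OF \<omega>(1) GI \<omega>(2), of "\<delta> 0 v"] zero by (simp add: measure_\<mu>)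
    qed
    then have "AE l in lborel. l \<notin> G \<inter> I"
      using D_pos
    proof eventually_elim
      case (elim l)
      show ?case
      proof
        assume l: "l \<in> G \<inter> I"
        then obtain c where "c > 0" "c * (norm v)\<^sup>2 \<le> (D l *v v) \<bullet> v" using elim by blast
        then show False using elim(1) l v by auto
      qed
    qed
    then have "emeasure lborel {l \<in> space lborel. l \<in> G \<inter> I} = 0"
      by (rule emeasure_eq_0_AE)
    moreover have "{l \<in> space lborel. l \<in> G \<inter> I} = G \<inter> I" by auto
    ultimately show False using I(2) by (metis less_irrefl)
  qed
  moreover have "\<exists>c1>0. \<exists>c2>0. \<forall>D. matrix_density_on (matrix_measure E) G D \<longrightarrow>
           (AE l in lborel. l \<in> G \<longrightarrow>
              herm_le (mat (complex_of_real c1)) (D l) \<and>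
              herm_le (D l) (mat (complex_of_real c2)))"
    if unif: "uniformly_nonsubordinate b G"
  proof -
    obtain \<beta> where \<beta>: "\<beta> > 0" "(SUP l\<in>G. Liminf at_top (\<lambda>t. ereal (b l t))) < ereal \<beta>"
      using pos_bound[OF unif[unfolded uniformly_nonsubordinate_def]] by (elim exE conjE)
    define K where "K = 4 + 36 * (dim * \<beta>)"
    have "K > 0" using K_pos \<beta>(1) by (simp add: K_def)
    \<comment> \<open>The supremum supplies one \<open>\<beta>\<close>, hence one \<open>K\<close>,
      for all points of \<open>G\<close>; the bounds \<open>1 / (8 * K)\<close> and
      \<open>5 / 2 * K\<close> are then independent of the chosen density.\<close>
    have ts: "two_sided K l" if "l \<in> G" for l
      unfolding K_def using \<beta> that
      by (intro ts_of_Liminf) (auto intro: SUP_upper order_le_less_trans)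
    have herm_mat: "hermitian (mat (complex_of_real c) :: complex^'d^'d)" for c
      by (simp add: hermitian_def adj_mat)
    have form_mat: "Re (cinner (mat (complex_of_real c) *v v) v) = c * (norm v)\<^sup>2" for c and v :: "complex^'d"
      by (simp add: Re_cinner mat_vector_mult of_real_smult power2_norm_eq_inner)
    have "AE l in lborel. l \<in> G \<longrightarrow>
              herm_le (mat (complex_of_real (1 / (8 * K)))) (D l) \<and>
              herm_le (D l) (mat (complex_of_real (5 / 2 * K)))"
      if D: "matrix_density_on (matrix_measure E) G D" for D
    proof -
      have D: "has_density (matrix_measure E) G D"
        using D by (simp add: matrix_density_on_iff)
      have "AE l in lborel. l \<in> G \<longrightarrow> (\<forall>v. (D l *v v) \<bullet> v \<le> 5 / 2 * K * (norm v)\<^sup>2)"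
        by (rule AE_density_upper[OF D G \<open>K > 0\<close>]) (rule ts)
      with AE_density_lower[OF D G] AE_density_hermitian[OF D G] show ?thesis
      proof eventually_elim
        case (elim l)
        show ?case
        proof
          assume l: "l \<in> G"
          then have "1 / (8 * K) * (norm v)\<^sup>2 \<le> (D l *v v) \<bullet> v" "(D l *v v) \<bullet> v \<le> 5 / 2 * K * (norm v)\<^sup>2" for v
            using elim \<open>K > 0\<close> ts by blast+
          then show "herm_le (mat (complex_of_real (1 / (8 * K)))) (D l) \<and>
              herm_le (D l) (mat (complex_of_real (5 / 2 * K)))"
            using elim l unfolding herm_le_def form_mat by (simp only: herm_mat Re_cinner) blast
        qed
      qed
    qed
    then show ?thesis
      using \<open>K > 0\<close> by (intro exI[of _ "1 / (8 * K)"] exI[of _ "5 / 2 * K"] conjI) auto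
  qed
  ultimately show ?thesis
    using D by (auto simp: matrix_density_on_iff)
qed

end
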